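(* Let $\rho\le1$ and let $\mathcal{A}$ be a polynomial time $\rho$-approximation algorithm for the $\mathscr{F}$-PCM problem. Then there is a polynomial time $(3,\rho)$-bi-criteria approximation algorithm for the Robust $\mathscr{F}$-Supplier problem.
   Context: Robust $\mathscr{F}$-Supplier problem: input $\mathscr{I}=(F,C,d,m,\mathscr{F})$ with $X=F\cup C$ finite, $d$ a metric on $X$, $\mathscr{F}\subseteq2^F$ down-closed, and $m\in\{0,\dots,|C|\}$; with $d(v,S)=\min_{u\in S}d(v,u)$, the goal is to find $S\in\mathscr{F}$ and $T\subseteq C$ with $|T|\ge m$ minimizing $\max_{u\in T}d(u,S)$, with optimum $\mathsf{opt}(\mathscr{I})$. An $(\alpha,\beta)$-bi-criteria approximation algorithm returns $S\in\mathscr{F}$ such that at least $\beta m$ customers $v\in C$ satisfy $d(v,S)\le\alpha\,\mathsf{opt}(\mathscr{I})$. $\mathscr{F}$-PCM problem: input $\mathscr{J}=(F,\mathscr{F},\mathscr{P},\mathsf{val})$ with $\mathscr{P}$ a sub-partition of $F$ (pairwise disjoint subsets) and $\mathsf{val}:F\to\{0,1,2,\dots\}$ poly-bounded and constant on each part of $\mathscr{P}$; $\mathsf{opt}(\mathscr{J})=\max\{\mathsf{val}(S):S\in\mathscr{F},|S\cap A|\le1\ \forall A\in\mathscr{P}\}$ with $\mathsf{val}(S)=\sum_{f\in S}\mathsf{val}(f)$. A $\rho$-approximation algorithm for $\mathscr{F}$-PCM returns a feasible $S$ (i.e. $S\in\mathscr{F}$ with $|S\cap A|\le1$ for all $A\in\mathscr{P}$)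 with $\mathsf{val}(S)\ge\rho\,\mathsf{opt}(\mathscr{J})$.
   Formalization: The formal theorem additionally assumes that the ratio ρ is polynomial-time, i.e. q ≥ ρm is decidable in time polynomial in q and m (true for all rationals); for other ρ in (0,1] the claim fails for suitable implicitly represented families. *)

theory Defs
  imports "HOL-Analysis.Analysis" "HOL-Computational_Algebra.Polynomial"
begin

section \<open>Polynomial-time computation\<close>

text \<open>
  The machine model is the WHILE language over binary trees (N. D. Jones, \<^emph>\<open>Computability and
  Complexity from a Programming Perspective\<close>). An assignment costs the size of the tree it stores,
  so within time \<open>t\<close> only trees of size at most \<open>t\<close> plus the input size can be built, and Turing
  machines and WHILE programs simulate each other with polynomial overhead. A program uses only
  the finitely many variables that occur in it.
\<close>

datatype data = Atom | Pair data data

datatype expr = Var nat | EAtom | EPair expr expr | Hd expr | Tl expr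

type_synonym store = "nat \<Rightarrow> data"

fun head :: "data \<Rightarrow> data" where
  "head Atom = Atom"
| "head (Pair a b) = a"

fun tail :: "data \<Rightarrow> data" where
  "tail Atom = Atom"
| "tail (Pair a b) = b"

primrec evaluate :: "expr \<Rightarrow> store \<Rightarrow> data" where
  "evaluate (Var i) s = s i"
| "evaluate EAtom s = Atom"
| "evaluate (EPair e f) s = Pair (evaluate e s) (evaluate f s)"
| "evaluate (Hd e) s = head (evaluate e s)"
| "evaluate (Tl e) s = tail (evaluate e s)"

datatype com =
    Skip
  | Assign nat expr
  | Seq com com
  | If expr com com
  | While expr com

text \<open>
  \<open>exec c s t s'\<close>: started in store \<open>s\<close>, \<open>c\<close> halts in store \<open>s'\<close> after time \<open>t\<close>. The tree \<open>Atom\<close>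
  is read as false, every other tree as true. \<open>size\<close> counts the \<open>Pair\<close> nodes of a tree.
\<close>

inductive exec :: "com \<Rightarrow> store \<Rightarrow> nat \<Rightarrow> store \<Rightarrow> bool" where
  Skip: "exec Skip s 1 s"
| Assign: "exec (Assign i e) s (1 + size (evaluate e s)) (s(i := evaluate e s))"
| Seq: "exec c\<^sub>1 s t\<^sub>1 s' \<Longrightarrow> exec c\<^sub>2 s' t\<^sub>2 s'' \<Longrightarrow> exec (Seq c\<^sub>1 c\<^sub>2) s (t\<^sub>1 + t\<^sub>2) s''"
| IfTrue: "evaluate e s \<noteq> Atom \<Longrightarrow> exec c\<^sub>1 s t s' \<Longrightarrow> exec (If e c\<^sub>1 c\<^sub>2) s (1 + t) s'"
| IfFalse: "evaluate e s = Atom \<Longrightarrow> exec c\<^sub>2 s t s' \<Longrightarrow> exec (If e c\<^sub>1 c\<^sub>2) s (1 + t) s'"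
| WhileFalse: "evaluate e s = Atom \<Longrightarrow> exec (While e c) s 1 s"
| WhileTrue: "evaluate e s \<noteq> Atom \<Longrightarrow> exec c s t\<^sub>1 s' \<Longrightarrow> exec (While e c) s' t\<^sub>2 s''
    \<Longrightarrow> exec (While e c) s (1 + t\<^sub>1 + t\<^sub>2) s''"

text \<open>Input and output are passed in variable \<open>0\<close>; all other variables initially hold \<open>Atom\<close>.\<close>

definition runs :: "com \<Rightarrow> data \<Rightarrow> nat \<Rightarrow> data \<Rightarrow> bool" where
  "runs c x t y \<longleftrightarrow> (\<exists>s. exec c ((\<lambda>_. Atom)(0 := x)) t s \<and> s 0 = y)"

text \<open>
  \<open>poly_time_solves c code valid ok\<close>: on (the code of) every valid instance \<open>i\<close>, \<open>c\<close> halts within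
  time polynomial in the size of the code, with an output \<open>y\<close> such that \<open>ok i y\<close>.
\<close>

definition poly_time_solves ::
    "com \<Rightarrow> ('i \<Rightarrow> data) \<Rightarrow> ('i \<Rightarrow> bool) \<Rightarrow> ('i \<Rightarrow> data \<Rightarrow> bool) \<Rightarrow> bool" where
  "poly_time_solves c code valid ok \<longleftrightarrow>
     (\<exists>p :: nat poly. \<forall>i. valid i \<longrightarrow>
        (\<exists>t y. runs c (code i) t y \<and> t \<le> poly p (size (code i)) \<and> ok i y))"


section \<open>Encodings\<close>

primrec enc_list :: "('a \<Rightarrow> data) \<Rightarrow> 'a list \<Rightarrow> data" where
  "enc_list f [] = Atom"
| "enc_list f (x # xs) = Pair (f x) (enc_list f xs)"

primrec enc_unary :: "nat \<Rightarrow> data" where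
  "enc_unary 0 = Atom"
| "enc_unary (Suc n) = Pair Atom (enc_unary n)"

text \<open>Binary numerals, least significant bit first.\<close>

fun enc_nat :: "nat \<Rightarrow> data" where
  "enc_nat n = (if n = 0 then Atom
     else Pair (if even n then Atom else Pair Atom Atom) (enc_nat (n div 2)))"

declare enc_nat.simps [simp del]

text \<open>Only used for non-negative rationals (distances).\<close>

definition enc_rat :: "rat \<Rightarrow> data" where
  "enc_rat q = (case quotient_of q of (a, b) \<Rightarrow> Pair (enc_nat (nat a)) (enc_nat (nat b)))"


section \<open>Set families\<close>

text \<open>
  The family of an instance may be exponentially large, so it is given by a description \<open>e\<close>, whose
  size counts towards the input size; \<open>fam e\<close> is the family described. The map \<open>fam\<close> is a
  parameter: it determines the type of constraint (explicitly listed families, matroids of some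
  class, knapsack constraints, \<open>\<dots>\<close>), and no computability of \<open>fam\<close> is required.
\<close>

type_synonym family_scheme = "data \<Rightarrow> nat set set"

definition down_closed :: "'a set set \<Rightarrow> bool" where
  "down_closed \<F> \<longleftrightarrow> (\<forall>S\<in>\<F>. \<forall>T. T \<subseteq> S \<longrightarrow> T \<in> \<F>)"

definition constraint_family :: "'a set \<Rightarrow> 'a set set \<Rightarrow> bool" where
  "constraint_family F \<F> \<longleftrightarrow> \<F> \<subseteq> Pow F \<and> \<F> \<noteq> {} \<and> down_closed \<F>"


section \<open>The \<open>\<F>\<close>-PCM problem\<close>

definition sub_partition :: "'a set \<Rightarrow> 'a set set \<Rightarrow> bool" where
  "sub_partition F \<P> \<longleftrightarrow> (\<forall>A\<in>\<P>. A \<subseteq> F) \<and> disjoint \<P>"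

definition pcm_feasible :: "'a set set \<Rightarrow> 'a set set \<Rightarrow> 'a set \<Rightarrow> bool" where
  "pcm_feasible \<F> \<P> S \<longleftrightarrow> S \<in> \<F> \<and> (\<forall>A\<in>\<P>. card (S \<inter> A) \<le> 1)"

definition pcm_opt :: "'a set set \<Rightarrow> 'a set set \<Rightarrow> ('a \<Rightarrow> nat) \<Rightarrow> nat" where
  "pcm_opt \<F> \<P> v = Max {sum v S | S. pcm_feasible \<F> \<P> S}"

text \<open>
  Finite sets are presented to a program as lists without repetitions, in arbitrary order.
\<close>

record pcm_instance =
  pcm_ground :: "nat list"
  pcm_parts :: "nat list list"
  pcm_val :: "nat \<Rightarrow> nat"
  pcm_family :: data

definition part_sets :: "pcm_instance \<Rightarrow> nat set set" where
  "part_sets J = set ` set (pcm_parts J)"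

definition pcm_valid :: "family_scheme \<Rightarrow> pcm_instance \<Rightarrow> bool" where
  "pcm_valid fam J \<longleftrightarrow>
     distinct (pcm_ground J) \<and>
     (\<forall>P\<in>set (pcm_parts J). distinct P) \<and> distinct (map set (pcm_parts J)) \<and>
     constraint_family (set (pcm_ground J)) (fam (pcm_family J)) \<and>
     sub_partition (set (pcm_ground J)) (part_sets J) \<and>
     (\<forall>A\<in>part_sets J. \<forall>f\<in>A. \<forall>g\<in>A. pcm_val J f = pcm_val J g)"

text \<open>
  Writing the values in unary expresses that they are poly-bounded: time may be polynomial in
  the values themselves.
\<close>

definition enc_pcm :: "pcm_instance \<Rightarrow> data" where
  "enc_pcm J =
     Pair (enc_list (\<lambda>f. Pair (enc_nat f) (enc_unary (pcm_val J f))) (pcm_ground J))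
       (Pair (enc_list (enc_list enc_nat) (pcm_parts J)) (pcm_family J))"

definition pcm_approximates :: "family_scheme \<Rightarrow> real \<Rightarrow> pcm_instance \<Rightarrow> data \<Rightarrow> bool" where
  "pcm_approximates fam \<rho> J y \<longleftrightarrow>
     (\<exists>xs. y = enc_list enc_nat xs \<and>
        pcm_feasible (fam (pcm_family J)) (part_sets J) (set xs) \<and>
        real (sum (pcm_val J) (set xs))
          \<ge> \<rho> * real (pcm_opt (fam (pcm_family J)) (part_sets J) (pcm_val J)))"

definition poly_time_pcm_approx :: "family_scheme \<Rightarrow> real \<Rightarrow> com \<Rightarrow> bool" where
  "poly_time_pcm_approx fam \<rho> c \<longleftrightarrow>
     poly_time_solves c enc_pcm (pcm_valid fam) (pcm_approximates fam \<rho>)"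


section \<open>The Robust \<open>\<F>\<close>-Supplier problem\<close>

text \<open>
  Objective values lie in \<open>ennreal\<close>: the distance to the empty set is \<open>\<infinity>\<close>, and the maximum over
  \<open>T = {}\<close> is \<open>0\<close>. For non-empty finite sets \<open>INF\<close> and \<open>SUP\<close> are minimum and maximum.
\<close>

definition set_dist :: "('a \<Rightarrow> 'a \<Rightarrow> real) \<Rightarrow> 'a \<Rightarrow> 'a set \<Rightarrow> ennreal" where
  "set_dist d v S = (INF u\<in>S. ennreal (d v u))"

definition supplier_opt ::
    "'a set set \<Rightarrow> 'a set \<Rightarrow> ('a \<Rightarrow> 'a \<Rightarrow> real) \<Rightarrow> nat \<Rightarrow> ennreal" where
  "supplier_opt \<F> C d m =
     Inf {(SUP u\<in>T. set_dist d u S) | S T. S \<in> \<F> \<and> T \<subseteq> C \<and> card T \<ge> m}"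

text \<open>
  Distances are rational, since they are part of a finite input. \<open>Metric_space X d\<close> also asks for
  symmetry and non-negativity of \<open>d\<close> outside of \<open>X\<close>; those values occur neither in the input nor
  in the objective, so this is only a normalisation.
\<close>

record supplier_instance =
  sup_facilities :: "nat list"
  sup_customers :: "nat list"
  sup_metric :: "nat \<Rightarrow> nat \<Rightarrow> rat"
  sup_demand :: nat
  sup_family :: data

definition sup_dist :: "supplier_instance \<Rightarrow> nat \<Rightarrow> nat \<Rightarrow> real" where
  "sup_dist I u v = of_rat (sup_metric I u v)"

definition supplier_valid :: "family_scheme \<Rightarrow> supplier_instance \<Rightarrow> bool" where
  "supplier_valid fam I \<longleftrightarrow>
     distinct (sup_facilities I) \<and> distinct (sup_customers I) \<and>
     Metric_space (set (sup_facilities I) \<union> set (sup_customers I)) (sup_dist I) \<and>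
     sup_demand I \<le> card (set (sup_customers I)) \<and>
     constraint_family (set (sup_facilities I)) (fam (sup_family I))"

text \<open>The metric is coded by its graph on the set of all points.\<close>

definition enc_supplier :: "supplier_instance \<Rightarrow> data" where
  "enc_supplier I =
     (let X = remdups (sup_facilities I @ sup_customers I) in
      Pair (enc_list enc_nat (sup_facilities I))
       (Pair (enc_list enc_nat (sup_customers I))
         (Pair (enc_list (\<lambda>(u, v). Pair (enc_nat u) (Pair (enc_nat v) (enc_rat (sup_metric I u v))))
                  (List.product X X))
           (Pair (enc_unary (sup_demand I)) (sup_family I)))))"

definition bicriteria_approximates ::
    "family_scheme \<Rightarrow> real \<Rightarrow> real \<Rightarrow> supplier_instance \<Rightarrow> data \<Rightarrow> bool" where
  "bicriteria_approximates fam \<alpha> \<beta> I y \<longleftrightarrow>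
     (\<exists>xs. y = enc_list enc_nat xs \<and> set xs \<in> fam (sup_family I) \<and>
        real (card {v \<in> set (sup_customers I). set_dist (sup_dist I) v (set xs)
            \<le> ennreal \<alpha> * supplier_opt (fam (sup_family I)) (set (sup_customers I))
                            (sup_dist I) (sup_demand I)})
          \<ge> \<beta> * real (sup_demand I))"

definition poly_time_bicriteria_approx :: "family_scheme \<Rightarrow> real \<Rightarrow> real \<Rightarrow> com \<Rightarrow> bool" where
  "poly_time_bicriteria_approx fam \<alpha> \<beta> c \<longleftrightarrow>
     poly_time_solves c enc_supplier (supplier_valid fam) (bicriteria_approximates fam \<alpha> \<beta>)"


section \<open>Polynomial-time ratios\<close>

text \<open>
  A ratio \<open>\<rho>\<close> is \<^emph>\<open>polynomial-time\<close> if \<open>q \<ge> \<rho> m\<close> can be decided in time polynomial in the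
  natural numbers \<open>q\<close> and \<open>m\<close> themselves. The ratio is a constant of the algorithm, which has to
  recognise whether \<open>q\<close> covered customers meet the requirement \<open>\<rho> m\<close>; for a non-computable real
  \<open>\<rho>\<close> no program can decide this.
\<close>

definition poly_time_ratio :: "real \<Rightarrow> bool" where
  "poly_time_ratio \<rho> \<longleftrightarrow>
     (\<exists>c. poly_time_solves c (\<lambda>(q, m). Pair (enc_unary q) (enc_unary m)) (\<lambda>_. True)
            (\<lambda>(q, m) y. y \<noteq> Atom \<longleftrightarrow> real q \<ge> \<rho> * real m))"

text \<open>In particular every rational number is a polynomial-time ratio.\<close>

lemma size_enc_unary [simp]: "size (enc_unary n) = n"
  by (induction n) auto

lemma exec_counting_loop:
  assumes "i \<noteq> j"
    and e: "\<And>s l. s j = enc_unary l \<Longrightarrow> evaluate e s = enc_unary (g l)"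
    and "\<And>k. k \<le> n \<Longrightarrow> (g ^^ k) l \<le> M"
    and "s i = enc_unary n" "s j = enc_unary l"
  shows "\<exists>t. exec (While (Var i) (Seq (Assign j e) (Assign i (Tl (Var i))))) s t
                (s(i := Atom, j := enc_unary ((g ^^ n) l))) \<and> t \<le> 1 + n * (M + n + 3)"
  using assms(3-)
proof (induction n arbitrary: s l)
  case 0
  have st: "s(i := Atom, j := enc_unary ((g ^^ 0) l)) = s" using 0 by (auto simp: fun_eq_iff)
  have "evaluate (Var i) s = Atom" using 0 by simp
  then show ?case unfolding st using exec.WhileFalse by fastforce
next
  case (Suc n)
  let ?c = "Seq (Assign j e) (Assign i (Tl (Var i)))"
  let ?s1 = "s(j := enc_unary (g l))"
  let ?s2 = "?s1(i := enc_unary n)"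
  have a1: "exec (Assign j e) s (1 + g l) ?s1"
    using exec.Assign[of j e s] e[of s l] Suc.prems(3) by simp
  have a2: "exec (Assign i (Tl (Var i))) ?s1 (1 + n) ?s2"
    using exec.Assign[of i "Tl (Var i)" ?s1] Suc.prems(2) \<open>i \<noteq> j\<close> by simp
  have c: "exec ?c s (1 + g l + (1 + n)) ?s2" by (rule exec.Seq[OF a1 a2])
  have "\<exists>t. exec (While (Var i) ?c) ?s2 t (?s2(i := Atom, j := enc_unary ((g ^^ n) (g l))))
          \<and> t \<le> 1 + n * (M + n + 3)"
  proof (rule Suc.IH)
    show "(g ^^ k) (g l) \<le> M" if "k \<le> n" for k
      using Suc.prems(1)[of "Suc k"] that by (simp add: funpow_swap1)
  qed (use \<open>i \<noteq> j\<close> in auto)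
  then obtain t where t: "exec (While (Var i) ?c) ?s2 t (?s2(i := Atom, j := enc_unary ((g ^^ n) (g l))))"
    "t \<le> 1 + n * (M + n + 3)" by blast
  have st: "?s2(i := Atom, j := enc_unary ((g ^^ n) (g l)))
      = s(i := Atom, j := enc_unary ((g ^^ Suc n) l))"
    using \<open>i \<noteq> j\<close> by (auto simp: fun_eq_iff funpow_swap1)
  have "exec (While (Var i) ?c) s (1 + (1 + g l + (1 + n)) + t)
      (s(i := Atom, j := enc_unary ((g ^^ Suc n) l)))"
    using exec.WhileTrue[OF _ c t(1)] Suc.prems(2) unfolding st by simp
  moreover have "g l \<le> M" using Suc.prems(1)[of 1] by simp
  then have "1 + (1 + g l + (1 + n)) + t \<le> 1 + Suc n * (M + Suc n + 3)"
    using t(2) by (simp add: algebra_simps)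
  ultimately show ?case by blast
qed

lemma poly_time_ratio_rational:
  assumes "\<rho> \<in> \<rat>"
  shows "poly_time_ratio \<rho>"
proof -
  obtain p :: int and b :: nat where b: "b \<noteq> 0" and p: "\<rho> = of_int p / of_nat b"
    using assms unfolding Rats_eq_int_div_nat by blast
  define a where "a = nat p"
  have iff: "real q \<ge> \<rho> * real m \<longleftrightarrow> a * m \<le> b * q" for q m
  proof (cases "p \<ge> 0")
    case True
    then have "\<rho> = real a / real b" by (simp add: a_def p)
    then have "real q \<ge> \<rho> * real m \<longleftrightarrow> real a * real m / real b \<le> real q" by simp
    also have "\<dots> \<longleftrightarrow> real (a * m) \<le> real (b * q)"
      using b by (simp add: divide_le_eq mult.commute)
    finally show ?thesis unfolding of_nat_le_iff .
  next
    case False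
    then have "\<rho> \<le> 0" by (simp add: p divide_nonpos_nonneg)
    then have "\<rho> * real m \<le> 0" by (simp add: mult_nonpos_nonneg)
    also have "0 \<le> real q" by simp
    finally show ?thesis using False by (simp add: a_def)
  qed
  define up where "up = (EPair EAtom ^^ b) (Var 0)"
  define dn where "dn = (Tl ^^ a) (Var 0)"
  have up: "evaluate up s = enc_unary (l + b)" if "s 0 = enc_unary l" for s l
    unfolding up_def by (induction b) (use that in auto)
  have dn: "evaluate dn s = enc_unary (l - a)" if "s 0 = enc_unary l" for s l
  proof -
    have "evaluate ((Tl ^^ k) (Var 0)) s = enc_unary (l - k)" for k
    proof (induction k)
      case (Suc k)
      show ?case
      proof (cases "l - k")
        case (Suc r)
        then have "l - Suc k = r" by simp
        with Suc Suc.IH show ?thesis by simp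
      qed (use Suc.IH in auto)
    qed (use that in simp)
    then show ?thesis by (simp add: dn_def)
  qed
  have upn: "((\<lambda>l. l + b) ^^ k) l = l + b * k" for k l
    by (induction k) auto
  have dnn: "((\<lambda>l. l - a) ^^ k) l = l - a * k" for k l
    by (induction k) auto
  define L where "L i e = While (Var i) (Seq (Assign 0 e) (Assign i (Tl (Var i))))" for i e
  define c where "c = Seq (Assign 1 (Hd (Var 0))) (Seq (Assign 2 (Tl (Var 0)))
    (Seq (Assign 0 (EPair EAtom EAtom)) (Seq (L 1 up) (L 2 dn))))"
  define P :: "nat poly" where "P = [:6, 1:] + [:0, 1:] * [:4, b + 1:]"
  have "\<exists>t y. runs c (Pair (enc_unary q) (enc_unary m)) t y \<and>
          t \<le> poly P (size (Pair (enc_unary q) (enc_unary m))) \<and>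
          (y \<noteq> Atom \<longleftrightarrow> real q \<ge> \<rho> * real m)" for q m
  proof -
    define x where "x = Pair (enc_unary q) (enc_unary m)"
    define s0 :: store where "s0 = (\<lambda>_. Atom)(0 := x)"
    define s1 where "s1 = s0(1 := enc_unary q)"
    define s2 where "s2 = s1(2 := enc_unary m)"
    define s3 where "s3 = s2(0 := enc_unary 1)"
    define M where "M = 1 + b * q"
    have e1: "exec (Assign 1 (Hd (Var 0))) s0 (1 + q) s1"
      using exec.Assign[of 1 "Hd (Var 0)" s0] by (simp add: s0_def s1_def x_def)
    have e2: "exec (Assign 2 (Tl (Var 0))) s1 (1 + m) s2"
      using exec.Assign[of 2 "Tl (Var 0)" s1] by (simp add: s0_def s1_def s2_def x_def)
    have e3: "exec (Assign 0 (EPair EAtom EAtom)) s2 2 s3"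
      using exec.Assign[of 0 "EPair EAtom EAtom" s2] by (simp add: s3_def numeral_2_eq_2)
    have v3: "s3 1 = enc_unary q" "s3 2 = enc_unary m" "s3 0 = enc_unary 1"
      by (auto simp: s3_def s2_def s1_def)
    obtain t4 where t4: "exec (L 1 up) s3 t4 (s3(1 := Atom, 0 := enc_unary M))"
      "t4 \<le> 1 + q * (M + q + 3)"
      using exec_counting_loop[of 1 0 up "\<lambda>l. l + b" q 1 M s3] up v3
      by (auto simp: upn L_def M_def)
    obtain t5 where t5: "exec (L 2 dn) (s3(1 := Atom, 0 := enc_unary M)) t5
        (s3(1 := Atom, 0 := enc_unary M, 2 := Atom, 0 := enc_unary (M - a * m)))"
      "t5 \<le> 1 + m * (M + m + 3)"
      using exec_counting_loop[of 2 0 dn "\<lambda>l. l - a" m M M "s3(1 := Atom, 0 := enc_unary M)"] dn v3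
      by (auto simp: dnn L_def)
    have run: "runs c x (1 + q + (1 + m + (2 + (t4 + t5)))) (enc_unary (M - a * m))"
      unfolding runs_def c_def s0_def[symmetric]
      by (intro exI conjI, rule exec.Seq[OF e1 exec.Seq[OF e2 exec.Seq[OF e3 exec.Seq[OF t4(1) t5(1)]]]])
        simp
    have out: "enc_unary (M - a * m) \<noteq> Atom \<longleftrightarrow> real q \<ge> \<rho> * real m"
      unfolding iff M_def by (cases "1 + b * q - a * m") auto
    define N where "N = q + m + 1"
    have "M + q + 3 \<le> (b + 1) * N + 4" "M + m + 3 \<le> (b + 1) * N + 4"
      by (auto simp: M_def N_def algebra_simps)
    then have "q * (M + q + 3) + m * (M + m + 3) \<le> q * ((b + 1) * N + 4) + m * ((b + 1) * N + 4)"
      by (rule add_le_mono[OF mult_le_mono2 mult_le_mono2])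
    also have "\<dots> \<le> N * ((b + 1) * N + 4)" by (simp add: N_def algebra_simps)
    finally have "1 + q + (1 + m + (2 + (t4 + t5))) \<le> 6 + N + N * ((b + 1) * N + 4)"
      using t4(2) t5(2) by (simp add: N_def)
    also have "\<dots> \<le> poly P N"
      by (simp add: P_def algebra_simps)
    finally have "1 + q + (1 + m + (2 + (t4 + t5))) \<le> poly P (size x)"
      by (simp add: N_def x_def)
    with run out show ?thesis unfolding x_def by blast
  qed
  then show ?thesis
    unfolding poly_time_ratio_def poly_time_solves_def by (intro exI[of _ c] exI[of _ P]) auto
qed

end

theory Submission
  imports Defs
begin

text \<open>
  Guess the optimal radius \<open>r\<close> among the distances. Two customers are in conflict if some facility is
  within \<open>r\<close> of both. Processing the customers in some order, assign each of them to an earlier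
  representative in conflict with it, or make it a representative. The facilities within \<open>r\<close> of a
  representative \<open>j\<close> form a part, with value the number \<open>cnt j\<close> of customers assigned to \<open>j\<close>;
  a facility in the part serves these customers within \<open>3 r\<close>, so a PCM solution of value at least
  \<open>\<rho> m\<close> is what we want.

  If the PCM algorithm returns less, then the PCM optimum is below \<open>m\<close>, so the set \<open>H\<close> of customers
  within \<open>r\<close> of an optimal solution satisfies \<open>\<Sum>j\<in>H. cnt j < m \<le> card H\<close>. This inequality separates
  the indicator vector of \<open>H\<close> from every vector whose decreasing order was used for processing the
  customers. Instead of the ellipsoid method, the perceptron algorithm finds a good order: each round
  adds the vector \<open>1 - cnt\<close> to the current point, and \<open>n ^ 3\<close> unsuccessful rounds are the most that
  can occur. As only the order matters, the point is represented by the accumulated penalties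
  \<open>\<Sum> cnt\<close>, which are natural numbers, and the customers are processed by increasing penalty.
  Each radius without a successful round is below the optimum, so the smallest successful radius is
  good; if there is none, the optimum is infinite or \<open>m = 0\<close>, and the empty set will do.
\<close>

section \<open>A calculus of polynomial-time computations\<close>

text \<open>The separation rests on one computation. Let x be a point whose decreasing order was
  used. Every customer v is assigned to a representative that does not come later, so x(rep v) \<ge>
  x(v); summing over v shows that the inner product of x with \<open>1 - cnt\<close> is not
  positive. With the indicator vector of \<open>H\<close> it is positive, and at least 1 because all
  numbers involved are integers. So a failed round adds at most n^2 to the squared norm of x and at
  least 1 to the sum of x over \<open>H\<close>. Comparing the two growth rates gives the bound n^3
  on failed rounds. It also keeps the penalties so small that they can be stored in unary, and the
  only rational arithmetic left is the comparison of distances. The other obstacle is that the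
  algorithm has to exist as a WHILE program. Its running time is derived by composition from rules
  for functions on mathematical objects. What composition does not provide is a bound on the
  intermediate states of a loop; every loop needs its own argument for that.\<close>

primrec expr_bound :: "expr \<Rightarrow> nat" where
  "expr_bound (Var i) = Suc i"
| "expr_bound EAtom = 0"
| "expr_bound (EPair e f) = max (expr_bound e) (expr_bound f)"
| "expr_bound (Hd e) = expr_bound e"
| "expr_bound (Tl e) = expr_bound e"

primrec com_bound :: "com \<Rightarrow> nat" where
  "com_bound Skip = 0"
| "com_bound (Assign i e) = max (Suc i) (expr_bound e)"
| "com_bound (Seq c d) = max (com_bound c) (com_bound d)"
| "com_bound (If e c d) = max (expr_bound e) (max (com_bound c) (com_bound d))"
| "com_bound (While e c) = max (expr_bound e) (com_bound c)"

lemma evaluate_cong: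
  "expr_bound e \<le> N \<Longrightarrow> (\<And>v. v < N \<Longrightarrow> s v = r v) \<Longrightarrow> evaluate e s = evaluate e r"
  by (induction e) auto

text \<open>A program touches only variables below \<open>com_bound\<close>, so the contents of the
  others do not influence the run and survive it. This allows a program specified by
  \<open>runs\<close>, where they are all \<open>Atom\<close>, to be used as a subroutine.\<close>

lemma exec_frame:
  assumes "exec c s t s'" "com_bound c \<le> N" "\<And>v. v < N \<Longrightarrow> s v = r v"
  shows "exec c r t (\<lambda>v. if v < N then s' v else r v)"
  using assms
proof (induction arbitrary: r rule: exec.induct)
  case (Skip s)
  then have "(\<lambda>v. if v < N then s v else r v) = r" by (auto simp: fun_eq_iff)
  then show ?case using exec.Skip[of r] by simp
next
  case (Assign i e s)
  then have ev: "evaluate e s = evaluate e r" by (intro evaluate_cong[of e N]) auto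
  have "(\<lambda>v. if v < N then (s(i := evaluate e s)) v else r v) = r(i := evaluate e r)"
    using Assign by (auto simp: fun_eq_iff ev)
  then show ?case using exec.Assign[of i e r] by (simp add: ev)
next
  case (Seq c1 s t1 s' c2 t2 s'')
  let ?r' = "\<lambda>v. if v < N then s' v else r v"
  have 1: "exec c1 r t1 ?r'" using Seq by simp
  have "exec c2 ?r' t2 (\<lambda>v. if v < N then s'' v else ?r' v)" using Seq by simp
  also have "(\<lambda>v. if v < N then s'' v else ?r' v) = (\<lambda>v. if v < N then s'' v else r v)" by auto
  finally show ?case using 1 exec.Seq by blast
next
  case (IfTrue e s c1 t s' c2)
  then have ev: "evaluate e s = evaluate e r" by (intro evaluate_cong[of e N]) auto
  show ?case using IfTrue ev by (intro exec.IfTrue) auto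
next
  case (IfFalse e s c2 t s' c1)
  then have ev: "evaluate e s = evaluate e r" by (intro evaluate_cong[of e N]) auto
  show ?case using IfFalse ev by (intro exec.IfFalse) auto
next
  case (WhileFalse e s c)
  then have ev: "evaluate e s = evaluate e r" by (intro evaluate_cong[of e N]) auto
  have "(\<lambda>v. if v < N then s v else r v) = r" using WhileFalse by (auto simp: fun_eq_iff)
  then show ?case using exec.WhileFalse[of e r] WhileFalse ev by simp
next
  case (WhileTrue e s c t1 s' t2 s'')
  then have ev: "evaluate e s = evaluate e r" by (intro evaluate_cong[of e N]) auto
  let ?r' = "\<lambda>v. if v < N then s' v else r v"
  have 1: "exec c r t1 ?r'" using WhileTrue by simp
  have "exec (While e c) ?r' t2 (\<lambda>v. if v < N then s'' v else ?r' v)" using WhileTrue by simp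
  also have "(\<lambda>v. if v < N then s'' v else ?r' v) = (\<lambda>v. if v < N then s'' v else r v)" by auto
  finally show ?case using 1 exec.WhileTrue[of e r c] WhileTrue(1) ev by simp
qed

text \<open>Holds because an assignment is charged the size of the tree it stores. It bounds the
  output of every fast program, which is what keeps compositions polynomial.\<close>

lemma exec_size: "exec c s t s' \<Longrightarrow> size (s' v) \<le> size (s v) + t"
  by (induction rule: exec.induct) auto

text \<open>Variable \<open>0\<close> is spared, as it carries the result. A program given by
  \<open>runs\<close> may leave anything in its other variables, so they are wiped before it is
  composed.\<close>

primrec clear_vars :: "nat \<Rightarrow> com" where
  "clear_vars 0 = Skip"
| "clear_vars (Suc n) = Seq (Assign (Suc n) EAtom) (clear_vars n)"

lemma exec_clear_vars: "exec (clear_vars n) s (Suc n) (\<lambda>v. if 0 < v \<and> v \<le> n then Atom else s v)"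
proof (induction n arbitrary: s)
  case 0
  have "(\<lambda>v. if 0 < v \<and> v \<le> (0::nat) then Atom else s v) = s" by auto
  then show ?case using exec.Skip[of s] by simp
next
  case (Suc n)
  let ?s = "s(Suc n := Atom)"
  have "exec (Assign (Suc n) EAtom) s 1 ?s" using exec.Assign[of "Suc n" EAtom s] by simp
  from exec.Seq[OF this Suc.IH[of ?s]]
  have "exec (clear_vars (Suc n)) s (1 + Suc n) (\<lambda>v. if 0 < v \<and> v \<le> n then Atom else ?s v)" by simp
  also have "(\<lambda>v. if 0 < v \<and> v \<le> n then Atom else ?s v) = (\<lambda>v. if 0 < v \<and> v \<le> Suc n then Atom else s v)"
    by auto
  finally show ?case by simp
qed

text \<open>A single exponent replaces a polynomial. The base is at least 2, so constants are
  absorbed through \<open>c \<le> 2 ^ c\<close> and a sum costs just one more factor.\<close>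

definition pbound :: "('a \<Rightarrow> bool) \<Rightarrow> ('a \<Rightarrow> data) \<Rightarrow> ('a \<Rightarrow> nat) \<Rightarrow> bool" where
  "pbound P X n \<longleftrightarrow> (\<exists>k. \<forall>i. P i \<longrightarrow> n i \<le> (size (X i) + 2) ^ k)"

text \<open>
  \<open>ptime P X Y\<close>: a single program turns \<open>X i\<close> into \<open>Y i\<close>, in time polynomial in the size of \<open>X i\<close>,
  for all \<open>i\<close> with \<open>P i\<close>. The index \<open>i\<close> is not part of the input; it lets input and output be
  described by mathematical objects instead of trees. In contrast to \<open>runs\<close>, the program has to
  restore its auxiliary variables and may be started while the other variables are in use,
  which makes programs composable.
\<close>

definition computes :: "com \<Rightarrow> nat \<Rightarrow> ('a \<Rightarrow> nat) \<Rightarrow> ('a \<Rightarrow> bool) \<Rightarrow> ('a \<Rightarrow> data) \<Rightarrow> ('a \<Rightarrow> data) \<Rightarrow> bool" where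
  "computes c N T P X Y \<longleftrightarrow> (\<forall>i s. P i \<longrightarrow> s 0 = X i \<longrightarrow> (\<forall>j. 0 < j \<longrightarrow> j < N \<longrightarrow> s j = Atom) \<longrightarrow>
     (\<exists>t. exec c s t (s(0 := Y i)) \<and> t \<le> T i))"

definition ptime :: "('a \<Rightarrow> bool) \<Rightarrow> ('a \<Rightarrow> data) \<Rightarrow> ('a \<Rightarrow> data) \<Rightarrow> bool" where
  "ptime P X Y \<longleftrightarrow> (\<exists>c N T. pbound P X T \<and> computes c N T P X Y)"

lemma computesD:
  "computes c N T P X Y \<Longrightarrow> P i \<Longrightarrow> s 0 = X i \<Longrightarrow> (\<And>j. 0 < j \<Longrightarrow> j < N \<Longrightarrow> s j = Atom) \<Longrightarrow>
    \<exists>t. exec c s t (s(0 := Y i)) \<and> t \<le> T i"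
  unfolding computes_def by blast

lemma pbound_mono:
  "pbound P X n \<Longrightarrow> (\<And>i. P i \<Longrightarrow> n' i \<le> n i) \<Longrightarrow> pbound P X n'"
  unfolding pbound_def by (blast intro: order_trans)

lemma pbound_const: "pbound P X (\<lambda>_. c)"
proof -
  have "c \<le> (size (X i) + 2) ^ c" for i
  proof -
    have "c \<le> 2 ^ c" by (rule less_imp_le[OF less_exp])
    also have "\<dots> \<le> (size (X i) + 2) ^ c" by (rule power_mono) auto
    finally show ?thesis .
  qed
  then show ?thesis unfolding pbound_def by blast
qed

lemma pbound_size: "pbound P X (\<lambda>i. size (X i))"
  unfolding pbound_def by (intro exI[of _ 1]) simp

lemma pbound_add:
  assumes "pbound P X f" "pbound P X g"
  shows "pbound P X (\<lambda>i. f i + g i)"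
proof -
  obtain k l where k: "\<And>i. P i \<Longrightarrow> f i \<le> (size (X i) + 2) ^ k"
    and l: "\<And>i. P i \<Longrightarrow> g i \<le> (size (X i) + 2) ^ l"
    using assms unfolding pbound_def by blast
  have "f i + g i \<le> (size (X i) + 2) ^ Suc (k + l)" if "P i" for i
  proof -
    have "(size (X i) + 2) ^ k \<le> (size (X i) + 2) ^ (k + l)"
      "(size (X i) + 2) ^ l \<le> (size (X i) + 2) ^ (k + l)" by (auto intro!: power_increasing)
    with k[OF that] l[OF that] have "f i + g i \<le> 2 * (size (X i) + 2) ^ (k + l)" by linarith
    also have "\<dots> \<le> (size (X i) + 2) ^ Suc (k + l)" by simp
    finally show ?thesis .
  qed
  then show ?thesis unfolding pbound_def by blast
qed

lemma pbound_mult: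
  assumes "pbound P X f" "pbound P X g"
  shows "pbound P X (\<lambda>i. f i * g i)"
proof -
  obtain k l where "\<And>i. P i \<Longrightarrow> f i \<le> (size (X i) + 2) ^ k"
    and "\<And>i. P i \<Longrightarrow> g i \<le> (size (X i) + 2) ^ l"
    using assms unfolding pbound_def by blast
  then have "\<And>i. P i \<Longrightarrow> f i * g i \<le> (size (X i) + 2) ^ (k + l)"
    unfolding power_add by (intro mult_le_mono) auto
  then show ?thesis unfolding pbound_def by blast
qed

lemma pbound_Suc: "pbound P X f \<Longrightarrow> pbound P X (\<lambda>i. Suc (f i))"
  using pbound_add[OF pbound_const[of P X 1]] by simp

lemma pbound_power: "pbound P X f \<Longrightarrow> pbound P X (\<lambda>i. f i ^ k)"
  by (induction k) (simp_all add: pbound_const pbound_mult)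

lemma pbound_poly: "pbound P X f \<Longrightarrow> pbound P X (\<lambda>i. poly p (f i))"
  by (induction p) (simp_all add: pbound_const pbound_mult pbound_add)

lemmas pbound_intros = pbound_const pbound_add pbound_mult pbound_Suc pbound_power pbound_poly

lemma ptime_pbound:
  assumes "ptime P X Y"
  shows "pbound P X (\<lambda>i. size (Y i))"
proof -
  obtain c N T where T: "pbound P X T" and c: "computes c N T P X Y"
    using assms unfolding ptime_def by blast
  have "size (Y i) \<le> size (X i) + T i" if P: "P i" for i
  proof -
    have "\<exists>t. exec c ((\<lambda>_. Atom)(0 := X i)) t (((\<lambda>_. Atom)(0 := X i))(0 := Y i)) \<and> t \<le> T i"
      by (rule computesD[OF c P]) auto
    then obtain t where "exec c ((\<lambda>_. Atom)(0 := X i)) t (((\<lambda>_. Atom)(0 := X i))(0 := Y i))" "t \<le> T i" by blast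
    with exec_size[OF this(1), of 0] show ?thesis by simp
  qed
  moreover have "pbound P X (\<lambda>i. size (X i) + T i)" by (intro pbound_intros pbound_size T)
  ultimately show ?thesis by (rule pbound_mono[rotated])
qed

lemma ptimeI:
  assumes "pbound P X T"
    and "\<And>i s. P i \<Longrightarrow> s 0 = X i \<Longrightarrow> (\<And>j. 0 < j \<Longrightarrow> j < N \<Longrightarrow> s j = Atom) \<Longrightarrow>
     \<exists>t. exec c s t (s(0 := Y i)) \<and> t \<le> T i"
  shows "ptime P X Y"
  unfolding ptime_def computes_def using assms by blast

lemma pbound_trans:
  assumes "pbound P X (\<lambda>i. size (Y i))" "pbound P Y n"
  shows "pbound P X n"
proof -
  obtain k where k: "\<And>i. P i \<Longrightarrow> n i \<le> (size (Y i) + 2) ^ k" using assms(2) unfolding pbound_def by blast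
  have "pbound P X (\<lambda>i. (size (Y i) + 2) ^ k)" by (intro pbound_intros assms(1))
  then show ?thesis by (rule pbound_mono) (rule k)
qed

lemma pbound_subst:
  assumes "pbound Q X n" "\<And>z. P z \<Longrightarrow> Q (h z)"
  shows "pbound P (\<lambda>z. X (h z)) (\<lambda>z. n (h z))"
proof -
  obtain k where "\<And>i. Q i \<Longrightarrow> n i \<le> (size (X i) + 2) ^ k" using assms(1) unfolding pbound_def by blast
  then show ?thesis unfolding pbound_def using assms(2) by (intro exI[of _ k]) simp
qed

text \<open>The program does not see the index, so reindexing along \<open>h\<close> costs nothing:
  the same program and the same exponent serve.\<close>

lemma ptime_subst:
  assumes "ptime Q X Y" "\<And>z. P z \<Longrightarrow> Q (h z)"
  shows "ptime P (\<lambda>z. X (h z)) (\<lambda>z. Y (h z))"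
proof -
  obtain c N T where T: "pbound Q X T" and c: "computes c N T Q X Y"
    using assms(1) unfolding ptime_def by blast
  show ?thesis
    by (rule ptimeI[OF pbound_subst[OF T assms(2)], where N = N and c = c]) (assumption | rule computesD[OF c assms(2)])+
qed

lemma ptime_cong:
  assumes "ptime P X Y" "\<And>i. P' i \<Longrightarrow> P i" "\<And>i. P' i \<Longrightarrow> X i = X' i" "\<And>i. P' i \<Longrightarrow> Y i = Y' i"
  shows "ptime P' X' Y'"
proof -
  obtain c N T where T: "pbound P X T" and c: "computes c N T P X Y"
    using assms(1) unfolding ptime_def by blast
  show ?thesis
  proof (rule ptimeI[where T = T and N = N and c = c])
    obtain k where k: "\<And>i. P i \<Longrightarrow> T i \<le> (size (X i) + 2) ^ k" using T unfolding pbound_def by blast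
    have "T i \<le> (size (X' i) + 2) ^ k" if "P' i" for i
      using k[OF assms(2)[OF that]] unfolding assms(3)[OF that] .
    then show "pbound P' X' T" unfolding pbound_def by blast
    fix i s assume P: "P' i" and s: "s 0 = X' i" "\<And>j. 0 < j \<Longrightarrow> j < N \<Longrightarrow> s j = Atom"
    have "s 0 = X i" using s(1) assms(3)[OF P] by simp
    then show "\<exists>t. exec c s t (s(0 := Y' i)) \<and> t \<le> T i"
      unfolding assms(4)[OF P, symmetric] by (rule computesD[OF c assms(2)[OF P]]) (rule s(2))
  qed
qed

lemma ptime_trans:
  assumes "ptime P X Y" "ptime P Y Z"
  shows "ptime P X Z"
proof -
  obtain c N T where T: "pbound P X T" and c: "computes c N T P X Y"
    using assms(1) unfolding ptime_def by blast
  obtain c' N' T' where T': "pbound P Y T'" and c': "computes c' N' T' P Y Z"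
    using assms(2) unfolding ptime_def by blast
  show ?thesis
  proof (rule ptimeI[where T = "\<lambda>i. T i + T' i" and N = "max N N'" and c = "Seq c c'"])
    show "pbound P X (\<lambda>i. T i + T' i)"
      by (intro pbound_intros T pbound_trans[OF ptime_pbound[OF assms(1)] T'])
    fix i s assume P: "P i" and s: "s 0 = X i" "\<And>j. 0 < j \<Longrightarrow> j < max N N' \<Longrightarrow> s j = Atom"
    have "\<exists>t. exec c s t (s(0 := Y i)) \<and> t \<le> T i"
      by (rule computesD[OF c P]) (use s in auto)
    then obtain t where t: "exec c s t (s(0 := Y i))" "t \<le> T i" by blast
    have "\<exists>t'. exec c' (s(0 := Y i)) t' (s(0 := Y i, 0 := Z i)) \<and> t' \<le> T' i"
      by (rule computesD[OF c' P]) (use s in auto)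
    then obtain t' where t': "exec c' (s(0 := Y i)) t' (s(0 := Y i, 0 := Z i))" "t' \<le> T' i" by blast
    show "\<exists>t. exec (Seq c c') s t (s(0 := Z i)) \<and> t \<le> T i + T' i"
      using exec.Seq[OF t(1) t'(1)] t(2) t'(2) by (intro exI[of _ "t + t'"]) auto
  qed
qed

text \<open>The subroutine call of the calculus: a program known for all indices in \<open>Q\<close>
  is run on the index \<open>h z\<close>. Only the code of \<open>h z\<close> has to be computable
  from the outer input.\<close>

lemma ptime_apply:
  assumes "ptime Q X Y" "ptime P X' (\<lambda>z. X (h z))" "\<And>z. P z \<Longrightarrow> Q (h z)"
  shows "ptime P X' (\<lambda>z. Y (h z))"
proof -
  have "ptime P (\<lambda>z. X (h z)) (\<lambda>z. Y (h z))" by (rule ptime_subst[where h = h, OF assms(1)]) (rule assms(3))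
  with assms(2) show ?thesis by (rule ptime_trans)
qed

lemma ptime_expr:
  assumes "\<And>s. evaluate e s = f (s 0)" "pbound P X (\<lambda>i. size (f (X i)))"
  shows "ptime P X (\<lambda>i. f (X i))"
proof (rule ptimeI[where T = "\<lambda>i. 1 + size (f (X i))" and N = 0 and c = "Assign 0 e"])
  show "pbound P X (\<lambda>i. 1 + size (f (X i)))" by (intro pbound_intros assms)
  fix i :: 'a and s :: store assume "s 0 = X i"
  then show "\<exists>t. exec (Assign 0 e) s t (s(0 := f (X i))) \<and> t \<le> 1 + size (f (X i))"
    using exec.Assign[of 0 e s] assms(1)[of s] by auto
qed

lemma ptime_id: "ptime P X X"
proof -
  have "ptime P X (\<lambda>i. id (X i))"
    by (rule ptime_expr[where e = "Var 0" and f = id]) (simp_all add: pbound_size)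
  then show ?thesis by simp
qed

lemma ptime_Atom: "ptime P X (\<lambda>_. Atom)"
  by (rule ptime_expr[where e = EAtom and f = "\<lambda>_. Atom"]) (simp_all add: pbound_const)

lemma size_head: "size (head x) \<le> size x" and size_tail: "size (tail x) \<le> size x"
  by (cases x; simp)+

lemma ptime_head:
  assumes "ptime P X Y"
  shows "ptime P X (\<lambda>i. head (Y i))"
proof -
  have "pbound P Y (\<lambda>i. size (head (Y i)))" by (rule pbound_mono[OF pbound_size]) (rule size_head)
  then have "ptime P Y (\<lambda>i. head (Y i))" by (rule ptime_expr[where e = "Hd (Var 0)" and f = head, rotated]) simp
  with assms show ?thesis by (rule ptime_trans)
qed

lemma ptime_tail:
  assumes "ptime P X Y"
  shows "ptime P X (\<lambda>i. tail (Y i))"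
proof -
  have "pbound P Y (\<lambda>i. size (tail (Y i)))" by (rule pbound_mono[OF pbound_size]) (rule size_tail)
  then have "ptime P Y (\<lambda>i. tail (Y i))" by (rule ptime_expr[where e = "Tl (Var 0)" and f = tail, rotated]) simp
  with assms show ?thesis by (rule ptime_trans)
qed

text \<open>Both programs expect the same input in variable \<open>0\<close>. The input is saved in
  \<open>M\<close> and the first result in \<open>Suc M\<close>, beyond the auxiliary variables of
  both programs, and both are reset to \<open>Atom\<close> afterwards, as \<open>computes\<close>
  demands.\<close>

lemma ptime_Pair:
  assumes "ptime P X Y" "ptime P X Z"
  shows "ptime P X (\<lambda>i. Pair (Y i) (Z i))"
proof -
  obtain c N T where T: "pbound P X T" and c: "computes c N T P X Y"
    using assms(1) unfolding ptime_def by blast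
  obtain c' N' T' where T': "pbound P X T'" and c': "computes c' N' T' P X Z"
    using assms(2) unfolding ptime_def by blast
  define M where "M = Suc (max N N')"
  have M: "0 < M" "N < M" "N' < M" by (auto simp: M_def)
  define p where "p = Seq (Assign M (Var 0)) (Seq c (Seq (Assign (Suc M) (Var 0)) (Seq (Assign 0 (Var M))
    (Seq c' (Seq (Assign 0 (EPair (Var (Suc M)) (Var 0))) (Seq (Assign M EAtom) (Assign (Suc M) EAtom)))))))"
  show ?thesis
  proof (rule ptimeI)
    show "pbound P X (\<lambda>i. (1 + size (X i)) + (T i + ((1 + size (Y i)) + ((1 + size (X i)) +
        (T' i + ((2 + size (Y i) + size (Z i)) + (1 + 1)))))))"
      by (intro pbound_intros T T' pbound_size ptime_pbound assms)
    fix i s assume P: "P i" and s: "s 0 = X i" "\<And>j. 0 < j \<Longrightarrow> j < M + 2 \<Longrightarrow> s j = Atom"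
    define s1 where "s1 = s(M := X i)"
    define s2 where "s2 = s1(0 := Y i)"
    define s3 where "s3 = s2(Suc M := Y i)"
    define s4 where "s4 = s3(0 := X i)"
    define s5 where "s5 = s4(0 := Z i)"
    define s6 where "s6 = s5(0 := Pair (Y i) (Z i))"
    define s7 where "s7 = s6(M := Atom)"
    note defs = s1_def s2_def s3_def s4_def s5_def s6_def s7_def
    have 1: "exec (Assign M (Var 0)) s (1 + size (X i)) s1"
      using exec.Assign[of M "Var 0" s] by (simp add: defs s)
    have "\<exists>t. exec c s1 t (s1(0 := Y i)) \<and> t \<le> T i"
      by (rule computesD[OF c P]) (use s M in \<open>auto simp: defs\<close>)
    then obtain t where t: "exec c s1 t s2" "t \<le> T i" unfolding s2_def by blast
    have 3: "exec (Assign (Suc M) (Var 0)) s2 (1 + size (Y i)) s3"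
      using exec.Assign[of "Suc M" "Var 0" s2] by (simp add: defs s)
    have 4: "exec (Assign 0 (Var M)) s3 (1 + size (X i)) s4"
      using exec.Assign[of 0 "Var M" s3] M by (simp add: defs s)
    have "\<exists>t. exec c' s4 t (s4(0 := Z i)) \<and> t \<le> T' i"
      by (rule computesD[OF c' P]) (use s M in \<open>auto simp: defs\<close>)
    then obtain t' where t': "exec c' s4 t' s5" "t' \<le> T' i" unfolding s5_def by blast
    have 6: "exec (Assign 0 (EPair (Var (Suc M)) (Var 0))) s5 (2 + size (Y i) + size (Z i)) s6"
      using exec.Assign[of 0 "EPair (Var (Suc M)) (Var 0)" s5] M by (simp add: defs s)
    have 7: "exec (Assign M EAtom) s6 1 s7"
      using exec.Assign[of M EAtom s6] by (simp add: defs s)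
    have "s7(Suc M := Atom) = s(0 := Pair (Y i) (Z i))"
      using s M by (auto simp: defs fun_eq_iff)
    then have 8: "exec (Assign (Suc M) EAtom) s7 1 (s(0 := Pair (Y i) (Z i)))"
      using exec.Assign[of "Suc M" EAtom s7] by simp
    show "\<exists>t. exec p s t (s(0 := Pair (Y i) (Z i))) \<and> t \<le> (1 + size (X i)) + (T i + ((1 + size (Y i)) + ((1 + size (X i)) +
        (T' i + ((2 + size (Y i) + size (Z i)) + (1 + 1))))))"
      unfolding p_def
      by (intro exI conjI, rule exec.Seq[OF 1 exec.Seq[OF t(1) exec.Seq[OF 3 exec.Seq[OF 4
            exec.Seq[OF t'(1) exec.Seq[OF 6 exec.Seq[OF 7 8]]]]]]])
         (use t(2) t'(2) in simp)
  qed
qed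

lemma ptime_fst: "ptime P X (\<lambda>i. Pair (Y i) (Z i)) \<Longrightarrow> ptime P X Y"
  by (drule ptime_head) simp

lemma ptime_snd: "ptime P X (\<lambda>i. Pair (Y i) (Z i)) \<Longrightarrow> ptime P X Z"
  by (drule ptime_tail) simp

definition enc_bool :: "bool \<Rightarrow> data" where
  "enc_bool b = (if b then Pair Atom Atom else Atom)"

lemma enc_bool_eq_Atom [simp]: "enc_bool b = Atom \<longleftrightarrow> \<not> b"
  by (simp add: enc_bool_def)

text \<open>Each branch has to be fast only where it is taken, which admits partial operations such
  as \<open>hd\<close> under a test for emptiness. The test value travels in front of the input, and
  each branch starts by dropping it.\<close>

lemma ptime_if_test:
  assumes "ptime P X B" "\<And>i. P i \<Longrightarrow> B i \<noteq> Atom \<longleftrightarrow> b i"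
    and "ptime (\<lambda>i. P i \<and> b i) X Y" "ptime (\<lambda>i. P i \<and> \<not> b i) X Z"
  shows "ptime P X (\<lambda>i. if b i then Y i else Z i)"
proof -
  let ?X = "\<lambda>i. Pair (B i) (X i)"
  have BX: "ptime P X ?X" by (intro ptime_Pair assms ptime_id)
  have X: "ptime Q ?X X" for Q by (rule ptime_snd[OF ptime_id])
  note YZ = ptime_trans[OF X assms(3)] ptime_trans[OF X assms(4)]
  obtain c N T where T: "pbound (\<lambda>i. P i \<and> b i) ?X T" and c: "computes c N T (\<lambda>i. P i \<and> b i) ?X Y"
    using YZ(1) unfolding ptime_def by blast
  obtain c' N' T' where T': "pbound (\<lambda>i. P i \<and> \<not> b i) ?X T'" and c': "computes c' N' T' (\<lambda>i. P i \<and> \<not> b i) ?X Z"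
    using YZ(2) unfolding ptime_def by blast
  obtain k l where k: "\<And>i. P i \<and> b i \<Longrightarrow> T i \<le> (size (?X i) + 2) ^ k"
    and l: "\<And>i. P i \<and> \<not> b i \<Longrightarrow> T' i \<le> (size (?X i) + 2) ^ l"
    using T T' unfolding pbound_def by blast
  have "ptime P ?X (\<lambda>i. if b i then Y i else Z i)"
  proof (rule ptimeI[where T = "\<lambda>i. 1 + ((size (?X i) + 2) ^ k + (size (?X i) + 2) ^ l)" and N = "max N N'" and c = "If (Hd (Var 0)) c c'"])
    show "pbound P ?X (\<lambda>i. 1 + ((size (?X i) + 2) ^ k + (size (?X i) + 2) ^ l))"
      by (intro pbound_intros pbound_size)
    fix i s assume P: "P i" and s: "s 0 = ?X i" "\<And>j. 0 < j \<Longrightarrow> j < max N N' \<Longrightarrow> s j = Atom"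
    show "\<exists>t. exec (If (Hd (Var 0)) c c') s t (s(0 := if b i then Y i else Z i)) \<and>
        t \<le> 1 + ((size (?X i) + 2) ^ k + (size (?X i) + 2) ^ l)"
    proof (cases "b i")
      case True
      have "\<exists>t. exec c s t (s(0 := Y i)) \<and> t \<le> T i"
        by (rule computesD[OF c]) (use P True s in auto)
      then obtain t where t: "exec c s t (s(0 := Y i))" "t \<le> T i" by blast
      have "exec (If (Hd (Var 0)) c c') s (1 + t) (s(0 := Y i))"
        by (rule exec.IfTrue[OF _ t(1)]) (use assms(2)[OF P] True s in auto)
      moreover have "t \<le> (size (?X i) + 2) ^ k" using t(2) k[of i] P True by (meson order_trans)
      ultimately show ?thesis using True by (intro exI[of _ "1 + t"]) auto
    next
      case False
      have "\<exists>t. exec c' s t (s(0 := Z i)) \<and> t \<le> T' i"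
        by (rule computesD[OF c']) (use P False s in auto)
      then obtain t where t: "exec c' s t (s(0 := Z i))" "t \<le> T' i" by blast
      have "exec (If (Hd (Var 0)) c c') s (1 + t) (s(0 := Z i))"
        by (rule exec.IfFalse[OF _ t(1)]) (use assms(2)[OF P] False s in auto)
      moreover have "t \<le> (size (?X i) + 2) ^ l" using t(2) l[of i] P False by (meson order_trans)
      ultimately show ?thesis using False by (intro exI[of _ "1 + t"]) auto
    qed
  qed
  then show ?thesis by (rule ptime_trans[OF BX])
qed

lemma ptime_weaken: "ptime P X Y \<Longrightarrow> (\<And>i. P' i \<Longrightarrow> P i) \<Longrightarrow> ptime P' X Y"
  by (rule ptime_cong[where P = P and X = X and Y = Y]) (assumption | rule refl)+

lemma ptime_if:
  assumes "ptime P X (\<lambda>i. enc_bool (b i))" "ptime P X Y" "ptime P X Z"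
  shows "ptime P X (\<lambda>i. if b i then Y i else Z i)"
  by (rule ptime_if_test[OF assms(1)], simp) (rule ptime_weaken, rule assms, simp)+

lemma ptime_test:
  assumes "ptime P X B" "\<And>i. P i \<Longrightarrow> B i \<noteq> Atom \<longleftrightarrow> b i"
  shows "ptime P X (\<lambda>i. enc_bool (b i))"
  unfolding enc_bool_def
  by (rule ptime_if_test[OF assms]) (simp, (intro ptime_Pair ptime_Atom)+)

section \<open>Passing between \<open>runs\<close> and \<open>ptime\<close>\<close>

lemma ptime_runs:
  assumes "pbound P X T" "\<And>i. P i \<Longrightarrow> \<exists>t. runs c (X i) t (Y i) \<and> t \<le> T i"
  shows "ptime P X Y"
proof (rule ptimeI[where T = "\<lambda>i. T i + Suc (com_bound c)" and N = "Suc (com_bound c)" and c = "Seq c (clear_vars (com_bound c))"])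
  show "pbound P X (\<lambda>i. T i + Suc (com_bound c))" by (intro pbound_intros assms)
  fix i s assume P: "P i" and s: "s 0 = X i" "\<And>j. 0 < j \<Longrightarrow> j < Suc (com_bound c) \<Longrightarrow> s j = Atom"
  obtain t s' where t: "exec c ((\<lambda>_. Atom)(0 := X i)) t s'" "s' 0 = Y i" "t \<le> T i"
    using assms(2)[OF P] unfolding runs_def by blast
  let ?s = "\<lambda>v. if v < Suc (com_bound c) then s' v else s v"
  have 1: "exec c s t ?s"
    by (rule exec_frame[OF t(1)]) (use s in \<open>auto simp: less_Suc_eq\<close>)
  have "(\<lambda>v. if 0 < v \<and> v \<le> com_bound c then Atom else ?s v) = s(0 := Y i)"
    using s t(2) by (auto simp: fun_eq_iff)
  with exec_clear_vars[of "com_bound c" ?s] have 2: "exec (clear_vars (com_bound c)) ?s (Suc (com_bound c)) (s(0 := Y i))"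
    by simp
  show "\<exists>t. exec (Seq c (clear_vars (com_bound c))) s t (s(0 := Y i)) \<and> t \<le> T i + Suc (com_bound c)"
    using exec.Seq[OF 1 2] t(3) by (intro exI) auto
qed

lemma ptime_imp_runs:
  assumes "ptime P X Y"
  shows "\<exists>c p. \<forall>i. P i \<longrightarrow> (\<exists>t. runs c (X i) t (Y i) \<and> t \<le> poly p (size (X i)))"
proof -
  obtain c N T k where c: "computes c N T P X Y" and k: "\<And>i. P i \<Longrightarrow> T i \<le> (size (X i) + 2) ^ k"
    using assms unfolding ptime_def pbound_def by blast
  have "\<exists>t. runs c (X i) t (Y i) \<and> t \<le> poly ([:2, 1:] ^ k) (size (X i))" if P: "P i" for i
  proof -
    have "\<exists>t. exec c ((\<lambda>_. Atom)(0 := X i)) t (((\<lambda>_. Atom)(0 := X i))(0 := Y i)) \<and> t \<le> T i"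
      by (rule computesD[OF c P]) auto
    then obtain t where t: "exec c ((\<lambda>_. Atom)(0 := X i)) t (((\<lambda>_. Atom)(0 := X i))(0 := Y i))" "t \<le> T i" by blast
    have "runs c (X i) t (Y i)" unfolding runs_def by (rule exI[of _ "((\<lambda>_. Atom)(0 := X i))(0 := Y i)"]) (simp add: t(1)[simplified])
    moreover have "t \<le> poly ([:2, 1:] ^ k) (size (X i))" using t(2) k[OF P] by (simp add: poly_power add.commute)
    ultimately show ?thesis by blast
  qed
  then show ?thesis by blast
qed


section \<open>Lists\<close>

lemma size_enc_list: "size (enc_list e xs) = (\<Sum>x\<leftarrow>xs. Suc (size (e x)))"
  by (induction xs) auto

lemma size_enc_list_le:
  "length xs \<le> n \<Longrightarrow> (\<And>x. x \<in> set xs \<Longrightarrow> size (e x) \<le> b) \<Longrightarrow> size (enc_list e xs) \<le> n * Suc b"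
proof -
  assume *: "length xs \<le> n" "\<And>x. x \<in> set xs \<Longrightarrow> size (e x) \<le> b"
  have "size (enc_list e xs) \<le> length xs * Suc b" using *(2)
  proof (induction xs)
    case (Cons x xs)
    then have "size (enc_list e xs) \<le> length xs * Suc b" "size (e x) \<le> b" by auto
    then show ?case by simp
  qed simp
  also have "\<dots> \<le> n * Suc b" using *(1) by (rule mult_le_mono1)
  finally show ?thesis .
qed

lemma length_le_size_enc_list: "length xs \<le> size (enc_list e xs)"
  by (induction xs) auto

lemma size_le_size_enc_list: "x \<in> set xs \<Longrightarrow> Suc (size (e x)) \<le> size (enc_list e xs)"
  by (induction xs) auto

lemma enc_list_map: "enc_list e (map f xs) = enc_list (\<lambda>x. e (f x)) xs"
  by (induction xs) auto

lemma enc_list_cong: "(\<And>x. x \<in> set xs \<Longrightarrow> e x = e' x) \<Longrightarrow> enc_list e xs = enc_list e' xs"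
  by (induction xs) auto

lemma pbound_length:
  "ptime P X (\<lambda>i. enc_list (e i) (xs i)) \<Longrightarrow> pbound P X (\<lambda>i. length (xs i))"
  by (erule pbound_mono[OF ptime_pbound]) (rule length_le_size_enc_list)

text \<open>A loop whose state in variable \<open>0\<close> consists of the unread list, the input
  and the accumulator. The bound \<open>n\<close> on all intermediate accumulators is a premise,
  because a fast step may double the size, and iterating it would lead to exponential growth.
  \<open>Q\<close> is an invariant that the step program may rely on.\<close>

lemma ptime_fold:
  fixes g :: "'a \<Rightarrow> 'b \<Rightarrow> 's \<Rightarrow> 's"
  assumes xs: "ptime P X (\<lambda>i. enc_list (e i) (xs i))"
    and s0: "ptime P X (\<lambda>i. S i (s0 i))"
    and step: "ptime (\<lambda>z. P (fst z) \<and> Q (fst z) (fst (snd z)) (snd (snd z)))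
      (\<lambda>z. Pair (X (fst z)) (Pair (e (fst z) (fst (snd z))) (S (fst z) (snd (snd z)))))
      (\<lambda>z. S (fst z) (g (fst z) (fst (snd z)) (snd (snd z))))"
    and Q: "\<And>i ys b zs. P i \<Longrightarrow> xs i = ys @ b # zs \<Longrightarrow> Q i b (fold (g i) ys (s0 i))"
    and bnd: "pbound P X n" "\<And>i ys zs. P i \<Longrightarrow> xs i = ys @ zs \<Longrightarrow> size (S i (fold (g i) ys (s0 i))) \<le> n i"
  shows "ptime P X (\<lambda>i. S i (fold (g i) (xs i) (s0 i)))"
proof -
  define W where "W i bs s = Pair (enc_list (e i) bs) (Pair (X i) (S i s))" for i bs s
  define R where "R z \<longleftrightarrow> P (fst z) \<and> Q (fst z) (hd (fst (snd z))) (snd (snd z)) \<and> fst (snd z) \<noteq> []"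
    for z :: "'a \<times> 'b list \<times> 's"
  let ?W = "\<lambda>z. W (fst z) (fst (snd z)) (snd (snd z))"
  have W: "ptime R ?W ?W" by (rule ptime_id)
  have 1: "ptime R ?W (\<lambda>z. enc_list (e (fst z)) (tl (fst (snd z))))"
    by (rule ptime_cong[OF ptime_tail[OF ptime_head[OF W]]]) (auto simp: W_def R_def neq_Nil_conv)
  have 2: "ptime R ?W (\<lambda>z. e (fst z) (hd (fst (snd z))))"
    by (rule ptime_cong[OF ptime_head[OF ptime_head[OF W]]]) (auto simp: W_def R_def neq_Nil_conv)
  have 3: "ptime R ?W (\<lambda>z. X (fst z))" "ptime R ?W (\<lambda>z. S (fst z) (snd (snd z)))"
    by (rule ptime_cong[OF ptime_head[OF ptime_tail[OF W]]], auto simp: W_def,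
        rule ptime_cong[OF ptime_tail[OF ptime_tail[OF W]]], auto simp: W_def)
  let ?h = "\<lambda>z. (fst z, hd (fst (snd z)), snd (snd z))"
  have "ptime R ?W (\<lambda>z. (\<lambda>z. Pair (X (fst z)) (Pair (e (fst z) (fst (snd z))) (S (fst z) (snd (snd z))))) (?h z))"
    using ptime_Pair[OF 3(1) ptime_Pair[OF 2 3(2)]] by simp
  moreover have "P (fst (?h z)) \<and> Q (fst (?h z)) (fst (snd (?h z))) (snd (snd (?h z)))" if "R z" for z
    using that by (simp add: R_def)
  ultimately have "ptime R ?W (\<lambda>z. (\<lambda>z. S (fst z) (g (fst z) (fst (snd z)) (snd (snd z)))) (?h z))"
    by (rule ptime_apply[OF step])
  then have 4: "ptime R ?W (\<lambda>z. S (fst z) (g (fst z) (hd (fst (snd z))) (snd (snd z))))"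
    by simp
  let ?Z = "\<lambda>z. W (fst z) (tl (fst (snd z))) (g (fst z) (hd (fst (snd z))) (snd (snd z)))"
  have "ptime R ?W (\<lambda>z. Pair (enc_list (e (fst z)) (tl (fst (snd z))))
      (Pair (X (fst z)) (S (fst z) (g (fst z) (hd (fst (snd z))) (snd (snd z))))))"
    by (intro ptime_Pair 1 3 4)
  then have "ptime R ?W ?Z" by (rule ptime_cong) (simp_all add: W_def)
  then obtain c N T k where k: "\<And>z. R z \<Longrightarrow> T z \<le> (size (?W z) + 2) ^ k" and c: "computes c N T R ?W ?Z"
    unfolding ptime_def pbound_def by blast
  define L where "L i = size (enc_list (e i) (xs i))" for i
  \<comment> \<open>Bounds the code of every loop state; the \<open>2\<close> pays for the two
    \<open>Pair\<close> nodes of \<open>W\<close>.\<close>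
  define B where "B i = L i + size (X i) + n i + 2" for i
  \<comment> \<open>Generalised over the prefix \<open>ys\<close> already consumed, so that the
    invariant and the size bound are available at each accumulator that is reached.\<close>
  have loop: "\<exists>t. exec (While (Hd (Var 0)) c) s t (s(0 := W i [] (fold (g i) (xs i) (s0 i)))) \<and>
      t \<le> 1 + length zs * (1 + (B i + 2) ^ k)"
    if "P i" "xs i = ys @ zs" "s 0 = W i zs (fold (g i) ys (s0 i))" "\<And>j. 0 < j \<Longrightarrow> j < N \<Longrightarrow> s j = Atom"
    for i s ys zs
    using that(2-)
  proof (induction zs arbitrary: ys s)
    case Nil
    then have "s(0 := W i [] (fold (g i) (xs i) (s0 i))) = s" by (auto simp: fun_eq_iff)
    moreover have "exec (While (Hd (Var 0)) c) s 1 s"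
      by (rule exec.WhileFalse) (use Nil in \<open>simp add: W_def\<close>)
    ultimately show ?case by auto
  next
    case (Cons b zs)
    let ?z = "(i, b # zs, fold (g i) ys (s0 i))"
    let ?s = "s(0 := W i zs (fold (g i) (ys @ [b]) (s0 i)))"
    have R: "R ?z" using \<open>P i\<close> Q[of i ys b zs] Cons.prems by (simp add: R_def)
    have "\<exists>t. exec c s t ?s \<and> t \<le> T ?z"
      using computesD[OF c R, of s] Cons.prems by simp
    then obtain t where t: "exec c s t ?s" "t \<le> T ?z" by blast
    have "size (enc_list (e i) (b # zs)) \<le> L i" using Cons.prems(1) by (simp add: L_def size_enc_list)
    then have "size (?W ?z) \<le> B i"
      using bnd(2)[of i ys "b # zs"] \<open>P i\<close> Cons.prems(1) by (simp add: W_def B_def)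
    then have "(size (?W ?z) + 2) ^ k \<le> (B i + 2) ^ k" by (intro power_mono) auto
    with t(2) k[OF R] have t2: "t \<le> (B i + 2) ^ k" by linarith
    have "\<exists>t'. exec (While (Hd (Var 0)) c) ?s t' (?s(0 := W i [] (fold (g i) (xs i) (s0 i)))) \<and>
        t' \<le> 1 + length zs * (1 + (B i + 2) ^ k)"
      by (rule Cons.IH[of "ys @ [b]" ?s]) (use Cons.prems in auto)
    then obtain t' where t': "exec (While (Hd (Var 0)) c) ?s t' (?s(0 := W i [] (fold (g i) (xs i) (s0 i))))"
      "t' \<le> 1 + length zs * (1 + (B i + 2) ^ k)" by blast
    have "exec (While (Hd (Var 0)) c) s (1 + t + t') (?s(0 := W i [] (fold (g i) (xs i) (s0 i))))"
      by (rule exec.WhileTrue[OF _ t(1) t'(1)]) (use Cons.prems in \<open>simp add: W_def\<close>)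
    then have "exec (While (Hd (Var 0)) c) s (1 + t + t') (s(0 := W i [] (fold (g i) (xs i) (s0 i))))"
      by (simp only: fun_upd_upd)
    moreover have "1 + t + t' \<le> 1 + length (b # zs) * (1 + (B i + 2) ^ k)" using t2 t'(2) by simp
    ultimately show ?case by blast
  qed
  have start: "ptime P X (\<lambda>i. W i (xs i) (s0 i))"
    unfolding W_def by (intro ptime_Pair xs s0 ptime_id)
  have "ptime P (\<lambda>i. W i (xs i) (s0 i)) (\<lambda>i. W i [] (fold (g i) (xs i) (s0 i)))"
  proof (rule ptimeI)
    have X: "ptime P (\<lambda>i. W i (xs i) (s0 i)) X" "ptime P (\<lambda>i. W i (xs i) (s0 i)) (\<lambda>i. enc_list (e i) (xs i))"
      unfolding W_def by (rule ptime_fst[OF ptime_snd[OF ptime_id]], rule ptime_fst[OF ptime_id])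
    show "pbound P (\<lambda>i. W i (xs i) (s0 i)) (\<lambda>i. 1 + length (xs i) * (1 + (B i + 2) ^ k))"
      unfolding B_def L_def
      by (intro pbound_intros pbound_length[OF X(2)] ptime_pbound X pbound_trans[OF ptime_pbound[OF X(1)] bnd(1)])
    fix i s assume "P i" "s 0 = W i (xs i) (s0 i)" "\<And>j. 0 < j \<Longrightarrow> j < N \<Longrightarrow> s j = Atom"
    then show "\<exists>t. exec (While (Hd (Var 0)) c) s t (s(0 := W i [] (fold (g i) (xs i) (s0 i)))) \<and>
        t \<le> 1 + length (xs i) * (1 + (B i + 2) ^ k)"
      by (intro loop[of i "[]" "xs i" s]) simp_all
  qed
  from ptime_trans[OF start this]
  have "ptime P X (\<lambda>i. Pair Atom (Pair (X i) (S i (fold (g i) (xs i) (s0 i)))))"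
    by (simp add: W_def)
  then show ?thesis by (rule ptime_snd[OF ptime_snd])
qed

text \<open>Inside a loop the input is extended by loop data \<open>W\<close>; whatever was
  computable from the outer input stays so.\<close>

lemma ptime_lift:
  assumes "ptime P X Y" "\<forall>z. Q z \<longrightarrow> P (fst z)"
  shows "ptime Q (\<lambda>z. Pair (X (fst z)) (W z)) (\<lambda>z. Y (fst z))"
  by (rule ptime_apply[OF assms(1) ptime_fst[OF ptime_id]]) (use assms(2) in blast)

lemma ptime_proj:
  "ptime Q (\<lambda>z. Pair (A z) (B z)) A"
  "ptime Q (\<lambda>z. Pair (A z) (B z)) B"
  "ptime Q (\<lambda>z. Pair (A z) (Pair (B z) (C z))) B"
  "ptime Q (\<lambda>z. Pair (A z) (Pair (B z) (C z))) C"
  by (rule ptime_fst[OF ptime_id], rule ptime_snd[OF ptime_id],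
      rule ptime_fst[OF ptime_snd[OF ptime_id]], rule ptime_snd[OF ptime_snd[OF ptime_id]])

lemma ptime_Nil: "ptime P X (\<lambda>i. enc_list (e i) [])"
  by (simp add: ptime_Atom)

lemma ptime_Cons:
  "ptime P X (\<lambda>i. e i (x i)) \<Longrightarrow> ptime P X (\<lambda>i. enc_list (e i) (xs i)) \<Longrightarrow>
    ptime P X (\<lambda>i. enc_list (e i) (x i # xs i))"
  by (simp add: ptime_Pair)

lemma ptime_hd:
  assumes "ptime P X (\<lambda>i. enc_list (e i) (xs i))" "\<And>i. P i \<Longrightarrow> xs i \<noteq> []"
  shows "ptime P X (\<lambda>i. e i (hd (xs i)))"
proof (rule ptime_cong[OF ptime_head[OF assms(1)]], assumption, rule refl)
  show "head (enc_list (e i) (xs i)) = e i (hd (xs i))" if "P i" for i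
    using assms(2)[OF that] by (cases "xs i") auto
qed

lemma ptime_not:
  assumes "ptime P X (\<lambda>i. enc_bool (b i))"
  shows "ptime P X (\<lambda>i. enc_bool (\<not> b i))"
  by (rule ptime_cong[OF ptime_if[OF assms ptime_Atom ptime_Pair[OF ptime_Atom ptime_Atom]]])
    (auto simp: enc_bool_def)

lemma ptime_conj:
  assumes "ptime P X (\<lambda>i. enc_bool (b i))" "ptime P X (\<lambda>i. enc_bool (c i))"
  shows "ptime P X (\<lambda>i. enc_bool (b i \<and> c i))"
  by (rule ptime_cong[OF ptime_if[OF assms ptime_Atom]]) (auto simp: enc_bool_def)

lemma ptime_disj:
  assumes "ptime P X (\<lambda>i. enc_bool (b i))" "ptime P X (\<lambda>i. enc_bool (c i))"
  shows "ptime P X (\<lambda>i. enc_bool (b i \<or> c i))"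
  by (rule ptime_cong[OF ptime_if[OF assms(1) assms(1) assms(2)]]) (auto simp: enc_bool_def)

lemma enc_list_eq_Atom [simp]: "enc_list e xs = Atom \<longleftrightarrow> xs = []"
  by (cases xs) auto

lemma ptime_eq_Nil:
  assumes "ptime P X (\<lambda>i. enc_list (e i) (xs i))"
  shows "ptime P X (\<lambda>i. enc_bool (xs i = []))"
  using ptime_not[OF ptime_test[OF assms, of "\<lambda>i. xs i \<noteq> []"]] by simp

lemma size_enc_list_append: "size (enc_list e (xs @ ys)) = size (enc_list e xs) + size (enc_list e ys)"
  by (simp add: size_enc_list)

lemma size_enc_list_rev: "size (enc_list e (rev xs)) = size (enc_list e xs)"
  by (induction xs) (auto simp: size_enc_list_append)

lemma size_enc_list_filter: "size (enc_list e (filter p xs)) \<le> size (enc_list e xs)"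
  by (induction xs) auto

text \<open>Pushing elements onto an accumulator reverses them, so this is what a loop yields
  directly. Append, filter and map are completed by a further reversal.\<close>

lemma ptime_rev_append:
  assumes "ptime P X (\<lambda>i. enc_list (e i) (xs i))" "ptime P X (\<lambda>i. enc_list (e i) (ys i))"
  shows "ptime P X (\<lambda>i. enc_list (e i) (rev (xs i) @ ys i))"
proof -
  have f: "fold (\<lambda>b s. b # s) as bs = rev as @ bs" for as bs :: "'b list"
    by (induction as arbitrary: bs) auto
  have "ptime P X (\<lambda>i. enc_list (e i) (fold (\<lambda>b s. b # s) (xs i) (ys i)))"
    by (rule ptime_fold[where S = "\<lambda>i. enc_list (e i)" and Q = "\<lambda>_ _ _. True" and e = e
        and n = "\<lambda>i. size (enc_list (e i) (xs i)) + size (enc_list (e i) (ys i))"])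
      (auto simp: f size_enc_list_append size_enc_list_rev
        intro!: assms ptime_Pair ptime_proj pbound_add ptime_pbound)
  then show ?thesis by (simp add: f)
qed

lemma ptime_rev:
  "ptime P X (\<lambda>i. enc_list (e i) (xs i)) \<Longrightarrow> ptime P X (\<lambda>i. enc_list (e i) (rev (xs i)))"
  using ptime_rev_append[where ys = "\<lambda>_. []"] by (simp add: ptime_Atom)

lemma ptime_append:
  assumes "ptime P X (\<lambda>i. enc_list (e i) (xs i))" "ptime P X (\<lambda>i. enc_list (e i) (ys i))"
  shows "ptime P X (\<lambda>i. enc_list (e i) (xs i @ ys i))"
  using ptime_rev_append[OF ptime_rev[OF assms(1)] assms(2)] by simp

lemma ptime_concat:
  assumes "ptime P X (\<lambda>i. enc_list (enc_list (e i)) (xss i))"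
  shows "ptime P X (\<lambda>i. enc_list (e i) (concat (xss i)))"
proof -
  have f: "fold (\<lambda>b s. s @ b) as bs = bs @ concat as" for as and bs :: "'b list"
    by (induction as arbitrary: bs) auto
  have c: "size (enc_list e (concat as)) \<le> size (enc_list (enc_list e) as)" for e as
    by (induction as) (auto simp: size_enc_list_append)
  have "ptime P X (\<lambda>i. enc_list (e i) (fold (\<lambda>b s. s @ b) (xss i) []))"
  proof (rule ptime_fold[where S = "\<lambda>i. enc_list (e i)" and Q = "\<lambda>_ _ _. True" and e = "\<lambda>i. enc_list (e i)"
        and n = "\<lambda>i. size (enc_list (enc_list (e i)) (xss i))"])
    fix i ys zs assume "xss i = ys @ zs"
    then show "size (enc_list (e i) (fold (\<lambda>b s. s @ b) ys [])) \<le> size (enc_list (enc_list (e i)) (xss i))"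
      using c[of "e i" ys] by (simp add: f size_enc_list_append)
  qed (auto intro!: assms ptime_append ptime_proj pbound_add ptime_pbound ptime_Atom)
  then show ?thesis by (simp add: f)
qed

lemma ptime_filter:
  assumes xs: "ptime P X (\<lambda>i. enc_list (e i) (xs i))"
    and p: "ptime (\<lambda>z. P (fst z) \<and> snd z \<in> set (xs (fst z))) (\<lambda>z. Pair (X (fst z)) (e (fst z) (snd z)))
      (\<lambda>z. enc_bool (p (fst z) (snd z)))"
  shows "ptime P X (\<lambda>i. enc_list (e i) (filter (p i) (xs i)))"
proof -
  let ?g = "\<lambda>i b s. if p i b then b # s else s"
  have f: "fold (?g i) as bs = rev (filter (p i) as) @ bs" for i as bs
    by (induction as arbitrary: bs) auto
  have "ptime P X (\<lambda>i. enc_list (e i) (fold (?g i) (xs i) []))"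
  proof (rule ptime_fold[where S = "\<lambda>i. enc_list (e i)" and Q = "\<lambda>i b _. b \<in> set (xs i)" and e = e
        and n = "\<lambda>i. size (enc_list (e i) (xs i))"])
    let ?Q = "\<lambda>z. P (fst z) \<and> fst (snd z) \<in> set (xs (fst z))"
    let ?X = "\<lambda>z. Pair (X (fst z)) (Pair (e (fst z) (fst (snd z))) (enc_list (e (fst z)) (snd (snd z))))"
    have "ptime ?Q ?X (\<lambda>z. (\<lambda>z. Pair (X (fst z)) (e (fst z) (snd z))) (fst z, fst (snd z)))"
      by (simp, intro ptime_Pair ptime_proj)
    from ptime_apply[OF p this] have "ptime ?Q ?X (\<lambda>z. enc_bool (p (fst z) (fst (snd z))))" by simp
    from ptime_if[OF this ptime_Pair ptime_proj(4), OF ptime_proj(3) ptime_proj(4)]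
    show "ptime ?Q ?X (\<lambda>z. enc_list (e (fst z)) (?g (fst z) (fst (snd z)) (snd (snd z))))"
      by (rule ptime_cong) simp_all
    fix i ys zs assume "xs i = ys @ zs"
    then show "size (enc_list (e i) (fold (?g i) ys [])) \<le> size (enc_list (e i) (xs i))"
      using size_enc_list_filter[of "e i" "p i" ys] by (simp add: f size_enc_list_append size_enc_list_rev)
  qed (auto intro!: xs ptime_Nil[simplified] ptime_pbound)
  from ptime_rev[OF this] show ?thesis by (simp add: f)
qed

lemma ptime_map:
  assumes xs: "ptime P X (\<lambda>i. enc_list (e i) (xs i))"
    and step: "ptime (\<lambda>z. P (fst z) \<and> snd z \<in> set (xs (fst z))) (\<lambda>z. Pair (X (fst z)) (e (fst z) (snd z)))
      (\<lambda>z. e' (fst z) (f (fst z) (snd z)))"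
  shows "ptime P X (\<lambda>i. enc_list (e' i) (map (f i) (xs i)))"
proof -
  let ?g = "\<lambda>i b s. f i b # s"
  have f: "fold (?g i) as bs = rev (map (f i) as) @ bs" for i as bs
    by (induction as arbitrary: bs) auto
  obtain k where k: "\<And>z. P (fst z) \<and> snd z \<in> set (xs (fst z)) \<Longrightarrow>
      size (e' (fst z) (f (fst z) (snd z))) \<le> (size (Pair (X (fst z)) (e (fst z) (snd z))) + 2) ^ k"
    using ptime_pbound[OF step] unfolding pbound_def by blast
  \<comment> \<open>The output bound of a single step, evaluated at a size that dominates the code
    of the input paired with any element.\<close>
  define B where "B i = (size (X i) + size (enc_list (e i) (xs i)) + 2) ^ k" for i
  have B: "size (e' i (f i b)) \<le> B i" if "P i" "b \<in> set (xs i)" for i b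
  proof -
    have "size (e' i (f i b)) \<le> (size (Pair (X i) (e i b)) + 2) ^ k" using k[of "(i, b)"] that by simp
    also have "\<dots> \<le> B i" unfolding B_def
      using size_le_size_enc_list[OF that(2), of "e i"] by (intro power_mono) auto
    finally show ?thesis .
  qed
  have "ptime P X (\<lambda>i. enc_list (e' i) (fold (?g i) (xs i) []))"
  proof (rule ptime_fold[where S = "\<lambda>i. enc_list (e' i)" and Q = "\<lambda>i b _. b \<in> set (xs i)" and e = e
        and n = "\<lambda>i. length (xs i) * Suc (B i)"])
    let ?Q = "\<lambda>z. P (fst z) \<and> fst (snd z) \<in> set (xs (fst z))"
    let ?X = "\<lambda>z. Pair (X (fst z)) (Pair (e (fst z) (fst (snd z))) (enc_list (e' (fst z)) (snd (snd z))))"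
    have "ptime ?Q ?X (\<lambda>z. (\<lambda>z. Pair (X (fst z)) (e (fst z) (snd z))) (fst z, fst (snd z)))"
      by (simp, intro ptime_Pair ptime_proj)
    from ptime_apply[OF step this] have "ptime ?Q ?X (\<lambda>z. e' (fst z) (f (fst z) (fst (snd z))))" by simp
    from ptime_Pair[OF this ptime_proj(4)]
    show "ptime ?Q ?X (\<lambda>z. enc_list (e' (fst z)) (?g (fst z) (fst (snd z)) (snd (snd z))))"
      by simp
    show "pbound P X (\<lambda>i. length (xs i) * Suc (B i))"
      unfolding B_def by (intro pbound_intros pbound_length[OF xs] pbound_size ptime_pbound[OF xs])
    fix i ys zs assume i: "P i" "xs i = ys @ zs"
    show "size (enc_list (e' i) (fold (?g i) ys [])) \<le> length (xs i) * Suc (B i)"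
      unfolding f by (rule size_enc_list_le) (use i B[of i] in auto)
  qed (auto intro!: xs ptime_Nil[simplified])
  from ptime_rev[OF this] show ?thesis by (simp add: f)
qed

lemma ptime_Bex:
  assumes xs: "ptime P X (\<lambda>i. enc_list (e i) (xs i))"
    and p: "ptime (\<lambda>z. P (fst z) \<and> snd z \<in> set (xs (fst z))) (\<lambda>z. Pair (X (fst z)) (e (fst z) (snd z)))
      (\<lambda>z. enc_bool (p (fst z) (snd z)))"
  shows "ptime P X (\<lambda>i. enc_bool (\<exists>x\<in>set (xs i). p i x))"
  by (rule ptime_cong[OF ptime_not[OF ptime_eq_Nil[OF ptime_filter[OF assms]]]]) (auto simp: filter_empty_conv)

lemma ptime_Ball:
  assumes xs: "ptime P X (\<lambda>i. enc_list (e i) (xs i))"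
    and p: "ptime (\<lambda>z. P (fst z) \<and> snd z \<in> set (xs (fst z))) (\<lambda>z. Pair (X (fst z)) (e (fst z) (snd z)))
      (\<lambda>z. enc_bool (p (fst z) (snd z)))"
  shows "ptime P X (\<lambda>i. enc_bool (\<forall>x\<in>set (xs i). p i x))"
  by (rule ptime_cong[OF ptime_not[OF ptime_Bex[OF xs ptime_not[OF p]]]]) auto

text \<open>The list \<open>xs\<close> is a clock: its length counts the iterations, so any
  computable list of the right length can drive the loop.\<close>

lemma ptime_funpow:
  fixes g :: "'a \<Rightarrow> 's \<Rightarrow> 's"
  assumes xs: "ptime P X (\<lambda>i. enc_list (e i) (xs i))"
    and s0: "ptime P X (\<lambda>i. S i (s0 i))"
    and step: "ptime (\<lambda>z. P (fst z) \<and> Q (fst z) (snd z)) (\<lambda>z. Pair (X (fst z)) (S (fst z) (snd z)))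
      (\<lambda>z. S (fst z) (g (fst z) (snd z)))"
    and Q: "\<And>i k. P i \<Longrightarrow> k < length (xs i) \<Longrightarrow> Q i ((g i ^^ k) (s0 i))"
    and bnd: "pbound P X n" "\<And>i k. P i \<Longrightarrow> k \<le> length (xs i) \<Longrightarrow> size (S i ((g i ^^ k) (s0 i))) \<le> n i"
  shows "ptime P X (\<lambda>i. S i ((g i ^^ length (xs i)) (s0 i)))"
proof -
  have f: "fold (\<lambda>_. g i) as s = (g i ^^ length as) s" for i s and as :: "'b list"
    by (induction as arbitrary: s) (auto simp: funpow_swap1)
  have "ptime P X (\<lambda>i. S i (fold (\<lambda>_. g i) (xs i) (s0 i)))"
  proof (rule ptime_fold[where S = S and Q = "\<lambda>i _ s. Q i s" and e = e and n = n])
    let ?Q = "\<lambda>z. P (fst z) \<and> Q (fst z) (snd (snd z))"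
    let ?X = "\<lambda>z. Pair (X (fst z)) (Pair (e (fst z) (fst (snd z))) (S (fst z) (snd (snd z))))"
    have "ptime ?Q ?X (\<lambda>z. (\<lambda>z. Pair (X (fst z)) (S (fst z) (snd z))) (fst z, snd (snd z)))"
      by (simp, intro ptime_Pair ptime_proj)
    from ptime_apply[OF step this]
    show "ptime ?Q ?X (\<lambda>z. S (fst z) (g (fst z) (snd (snd z))))" by simp
  qed (auto simp: f intro!: xs s0 bnd Q)
  then show ?thesis by (simp add: f)
qed


section \<open>Numbers\<close>

text \<open>Unary numbers are codes of lists of constant elements, so length, addition and clocks
  come from list operations.\<close>

lemma enc_list_unary: "enc_list (\<lambda>_. Atom) xs = enc_unary (length xs)"
  by (induction xs) auto

lemma ptime_length:
  assumes "ptime P X (\<lambda>i. enc_list (e i) (xs i))"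
  shows "ptime P X (\<lambda>i. enc_unary (length (xs i)))"
  using ptime_map[OF assms, of "\<lambda>_ _. Atom" "\<lambda>_ x. x"] by (simp add: enc_list_unary ptime_Atom)

lemma ptime_unary_add:
  "ptime P X (\<lambda>i. enc_unary (a i)) \<Longrightarrow> ptime P X (\<lambda>i. enc_unary (b i)) \<Longrightarrow>
    ptime P X (\<lambda>i. enc_unary (a i + b i))"
  using ptime_append[where e = "\<lambda>_ _. Atom" and xs = "\<lambda>i. replicate (a i) ()" and ys = "\<lambda>i. replicate (b i) ()"]
  by (simp add: enc_list_unary)

lemma enc_unary_eq_Atom [simp]: "enc_unary n = Atom \<longleftrightarrow> n = 0"
  by (cases n) auto

lemma tail_enc_unary: "tail (enc_unary n) = enc_unary (n - Suc 0)"
  by (cases n) auto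

text \<open>Truncated subtraction: taking the tail \<open>b i\<close> times turns the unary code of
  \<open>a i\<close> into \<open>Atom\<close> exactly if \<open>a i \<le> b i\<close>.\<close>

lemma ptime_unary_le:
  assumes "ptime P X (\<lambda>i. enc_unary (a i))" "ptime P X (\<lambda>i. enc_unary (b i))"
  shows "ptime P X (\<lambda>i. enc_bool (a i \<le> b i))"
proof -
  have f: "((\<lambda>n. n - Suc 0) ^^ k) m = m - k" for k m :: nat by (induction k) auto
  have "ptime P X (\<lambda>i. enc_unary (((\<lambda>n. n - Suc 0) ^^ length (replicate (b i) ())) (a i)))"
  proof (rule ptime_funpow[where e = "\<lambda>_ _. Atom" and S = "\<lambda>_. enc_unary" and Q = "\<lambda>_ _. True" and n = a])
    show "pbound P X a" using ptime_pbound[OF assms(1)] by simp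
    show "ptime (\<lambda>z. P (fst z) \<and> True) (\<lambda>z. Pair (X (fst z)) (enc_unary (snd z))) (\<lambda>z. enc_unary (snd z - Suc 0))"
      unfolding tail_enc_unary[symmetric] by (intro ptime_tail ptime_proj)
  qed (auto simp: f enc_list_unary assms)
  then have "ptime P X (\<lambda>i. enc_unary (a i - b i))" by (simp add: f)
  from ptime_not[OF ptime_test[OF this, of "\<lambda>i. \<not> a i \<le> b i"]] show ?thesis by simp
qed

section \<open>Binary arithmetic, digit by digit\<close>

lemma enc_nat_0 [simp]: "enc_nat 0 = Atom"
  by (simp add: enc_nat.simps)

lemma enc_nat_eq_Atom [simp]: "enc_nat n = Atom \<longleftrightarrow> n = 0"
  by (subst enc_nat.simps) simp

lemma head_enc_nat: "head (enc_nat n) = enc_bool (odd n)"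
  by (subst enc_nat.simps) (simp add: enc_bool_def)

lemma tail_enc_nat: "tail (enc_nat n) = enc_nat (n div 2)"
  by (subst enc_nat.simps) simp

text \<open>The exceptional case keeps numerals canonical: a zero digit is not put in front of the
  empty numeral.\<close>

lemma enc_nat_double: "enc_nat (2 * n + of_bool b) = (if n = 0 \<and> \<not> b then Atom else Pair (enc_bool b) (enc_nat n))"
  by (subst enc_nat.simps) (auto simp: enc_bool_def)

lemma ptime_odd: "ptime P X (\<lambda>i. enc_nat (a i)) \<Longrightarrow> ptime P X (\<lambda>i. enc_bool (odd (a i)))"
  using ptime_head[of P X "\<lambda>i. enc_nat (a i)"] by (simp add: head_enc_nat)

lemma ptime_half: "ptime P X (\<lambda>i. enc_nat (a i)) \<Longrightarrow> ptime P X (\<lambda>i. enc_nat (a i div 2))"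
  using ptime_tail[of P X "\<lambda>i. enc_nat (a i)"] by (simp add: tail_enc_nat)

lemma ptime_nat_eq_0: "ptime P X (\<lambda>i. enc_nat (a i)) \<Longrightarrow> ptime P X (\<lambda>i. enc_bool (a i = 0))"
  using ptime_not[OF ptime_test[of P X "\<lambda>i. enc_nat (a i)" "\<lambda>i. a i \<noteq> 0"]] by simp

lemma ptime_double:
  assumes "ptime P X (\<lambda>i. enc_nat (a i))" "ptime P X (\<lambda>i. enc_bool (b i))"
  shows "ptime P X (\<lambda>i. enc_nat (2 * a i + of_bool (b i)))"
  unfolding enc_nat_double
  by (intro ptime_if ptime_conj ptime_not ptime_nat_eq_0 ptime_Pair ptime_Atom assms)

text \<open>Makes a numeral the code of a list, so that list lemmas apply to it and it can serve as
  a clock.\<close>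

fun bits :: "nat \<Rightarrow> bool list" where
  "bits n = (if n = 0 then [] else odd n # bits (n div 2))"

declare bits.simps [simp del]

lemma enc_list_bits: "enc_list enc_bool (bits n) = enc_nat n"
proof (induction n rule: bits.induct)
  case (1 n)
  then show ?case by (subst bits.simps, subst enc_nat.simps) (simp add: enc_bool_def[of "odd n"])
qed

lemma less_two_power_bits: "n < 2 ^ length (bits n)"
proof (induction n rule: bits.induct)
  case (1 n)
  show ?case
  proof (cases "n = 0")
    case False
    then have "n < 2 * 2 ^ length (bits (n div 2))" using 1 by (simp add: div_less_iff_less_mult mult.commute)
    then show ?thesis using False by (subst bits.simps) simp
  qed simp
qed

lemma less_two_power: "length (bits n) \<le> k \<Longrightarrow> n < 2 ^ k"
  by (rule order.strict_trans2[OF less_two_power_bits power_increasing]) auto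

lemma less_two_power_size: "n < 2 ^ size (enc_nat n)"
  using length_le_size_enc_list[of "bits n" enc_bool]
  by (intro less_two_power) (simp add: enc_list_bits)

lemma size_enc_nat_le: "n < 2 ^ k \<Longrightarrow> size (enc_nat n) \<le> 2 * k"
proof (induction k arbitrary: n)
  case (Suc k)
  then have "size (enc_nat (n div 2)) \<le> 2 * k" by (intro Suc.IH) auto
  then show ?case by (subst enc_nat.simps) auto
qed simp

lemma size_enc_nat_half: "size (enc_nat (n div 2 ^ k)) \<le> size (enc_nat n)"
proof (induction k)
  case (Suc k)
  have "n div 2 ^ Suc k = n div 2 ^ k div 2" by (metis div_mult2_eq power_Suc2)
  then show ?case using Suc size_tail[of "enc_nat (n div 2 ^ k)"] by (simp add: tail_enc_nat)
qed simp

lemma ptime_bits: "ptime P X (\<lambda>i. enc_nat (a i)) \<Longrightarrow> ptime P X (\<lambda>i. enc_list enc_bool (bits (a i)))"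
  by (simp add: enc_list_bits)

lemma mod_two_power_Suc: "(n::nat) mod 2 ^ Suc k = 2 ^ k * of_bool (odd (n div 2 ^ k)) + n mod 2 ^ k"
  using mod_mult2_eq[of n "2 ^ k" 2] by (simp add: mod2_eq_if mult.commute)

lemma div_two_power_Suc: "(n::nat) div 2 ^ Suc k = n div 2 ^ k div 2"
  by (metis div_mult2_eq power_Suc2)

lemma digit_le_iff:
  "u < 2 ^ k \<Longrightarrow> v < 2 ^ k \<Longrightarrow>
    2 ^ k * of_bool p + u \<le> 2 ^ k * of_bool q + v \<longleftrightarrow> (if p = q then u \<le> v else q)" for u v :: nat
  by auto

text \<open>Digits arrive least significant first, so a later difference overrides the earlier
  verdict. After \<open>k\<close> steps the flag compares the residues modulo \<open>2 ^ k\<close>;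
  the two bit lists together are a clock long enough for the residues to be the numbers
  themselves.\<close>

lemma ptime_nat_le:
  assumes a: "ptime P X (\<lambda>i. enc_nat (a i))" and b: "ptime P X (\<lambda>i. enc_nat (b i))"
  shows "ptime P X (\<lambda>i. enc_bool (a i \<le> b i))"
proof -
  define g :: "nat \<times> nat \<times> bool \<Rightarrow> nat \<times> nat \<times> bool" where "g s = (fst s div 2, fst (snd s) div 2,
    if odd (fst s) = odd (fst (snd s)) then snd (snd s) else odd (fst (snd s)))" for s
  define S where "S s = Pair (enc_nat (fst s)) (Pair (enc_nat (fst (snd s))) (enc_bool (snd (snd s))))"
    for s :: "nat \<times> nat \<times> bool"
  have g: "(g ^^ k) (x, y, True) = (x div 2 ^ k, y div 2 ^ k, x mod 2 ^ k \<le> y mod 2 ^ k)" for k x y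
  proof (induction k)
    case (Suc k)
    have "(g ^^ Suc k) (x, y, True) = g (x div 2 ^ k, y div 2 ^ k, x mod 2 ^ k \<le> y mod 2 ^ k)"
      using Suc by simp
    also have "\<dots> = (x div 2 ^ Suc k, y div 2 ^ Suc k, x mod 2 ^ Suc k \<le> y mod 2 ^ Suc k)"
      by (simp add: g_def mod_two_power_Suc div_two_power_Suc digit_le_iff del: power_Suc)
    finally show ?case .
  qed (simp add: mod_by_1[where ?'a = nat])
  let ?xs = "\<lambda>i. bits (a i) @ bits (b i)"
  have "ptime P X (\<lambda>i. S ((g ^^ length (?xs i)) (a i, b i, True)))"
  proof (rule ptime_funpow[where e = "\<lambda>_. enc_bool" and S = "\<lambda>_. S" and Q = "\<lambda>_ _. True" and xs = ?xs
        and n = "\<lambda>i. size (enc_nat (a i)) + size (enc_nat (b i)) + 4"])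
    show "ptime P X (\<lambda>i. enc_list enc_bool (?xs i))"
      by (intro ptime_append ptime_bits a b)
    show "ptime P X (\<lambda>i. S (a i, b i, True))"
      unfolding S_def enc_bool_def by (simp, intro ptime_Pair ptime_Atom a b)
    let ?Q = "\<lambda>z. P (fst z) \<and> True"
    let ?X = "\<lambda>z. Pair (X (fst z)) (S (snd z))"
    have 1: "ptime ?Q ?X (\<lambda>z. enc_nat (fst (snd z)))" "ptime ?Q ?X (\<lambda>z. enc_nat (fst (snd (snd z))))"
      "ptime ?Q ?X (\<lambda>z. enc_bool (snd (snd (snd z))))"
      unfolding S_def by (rule ptime_fst[OF ptime_snd[OF ptime_id]], rule ptime_fst[OF ptime_snd[OF ptime_snd[OF ptime_id]]],
          rule ptime_snd[OF ptime_snd[OF ptime_snd[OF ptime_id]]])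
    have if_enc: "enc_bool (if x = y then r else y) = (if x \<and> y \<or> \<not> x \<and> \<not> y then enc_bool r else enc_bool y)" for x y r
      by auto
    have S: "S (x, y, r) = Pair (enc_nat x) (Pair (enc_nat y) (enc_bool r))" for x y r
      by (simp add: S_def)
    show "ptime ?Q ?X (\<lambda>z. S (g (snd z)))"
      unfolding g_def S if_enc
      by (intro ptime_Pair ptime_half ptime_if ptime_disj ptime_conj ptime_not ptime_odd 1)
    show "pbound P X (\<lambda>i. size (enc_nat (a i)) + size (enc_nat (b i)) + 4)"
      by (intro pbound_intros ptime_pbound a b)
    fix i k
    show "size (S ((g ^^ k) (a i, b i, True))) \<le> size (enc_nat (a i)) + size (enc_nat (b i)) + 4"
      using size_enc_nat_half[of "a i" k] size_enc_nat_half[of "b i" k]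
      by (auto simp: g S_def enc_bool_def)
  qed auto
  from ptime_snd[OF ptime_snd[OF this[unfolded S_def]]]
  have "ptime P X (\<lambda>i. enc_bool (a i mod 2 ^ length (?xs i) \<le> b i mod 2 ^ length (?xs i)))"
    by (simp add: g)
  moreover have "a i mod 2 ^ length (?xs i) = a i" "b i mod 2 ^ length (?xs i) = b i" for i
    by (auto intro!: mod_less less_two_power)
  ultimately show ?thesis by simp
qed

lemma ptime_nat_eq:
  assumes "ptime P X (\<lambda>i. enc_nat (a i))" "ptime P X (\<lambda>i. enc_nat (b i))"
  shows "ptime P X (\<lambda>i. enc_bool (a i = b i))"
  unfolding order_eq_iff by (intro ptime_conj ptime_nat_le assms)

lemma fold_double_bits:
  "fold (\<lambda>b m. 2 * m + of_bool b) (rev (map (\<lambda>j. odd (n div 2 ^ j)) [0..<k])) (n div 2 ^ k) = (n::nat)"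
proof (induction k)
  case (Suc k)
  have "2 * (n div 2 ^ k div 2) + of_bool (odd (n div 2 ^ k)) = n div 2 ^ k"
    using mult_div_mod_eq[of 2 "n div 2 ^ k"] by (simp add: mod2_eq_if split: if_splits)
  then show ?case using Suc by (simp add: div_two_power_Suc del: power_Suc)
qed simp

text \<open>Horner's scheme, most significant digit first. It removes leading zeros, so the digits
  collected by addition, which may start with zeros, become the canonical numeral.\<close>

lemma ptime_of_bits:
  assumes bs: "ptime P X (\<lambda>i. enc_list enc_bool (bs i))"
  shows "ptime P X (\<lambda>i. enc_nat (fold (\<lambda>b m. 2 * m + of_bool b) (bs i) 0))"
proof (rule ptime_fold[where e = "\<lambda>_. enc_bool" and S = "\<lambda>_. enc_nat" and Q = "\<lambda>_ _ _. True"
      and n = "\<lambda>i. 2 * length (bs i)"])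
  show "ptime (\<lambda>z. P (fst z) \<and> True) (\<lambda>z. Pair (X (fst z)) (Pair (enc_bool (fst (snd z))) (enc_nat (snd (snd z)))))
      (\<lambda>z. enc_nat (2 * snd (snd z) + of_bool (fst (snd z))))"
    by (intro ptime_double ptime_proj)
  have less: "fold (\<lambda>b m. 2 * m + of_bool b) ys (0::nat) < 2 ^ length ys" for ys
    by (induction ys rule: rev_induct) (auto simp: of_bool_def)
  fix i ys zs assume "bs i = ys @ zs"
  then show "size (enc_nat (fold (\<lambda>b m. 2 * m + of_bool b) ys 0)) \<le> 2 * length (bs i)"
    using size_enc_nat_le[OF less[of ys]] by simp
qed (auto intro!: bs ptime_Atom pbound_intros pbound_length[OF bs])

text \<open>Ripple-carry addition. The invariant is that the unread parts plus the carry equal the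
  unread part of the sum; the digits pile up with the most significant on top, as
  \<open>ptime_of_bits\<close> expects.\<close>

lemma ptime_nat_add:
  assumes a: "ptime P X (\<lambda>i. enc_nat (a i))" and b: "ptime P X (\<lambda>i. enc_nat (b i))"
  shows "ptime P X (\<lambda>i. enc_nat (a i + b i))"
proof -
  define g :: "nat \<times> nat \<times> bool \<times> bool list \<Rightarrow> nat \<times> nat \<times> bool \<times> bool list" where
    "g = (\<lambda>(x, y, c, acc). (x div 2, y div 2, odd x \<and> odd y \<or> (odd x \<or> odd y) \<and> c,
       ((odd x \<longleftrightarrow> odd y) \<longleftrightarrow> c) # acc))"
  define S :: "nat \<times> nat \<times> bool \<times> bool list \<Rightarrow> data" where
    "S = (\<lambda>(x, y, c, acc). Pair (enc_nat x) (Pair (enc_nat y) (Pair (enc_bool c) (enc_list enc_bool acc))))"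
  have g: "\<exists>c. (g ^^ k) (x, y, False, []) = (x div 2 ^ k, y div 2 ^ k, c, rev (map (\<lambda>j. odd ((x + y) div 2 ^ j)) [0..<k]))
      \<and> x div 2 ^ k + y div 2 ^ k + of_bool c = (x + y) div 2 ^ k" for k x y
  proof (induction k)
    case (Suc k)
    then obtain c where c: "(g ^^ k) (x, y, False, []) = (x div 2 ^ k, y div 2 ^ k, c, rev (map (\<lambda>j. odd ((x + y) div 2 ^ j)) [0..<k]))"
      "x div 2 ^ k + y div 2 ^ k + of_bool c = (x + y) div 2 ^ k" by blast
    define x' y' where "x' = x div 2 ^ k" and "y' = y div 2 ^ k"
    have *: "x' div 2 + y' div 2 + of_bool (odd x' \<and> odd y' \<or> (odd x' \<or> odd y') \<and> c) = (x' + y' + of_bool c) div 2"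
      by (cases c; cases "odd x'"; cases "odd y'") (auto elim!: oddE evenE)
    have **: "((odd x' \<longleftrightarrow> odd y') \<longleftrightarrow> c) \<longleftrightarrow> odd (x' + y' + of_bool c)"
      by (cases c) auto
    show ?case
      using c * ** unfolding x'_def y'_def by (simp add: g_def div_two_power_Suc del: power_Suc)
  next
    case 0
    show ?case by (intro exI[of _ False]) simp
  qed
  \<comment> \<open>The extra element is for the carry: with a clock of length \<open>k\<close> both
    summands are below \<open>2 ^ (k - 1)\<close>, so the sum is below \<open>2 ^ k\<close>.\<close>
  let ?xs = "\<lambda>i. True # bits (a i) @ bits (b i)"
  have "ptime P X (\<lambda>i. S ((g ^^ length (?xs i)) (a i, b i, False, [])))"
  proof (rule ptime_funpow[where e = "\<lambda>_. enc_bool" and S = "\<lambda>_. S" and Q = "\<lambda>_ _. True" and xs = ?xs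
        and n = "\<lambda>i. size (enc_nat (a i)) + size (enc_nat (b i)) + 4 + length (?xs i) * 2"])
    show xs: "ptime P X (\<lambda>i. enc_list enc_bool (?xs i))"
      unfolding enc_bool_def[of True] enc_list.simps
      by (simp add: enc_bool_def[of True], intro ptime_Pair ptime_Atom ptime_append ptime_bits a b)
    show "ptime P X (\<lambda>i. S (a i, b i, False, []))"
      unfolding S_def enc_bool_def by (simp, intro ptime_Pair ptime_Atom a b)
    let ?Q = "\<lambda>z. P (fst z) \<and> True"
    let ?X = "\<lambda>z. Pair (X (fst z)) (S (snd z))"
    have S_eq: "S z = Pair (enc_nat (fst z)) (Pair (enc_nat (fst (snd z)))
        (Pair (enc_bool (fst (snd (snd z)))) (enc_list enc_bool (snd (snd (snd z))))))" for z
      by (simp add: S_def split: prod.splits)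
    have g_eq: "g z = (fst z div 2, fst (snd z) div 2,
        odd (fst z) \<and> odd (fst (snd z)) \<or> (odd (fst z) \<or> odd (fst (snd z))) \<and> fst (snd (snd z)),
       ((odd (fst z) \<and> odd (fst (snd z)) \<or> \<not> odd (fst z) \<and> \<not> odd (fst (snd z))) \<and> fst (snd (snd z)) \<or>
        \<not> (odd (fst z) \<and> odd (fst (snd z)) \<or> \<not> odd (fst z) \<and> \<not> odd (fst (snd z))) \<and> \<not> fst (snd (snd z))) # snd (snd (snd z)))" for z
      by (auto simp: g_def split: prod.splits)
    have 1: "ptime ?Q ?X (\<lambda>z. enc_nat (fst (snd z)))" "ptime ?Q ?X (\<lambda>z. enc_nat (fst (snd (snd z))))"
      "ptime ?Q ?X (\<lambda>z. enc_bool (fst (snd (snd (snd z)))))"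
      "ptime ?Q ?X (\<lambda>z. enc_list enc_bool (snd (snd (snd (snd z)))))"
      unfolding S_eq by (rule ptime_fst[OF ptime_snd[OF ptime_id]], rule ptime_fst[OF ptime_snd[OF ptime_snd[OF ptime_id]]],
          rule ptime_fst[OF ptime_snd[OF ptime_snd[OF ptime_snd[OF ptime_id]]]],
          rule ptime_snd[OF ptime_snd[OF ptime_snd[OF ptime_snd[OF ptime_id]]]])
    have S: "S (x, y, c, bs) = Pair (enc_nat x) (Pair (enc_nat y) (Pair (enc_bool c) (enc_list enc_bool bs)))" for x y c bs
      by (simp add: S_def)
    show "ptime ?Q ?X (\<lambda>z. S (g (snd z)))"
      unfolding g_eq S enc_list.simps
      by (intro ptime_Pair ptime_half ptime_disj ptime_conj ptime_not ptime_odd 1)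
    show "pbound P X (\<lambda>i. size (enc_nat (a i)) + size (enc_nat (b i)) + 4 + length (?xs i) * 2)"
      by (intro pbound_intros ptime_pbound a b pbound_length[OF xs])
    fix i k assume k: "k \<le> length (?xs i)"
    obtain c where "(g ^^ k) (a i, b i, False, []) = (a i div 2 ^ k, b i div 2 ^ k, c,
        rev (map (\<lambda>j. odd ((a i + b i) div 2 ^ j)) [0..<k]))" using g by blast
    moreover have "size (enc_list enc_bool (rev (map (\<lambda>j. odd ((a i + b i) div 2 ^ j)) [0..<k]))) \<le> length (?xs i) * Suc 1"
      by (rule size_enc_list_le) (use k in \<open>auto simp: enc_bool_def\<close>)
    ultimately show "size (S ((g ^^ k) (a i, b i, False, []))) \<le> size (enc_nat (a i)) + size (enc_nat (b i)) + 4 + length (?xs i) * 2"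
      using size_enc_nat_half[of "a i" k] size_enc_nat_half[of "b i" k]
      by (simp add: S_def enc_bool_def)
  qed auto
  moreover have "\<exists>c. S ((g ^^ length (?xs i)) (a i, b i, False, [])) =
      Pair (enc_nat (a i div 2 ^ length (?xs i))) (Pair (enc_nat (b i div 2 ^ length (?xs i))) (Pair c
        (enc_list enc_bool (rev (map (\<lambda>j. odd ((a i + b i) div 2 ^ j)) [0..<length (?xs i)])))))" for i
    using g[of "length (?xs i)" "a i" "b i"] unfolding S_def by auto
  then obtain c where "\<And>i. S ((g ^^ length (?xs i)) (a i, b i, False, [])) =
      Pair (enc_nat (a i div 2 ^ length (?xs i))) (Pair (enc_nat (b i div 2 ^ length (?xs i))) (Pair (c i)
        (enc_list enc_bool (rev (map (\<lambda>j. odd ((a i + b i) div 2 ^ j)) [0..<length (?xs i)])))))"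
    by metis
  ultimately have "ptime P X (\<lambda>i. Pair (enc_nat (a i div 2 ^ length (?xs i))) (Pair (enc_nat (b i div 2 ^ length (?xs i))) (Pair (c i)
        (enc_list enc_bool (rev (map (\<lambda>j. odd ((a i + b i) div 2 ^ j)) [0..<length (?xs i)]))))))"
    by (simp only:)
  from ptime_of_bits[OF ptime_snd[OF ptime_snd[OF ptime_snd[OF this]]]]
  have "ptime P X (\<lambda>i. enc_nat (fold (\<lambda>b m. 2 * m + of_bool b) (rev (map (\<lambda>j. odd ((a i + b i) div 2 ^ j)) [0..<length (?xs i)])) 0))" .
  moreover have "(a i + b i) div 2 ^ length (?xs i) = 0" for i
  proof -
    have "a i < 2 ^ (length (bits (a i)) + length (bits (b i)))" "b i < 2 ^ (length (bits (a i)) + length (bits (b i)))"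
      by (auto intro: less_two_power)
    then show ?thesis by (intro div_less) simp
  qed
  then have "fold (\<lambda>b m. 2 * m + of_bool b) (rev (map (\<lambda>j. odd ((a i + b i) div 2 ^ j)) [0..<length (?xs i)])) 0 = a i + b i" for i
    using fold_double_bits[of "a i + b i" "length (?xs i)"] by (simp only:)
  ultimately show ?thesis by (simp only:)
qed

text \<open>Multiplication by halving and doubling, with the invariant that the accumulator plus the
  product of the current factors is the result. The accumulator never exceeds the final product and
  the doubled factor gains at most one digit per step, which bounds all intermediate sizes.\<close>

lemma ptime_nat_mult:
  assumes a: "ptime P X (\<lambda>i. enc_nat (a i))" and b: "ptime P X (\<lambda>i. enc_nat (b i))"
  shows "ptime P X (\<lambda>i. enc_nat (a i * b i))"
proof -
  define g :: "nat \<times> nat \<times> nat \<Rightarrow> nat \<times> nat \<times> nat" where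
    "g s = (fst s div 2, 2 * fst (snd s) + of_bool False,
      if odd (fst s) then snd (snd s) + fst (snd s) else snd (snd s))" for s
  define S where "S s = Pair (enc_nat (fst s)) (Pair (enc_nat (fst (snd s))) (enc_nat (snd (snd s))))"
    for s :: "nat \<times> nat \<times> nat"
  have g: "\<exists>c. (g ^^ k) (x, y, 0) = (x div 2 ^ k, y * 2 ^ k, c) \<and> c + (x div 2 ^ k) * (y * 2 ^ k) = x * y" for k x y
  proof (induction k)
    case (Suc k)
    then obtain c where c: "(g ^^ k) (x, y, 0) = (x div 2 ^ k, y * 2 ^ k, c)" "c + (x div 2 ^ k) * (y * 2 ^ k) = x * y"
      by blast
    define x' y' where "x' = x div 2 ^ k" and "y' = y * 2 ^ k"
    have "(if odd x' then c + y' else c) + (x' div 2) * (2 * y') = c + x' * y'"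
      by (cases "odd x'") (auto elim!: oddE evenE simp: algebra_simps)
    moreover have "(g ^^ Suc k) (x, y, 0) = g (x', y', c)" using c(1) by (simp add: x'_def y'_def)
    moreover have "g (x', y', c) = (x' div 2, 2 * y', if odd x' then c + y' else c)" by (simp add: g_def)
    moreover have "x div 2 ^ Suc k = x' div 2" "y * 2 ^ Suc k = 2 * y'"
      by (simp_all add: div_two_power_Suc x'_def y'_def del: power_Suc) simp
    ultimately show ?case using c(2) by (metis x'_def y'_def)
  qed simp
  let ?xs = "\<lambda>i. bits (a i)"
  let ?n = "\<lambda>i. 2 + (size (enc_nat (a i)) + 2 * (size (enc_nat (b i)) + length (?xs i)) + 2 * (size (enc_nat (a i)) + size (enc_nat (b i))))"
  have "ptime P X (\<lambda>i. S ((g ^^ length (?xs i)) (a i, b i, 0)))"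
  proof (rule ptime_funpow[where e = "\<lambda>_. enc_bool" and S = "\<lambda>_. S" and Q = "\<lambda>_ _. True" and xs = ?xs
        and n = ?n])
    show xs: "ptime P X (\<lambda>i. enc_list enc_bool (?xs i))" by (intro ptime_bits a)
    show "ptime P X (\<lambda>i. S (a i, b i, 0))"
      unfolding S_def by (simp, intro ptime_Pair ptime_Atom a b)
    let ?Q = "\<lambda>z. P (fst z) \<and> True"
    let ?X = "\<lambda>z. Pair (X (fst z)) (S (snd z))"
    have 1: "ptime ?Q ?X (\<lambda>z. enc_nat (fst (snd z)))" "ptime ?Q ?X (\<lambda>z. enc_nat (fst (snd (snd z))))"
      "ptime ?Q ?X (\<lambda>z. enc_nat (snd (snd (snd z))))"
      unfolding S_def by (rule ptime_fst[OF ptime_snd[OF ptime_id]], rule ptime_fst[OF ptime_snd[OF ptime_snd[OF ptime_id]]],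
          rule ptime_snd[OF ptime_snd[OF ptime_snd[OF ptime_id]]])
    have F: "ptime ?Q ?X (\<lambda>z. enc_bool False)" by (simp add: enc_bool_def ptime_Atom)
    have S: "S (x, y, r) = Pair (enc_nat x) (Pair (enc_nat y) (enc_nat r))" for x y r
      by (simp add: S_def)
    show "ptime ?Q ?X (\<lambda>z. S (g (snd z)))"
      unfolding g_def S if_distrib[of enc_nat]
      by (intro ptime_Pair ptime_half ptime_double ptime_if ptime_odd ptime_nat_add 1 F)
    show "pbound P X ?n"
      by (intro pbound_intros ptime_pbound a b pbound_length[OF xs])
    fix i k assume k: "k \<le> length (?xs i)"
    obtain c where c: "(g ^^ k) (a i, b i, 0) = (a i div 2 ^ k, b i * 2 ^ k, c)"
      "c + (a i div 2 ^ k) * (b i * 2 ^ k) = a i * b i" using g by blast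
    have "b i * 2 ^ k < 2 ^ (size (enc_nat (b i)) + k)"
      using less_two_power_size[of "b i"] by (simp add: power_add)
    also have "\<dots> \<le> 2 ^ (size (enc_nat (b i)) + length (?xs i))" using k by (intro power_increasing) auto
    finally have 2: "size (enc_nat (b i * 2 ^ k)) \<le> 2 * (size (enc_nat (b i)) + length (?xs i))"
      by (rule size_enc_nat_le)
    have "c \<le> a i * b i" using c(2) by linarith
    also have "\<dots> < 2 ^ (size (enc_nat (a i)) + size (enc_nat (b i)))"
      unfolding power_add by (intro mult_strict_mono less_two_power_size) auto
    finally have 3: "size (enc_nat c) \<le> 2 * (size (enc_nat (a i)) + size (enc_nat (b i)))"
      by (rule size_enc_nat_le)
    show "size (S ((g ^^ k) (a i, b i, 0))) \<le> ?n i"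
      using size_enc_nat_half[of "a i" k] 2 3 by (simp add: S_def c(1))
  qed auto
  from ptime_snd[OF ptime_snd[OF this[unfolded S_def]]]
  have "ptime P X (\<lambda>i. enc_nat (snd (snd ((g ^^ length (?xs i)) (a i, b i, 0)))))" .
  moreover have "snd (snd ((g ^^ length (?xs i)) (a i, b i, 0))) = a i * b i" for i
    using g[of "length (?xs i)" "a i" "b i"] less_two_power_bits[of "a i"] by auto
  ultimately show ?thesis by simp
qed

text \<open>Comparison by cross-multiplication. Non-negativity is assumed because the code of a
  rational truncates a negative numerator to zero.\<close>

lemma ptime_rat_le:
  assumes "ptime P X (\<lambda>i. enc_rat (q i))" "ptime P X (\<lambda>i. enc_rat (r i))"
    and "\<And>i. P i \<Longrightarrow> 0 \<le> q i" "\<And>i. P i \<Longrightarrow> 0 \<le> r i"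
  shows "ptime P X (\<lambda>i. enc_bool (q i \<le> r i))"
proof -
  let ?a = "\<lambda>q. nat (fst (quotient_of q))" and ?b = "\<lambda>q. nat (snd (quotient_of q))"
  have enc: "enc_rat q = Pair (enc_nat (?a q)) (enc_nat (?b q))" for q
    by (simp add: enc_rat_def split: prod.splits)
  note 1 = ptime_fst[OF assms(1)[unfolded enc]] ptime_snd[OF assms(1)[unfolded enc]]
    ptime_fst[OF assms(2)[unfolded enc]] ptime_snd[OF assms(2)[unfolded enc]]
  have le: "ptime P X (\<lambda>i. enc_bool (?a (q i) * ?b (r i) \<le> ?a (r i) * ?b (q i)))"
    by (intro ptime_nat_le ptime_nat_mult 1)
  have iff: "?a (q i) * ?b (r i) \<le> ?a (r i) * ?b (q i) \<longleftrightarrow> q i \<le> r i" if i: "P i" for i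
  proof -
    have nn: "fst (quotient_of s) \<ge> 0" if "s \<ge> 0" for s
    proof (rule ccontr)
      assume "\<not> ?thesis"
      then have "of_int (fst (quotient_of s)) / (of_int (snd (quotient_of s)) :: rat) < 0"
        using quotient_of_denom_pos'[of s] by (intro divide_neg_pos) auto
      with that show False using quotient_of_div[of s "fst (quotient_of s)" "snd (quotient_of s)"] by simp
    qed
    have "int (?a (q i) * ?b (r i)) \<le> int (?a (r i) * ?b (q i)) \<longleftrightarrow> q i \<le> r i"
      using nn[OF assms(3)[OF i]] nn[OF assms(4)[OF i]] quotient_of_denom_pos'[of "q i"] quotient_of_denom_pos'[of "r i"]
      by (simp add: rat_less_eq_code Let_def mult.commute split: prod.splits)
    then show ?thesis by (simp only: of_nat_le_iff)
  qed
  show ?thesis by (rule ptime_cong[OF le]) (simp_all add: iff)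
qed

section \<open>The greedy assignment\<close>

text \<open>Splitting by two filters avoids recursion, so the running time follows from the lemmas
  on filtering and appending. On a sorted list it is ordinary insertion.\<close>

definition insert_by :: "('a \<Rightarrow> nat) \<Rightarrow> 'a \<Rightarrow> 'a list \<Rightarrow> 'a list" where
  "insert_by u x ys = filter (\<lambda>y. u y \<le> u x) ys @ x # filter (\<lambda>y. \<not> u y \<le> u x) ys"

definition sort_by :: "('a \<Rightarrow> nat) \<Rightarrow> 'a list \<Rightarrow> 'a list" where
  "sort_by u xs = fold (insert_by u) xs []"

lemma mset_fold_insert_by: "mset (fold (insert_by u) xs ys) = mset xs + mset ys"
  by (induction xs arbitrary: ys) (auto simp: insert_by_def)

lemma mset_sort_by: "mset (sort_by u xs) = mset xs"
  by (simp add: sort_by_def mset_fold_insert_by)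

lemma set_sort_by [simp]: "set (sort_by u xs) = set xs"
  by (rule mset_eq_setD[OF mset_sort_by])

lemma distinct_sort_by [simp]: "distinct (sort_by u xs) = distinct xs"
  by (rule mset_eq_imp_distinct_iff[OF mset_sort_by])

lemma length_sort_by [simp]: "length (sort_by u xs) = length xs"
  by (rule mset_eq_length[OF mset_sort_by])

lemma sorted_insert_by:
  "sorted_wrt (\<lambda>a b. u a \<le> u b) ys \<Longrightarrow> sorted_wrt (\<lambda>a b. u a \<le> u b) (insert_by u x ys)"
  by (auto simp: insert_by_def sorted_wrt_append intro: sorted_wrt_filter)

lemma sorted_sort_by: "sorted_wrt (\<lambda>a b. u a \<le> u b) (sort_by u xs)"
proof -
  have "sorted_wrt (\<lambda>a b. u a \<le> u b) (fold (insert_by u) xs ys)" if "sorted_wrt (\<lambda>a b. u a \<le> u b) ys" for ys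
    using that by (induction xs arbitrary: ys) (auto intro: sorted_insert_by)
  then show ?thesis by (simp add: sort_by_def)
qed

text \<open>Pairs are stacked with the newest first, so the customer joins the latest conflicting
  representative; any other conflicting one would serve as well.\<close>

definition assign_step :: "('a \<Rightarrow> 'a \<Rightarrow> bool) \<Rightarrow> 'a \<Rightarrow> ('a \<times> 'a) list \<Rightarrow> ('a \<times> 'a) list" where
  "assign_step R v ps = (v, (if filter (\<lambda>p. fst p = snd p \<and> R (fst p) v) ps = [] then v
     else fst (hd (filter (\<lambda>p. fst p = snd p \<and> R (fst p) v) ps)))) # ps"

text \<open>A pair \<open>(v, j)\<close> assigns \<open>v\<close> to \<open>j\<close>; the representatives are the elements assigned to themselves.\<close>

definition assignment :: "('a \<Rightarrow> 'a \<Rightarrow> bool) \<Rightarrow> 'a list \<Rightarrow> ('a \<times> 'a) list" where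
  "assignment R vs = fold (assign_step R) vs []"

text \<open>A representative never comes after its customers, and the order is by \<open>u\<close>,
  hence \<open>u (rep v) \<le> u v\<close>. Two representatives are never in conflict, as the later
  one would have been assigned to an earlier one instead.\<close>

lemma assignment_rep:
  fixes u :: "'a \<Rightarrow> nat"
  assumes "distinct vs" "sorted_wrt (\<lambda>a b. u a \<le> u b) vs" "\<And>v w. R v w = R w v"
  shows "\<exists>rep. assignment R vs = rev (map (\<lambda>v. (v, rep v)) vs) \<and>
    (\<forall>v\<in>set vs. rep v \<in> set vs \<and> rep (rep v) = rep v \<and> u (rep v) \<le> u v \<and> (rep v = v \<or> R (rep v) v)) \<and>
    (\<forall>v\<in>set vs. \<forall>w\<in>set vs. rep v = v \<longrightarrow> rep w = w \<longrightarrow> R v w \<longrightarrow> v = w)"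
  using assms(1,2)
proof (induction vs rule: rev_induct)
  case Nil
  show ?case by (simp add: assignment_def)
next
  case (snoc x vs)
  have "distinct vs" "sorted_wrt (\<lambda>a b. u a \<le> u b) vs"
    using snoc.prems by (auto simp: sorted_wrt_append)
  from snoc.IH[OF this] obtain rep where IH: "assignment R vs = rev (map (\<lambda>v. (v, rep v)) vs)"
    "\<forall>v\<in>set vs. rep v \<in> set vs \<and> rep (rep v) = rep v \<and> u (rep v) \<le> u v \<and> (rep v = v \<or> R (rep v) v)"
    "\<forall>v\<in>set vs. \<forall>w\<in>set vs. rep v = v \<longrightarrow> rep w = w \<longrightarrow> R v w \<longrightarrow> v = w"
    by (elim exE conjE)
  have rep: "assignment R vs = rev (map (\<lambda>v. (v, rep v)) vs)"
    "\<And>v. v \<in> set vs \<Longrightarrow> rep v \<in> set vs \<and> rep (rep v) = rep v \<and> u (rep v) \<le> u v \<and> (rep v = v \<or> R (rep v) v)"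
    "\<And>v w. v \<in> set vs \<Longrightarrow> w \<in> set vs \<Longrightarrow> rep v = v \<Longrightarrow> rep w = w \<Longrightarrow> R v w \<Longrightarrow> v = w" for v w
    using IH by simp_all
  have x: "x \<notin> set vs" "\<And>v. v \<in> set vs \<Longrightarrow> u v \<le> u x"
    using snoc.prems by (auto simp: sorted_wrt_append)
  let ?L = "filter (\<lambda>p. fst p = snd p \<and> R (fst p) x) (assignment R vs)"
  have L: "p \<in> set ?L \<longleftrightarrow> fst p = snd p \<and> fst p \<in> set vs \<and> rep (fst p) = fst p \<and> R (fst p) x" for p
    by (cases p) (auto simp: rep(1))
  define j where "j = (if ?L = [] then x else fst (hd ?L))"
  have step: "assignment R (vs @ [x]) = (x, j) # assignment R vs"
    by (simp add: assignment_def assign_step_def j_def)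
  \<comment> \<open>Either no earlier representative conflicts with \<open>x\<close>, or
    \<open>j\<close> is one that does; all claims about \<open>x\<close> come from this
    alternative.\<close>
  have j: "j = x \<and> (\<forall>v\<in>set vs. rep v = v \<longrightarrow> \<not> R v x) \<or> j \<in> set vs \<and> rep j = j \<and> R j x"
  proof (cases "?L = []")
    case True
    then have "\<not> R v x" if "v \<in> set vs" "rep v = v" for v
      using L[of "(v, v)"] that by simp
    then show ?thesis using True by (simp add: j_def)
  next
    case False
    then have "hd ?L \<in> set ?L" by (rule hd_in_set)
    then have "fst (hd ?L) \<in> set vs \<and> rep (fst (hd ?L)) = fst (hd ?L) \<and> R (fst (hd ?L)) x"
      using iffD1[OF L] by blast
    moreover have "j = fst (hd ?L)" unfolding j_def using False by (rule if_not_P)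
    ultimately show ?thesis by simp
  qed
  let ?rep = "rep(x := j)"
  have r: "?rep v = rep v" if "v \<in> set vs" for v using that x(1) by auto
  have rr: "?rep (rep v) = rep v" if "v \<in> set vs" for v using rep(2)[OF that] r[of "rep v"] by simp
  show ?case
  proof (intro exI[of _ ?rep] conjI ballI impI)
    show "assignment R (vs @ [x]) = rev (map (\<lambda>v. (v, ?rep v)) (vs @ [x]))"
      using x(1) by (simp add: step rep(1) cong: map_cong)
  next
    fix v assume "v \<in> set (vs @ [x])"
    then consider "v = x" | "v \<in> set vs" by auto
    note cases = this
    show "?rep v \<in> set (vs @ [x])" using cases by cases (use j rep(2) r in auto)
    show "?rep (?rep v) = ?rep v" using cases by cases (use j r rr in auto)
    show "u (?rep v) \<le> u v" using cases by cases (use j rep(2) r x in auto)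
    show "?rep v = v \<or> R (?rep v) v" using cases by cases (use j rep(2) r in auto)
    fix w assume "w \<in> set (vs @ [x])" and eq: "?rep v = v" "?rep w = w" "R v w"
    then consider "v = x" "w = x" | "v = x" "w \<in> set vs" | "v \<in> set vs" "w = x" | "v \<in> set vs" "w \<in> set vs"
      using cases by auto
    then show "v = w"
    proof cases
      case 2
      then have "j = x" "rep w = w" using eq r by auto
      then show ?thesis using j 2 eq(3) assms(3)[of v w] x(1) by auto
    next
      case 3
      then have "j = x" "rep v = v" using eq r by auto
      then show ?thesis using j 3 eq(3) x(1) by auto
    next
      case 4
      then show ?thesis using rep(3)[of v w] eq r by auto
    qed simp
  qed
qed


section \<open>The perceptron bound\<close>

text \<open>
  In round \<open>k\<close> the vector \<open>1 - cnt\<close> has non-positive inner product with the current point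
  \<open>k - u k\<close>, but inner product at least \<open>1\<close> with the indicator vector of \<open>H\<close>.
\<close>

lemma perceptron_bound:
  fixes u :: "nat \<Rightarrow> 'a \<Rightarrow> nat" and rep :: "nat \<Rightarrow> 'a \<Rightarrow> 'a" and C :: "'a set"
  defines "cnt \<equiv> \<lambda>k j. card {v \<in> C. rep k v = j}"
  assumes C: "finite C" and H: "H \<subseteq> C" "m \<le> card H"
    and u0: "\<And>v. u 0 v = 0"
    and u_Suc: "\<And>k v. k < T \<Longrightarrow> v \<in> C \<Longrightarrow> u (Suc k) v = u k v + cnt k v"
    and rep_le: "\<And>k v. k < T \<Longrightarrow> v \<in> C \<Longrightarrow> rep k v \<in> C \<and> u k (rep k v) \<le> u k v"
    and sep: "\<And>k. k < T \<Longrightarrow> (\<Sum>j\<in>H. cnt k j) < m"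
  shows "T \<le> card C ^ 3"
proof -
  define n where "n = card C"
  define w where "w k v = real k - real (u k v)" for k v
  have fH: "finite H" using C H(1) finite_subset by blast
  \<comment> \<open>Double counting: weighting each representative by its number of customers
    amounts to letting each customer contribute the value of its representative.\<close>
  have fib: "(\<Sum>j\<in>C. real (cnt k j) * g j) = (\<Sum>v\<in>C. g (rep k v))" if "k < T" for k and g :: "'a \<Rightarrow> real"
  proof -
    have "(\<Sum>v\<in>C. g (rep k v)) = (\<Sum>j\<in>C. \<Sum>v\<in>{v \<in> C. rep k v = j}. g (rep k v))"
      using rep_le[OF that] C by (intro sum.group[symmetric]) auto
    also have "\<dots> = (\<Sum>j\<in>C. \<Sum>v\<in>{v \<in> C. rep k v = j}. g j)"
      by (intro sum.cong refl) auto
    also have "\<dots> = (\<Sum>j\<in>C. real (cnt k j) * g j)" by (simp add: cnt_def)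
    finally show ?thesis by simp
  qed
  have cnt_sum: "(\<Sum>j\<in>C. real (cnt k j)) = n" if "k < T" for k
    using fib[OF that, of "\<lambda>_. 1"] by (simp add: n_def)
  have cnt_le: "cnt k j \<le> n" for k j
    unfolding cnt_def n_def using C by (intro card_mono) auto
  have w_Suc: "w (Suc k) v = w k v + (1 - real (cnt k v))" if "k < T" "v \<in> C" for k v
    using u_Suc[OF that] by (simp add: w_def)
  \<comment> \<open>\<open>sep\<close> is a strict inequality of natural numbers, so each round
    gains at least 1 against the indicator vector of \<open>H\<close>.\<close>
  have lower: "real k \<le> (\<Sum>v\<in>H. w k v)" if "k \<le> T" for k
    using that
  proof (induction k)
    case (Suc k)
    have "(\<Sum>v\<in>H. w (Suc k) v) = (\<Sum>v\<in>H. w k v + (1 - real (cnt k v)))"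
      using w_Suc Suc.prems H(1) by (intro sum.cong) auto
    also have "\<dots> = (\<Sum>v\<in>H. w k v) + (real (card H) - real (\<Sum>v\<in>H. cnt k v))"
      by (simp add: sum.distrib sum_subtractf)
    finally show ?case using Suc sep[of k] H(2) by linarith
  qed (simp add: w_def u0)
  \<comment> \<open>The cross term is not positive, so a round adds at most the squared length of
    \<open>1 - cnt\<close> to the squared norm.\<close>
  have upper: "(\<Sum>v\<in>C. (w k v)\<^sup>2) \<le> real k * (real n)\<^sup>2" if "k \<le> T" for k
    using that
  proof (induction k)
    case (Suc k)
    then have k: "k < T" by simp
    have "(\<Sum>v\<in>C. (1 - real (cnt k v)) * w k v) = (\<Sum>v\<in>C. w k v) - (\<Sum>v\<in>C. real (cnt k v) * w k v)"
      by (simp add: left_diff_distrib sum_subtractf)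
    also have "\<dots> = (\<Sum>v\<in>C. w k v - w k (rep k v))"
      by (simp add: fib[OF k] sum_subtractf)
    also have "\<dots> \<le> 0"
      by (intro sum_nonpos) (use rep_le[OF k] in \<open>auto simp: w_def\<close>)
    finally have 1: "(\<Sum>v\<in>C. (1 - real (cnt k v)) * w k v) \<le> 0" .
    \<comment> \<open>As the counts sum to \<open>n\<close>, this is \<open>- n\<close> plus the sum
      of their squares, and the latter is at most \<open>n * n\<close> because each count is at most
      \<open>n\<close>.\<close>
    have "(\<Sum>v\<in>C. (1 - real (cnt k v))\<^sup>2) = real n - 2 * (\<Sum>v\<in>C. real (cnt k v)) + (\<Sum>v\<in>C. real (cnt k v) * real (cnt k v))"
      unfolding power2_eq_square left_diff_distrib right_diff_distrib
      by (simp add: sum.distrib sum_subtractf n_def sum_distrib_left)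
    also have "(\<Sum>v\<in>C. real (cnt k v) * real (cnt k v)) \<le> (\<Sum>v\<in>C. real (cnt k v) * real n)"
      by (intro sum_mono mult_left_mono) (use cnt_le in auto)
    also have "\<dots> = real n * real n" by (simp add: cnt_sum[OF k] flip: sum_distrib_right)
    finally have 2: "(\<Sum>v\<in>C. (1 - real (cnt k v))\<^sup>2) \<le> (real n)\<^sup>2"
      by (simp add: cnt_sum[OF k] power2_eq_square)
    have "(\<Sum>v\<in>C. (w (Suc k) v)\<^sup>2) = (\<Sum>v\<in>C. (w k v)\<^sup>2 + 2 * ((1 - real (cnt k v)) * w k v) + (1 - real (cnt k v))\<^sup>2)"
      by (intro sum.cong refl) (simp add: w_Suc[OF k] power2_sum)
    also have "\<dots> = (\<Sum>v\<in>C. (w k v)\<^sup>2) + 2 * (\<Sum>v\<in>C. (1 - real (cnt k v)) * w k v) + (\<Sum>v\<in>C. (1 - real (cnt k v))\<^sup>2)"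
      by (simp add: sum.distrib sum_distrib_left)
    also have "\<dots> \<le> real k * (real n)\<^sup>2 + (real n)\<^sup>2" using Suc 1 2 by simp
    finally show ?case by (simp add: algebra_simps)
  qed (simp add: w_def u0)
  \<comment> \<open>Cauchy-Schwarz against the indicator vector of \<open>H\<close>: a sum of at
    least \<open>T\<close> meets a norm that grows only like the square root of \<open>T\<close>,
    and cancelling \<open>T\<close> leaves \<open>n ^ 3\<close>.\<close>
  have "(real T)\<^sup>2 \<le> (\<Sum>v\<in>H. 1 * w T v)\<^sup>2" using lower[of T] by (intro power_mono) auto
  also have "\<dots> \<le> (\<Sum>v\<in>H. 1\<^sup>2) * (\<Sum>v\<in>H. (w T v)\<^sup>2)" by (rule Cauchy_Schwarz_ineq_sum)
  also have "\<dots> \<le> real n * (\<Sum>v\<in>C. (w T v)\<^sup>2)"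
    using C H(1) by (intro mult_mono sum_mono2) (auto simp: n_def intro: card_mono sum_nonneg)
  also have "\<dots> \<le> real n * (real T * (real n)\<^sup>2)" by (intro mult_left_mono upper) auto
  also have "\<dots> = real T * real n ^ 3" by (simp add: power2_eq_square power3_eq_cube)
  finally have "real T * real T \<le> real T * real n ^ 3" by (simp add: power2_eq_square)
  then have "T = 0 \<or> real T \<le> real n ^ 3" by (auto simp: mult_le_cancel_left)
  then show ?thesis unfolding n_def by (metis of_nat_le_iff of_nat_power zero_le)
qed


section \<open>The algorithm\<close>

definition dist_table :: "supplier_instance \<Rightarrow> (nat \<times> nat \<times> rat) list" where
  "dist_table I = (let X = remdups (sup_facilities I @ sup_customers I) in
     map (\<lambda>(u, v). (u, v, sup_metric I u v)) (List.product X X))"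

text \<open>Stated as a search in the table, since that is the form in which a program can reach the
  metric.\<close>

definition near :: "supplier_instance \<Rightarrow> rat \<Rightarrow> nat \<Rightarrow> nat \<Rightarrow> bool" where
  "near I r f v \<longleftrightarrow> (\<exists>t\<in>set (dist_table I). fst t = f \<and> fst (snd t) = v \<and> snd (snd t) \<le> r)"

definition conflict :: "supplier_instance \<Rightarrow> rat \<Rightarrow> nat \<Rightarrow> nat \<Rightarrow> bool" where
  "conflict I r v w \<longleftrightarrow> (\<exists>f\<in>set (sup_facilities I). near I r f v \<and> near I r f w)"

definition rep_pairs :: "supplier_instance \<Rightarrow> rat \<Rightarrow> (nat \<Rightarrow> nat) \<Rightarrow> (nat \<times> nat) list" where
  "rep_pairs I r u = assignment (conflict I r) (sort_by u (sup_customers I))"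

text \<open>The value counts the customers whose representative is within \<open>r\<close> of the
  facility: on a part it is the number of customers assigned to its representative, and for a
  facility in no part it is \<open>0\<close>. Empty parts are dropped because two representatives
  without a facility would list the same set twice, against the distinctness of the parts.\<close>

definition pcm_of :: "supplier_instance \<Rightarrow> rat \<Rightarrow> (nat \<Rightarrow> nat) \<Rightarrow> pcm_instance" where
  "pcm_of I r u = \<lparr>
     pcm_ground = sup_facilities I,
     pcm_parts = filter (\<lambda>A. A \<noteq> []) (map (\<lambda>p. filter (\<lambda>f. near I r f (fst p)) (sup_facilities I))
       (filter (\<lambda>p. fst p = snd p) (rep_pairs I r u))),
     pcm_val = (\<lambda>f. length (filter (\<lambda>p. near I r f (snd p)) (rep_pairs I r u))),
     pcm_family = sup_family I\<rparr>"

text \<open>The success test of a round. For a feasible solution it lies between the PCM value and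
  the number of customers served within \<open>3 * r\<close>.\<close>

definition covered :: "supplier_instance \<Rightarrow> rat \<Rightarrow> (nat \<Rightarrow> nat) \<Rightarrow> nat list \<Rightarrow> nat" where
  "covered I r u y = length (filter (\<lambda>p. \<exists>f\<in>set y. near I r f (snd p)) (rep_pairs I r u))"

definition penalize :: "supplier_instance \<Rightarrow> rat \<Rightarrow> (nat \<Rightarrow> nat) \<Rightarrow> nat \<Rightarrow> nat" where
  "penalize I r u v = u v + length (filter (\<lambda>p. snd p = v) (rep_pairs I r u))"

text \<open>One more than the \<open>n ^ 3\<close> rounds that can fail. The penalties develop
  independently of what the PCM algorithm returns, so all rounds can be listed beforehand.\<close>

definition rounds :: "supplier_instance \<Rightarrow> rat \<Rightarrow> (nat \<Rightarrow> nat) list" where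
  "rounds I r = map (\<lambda>k. (penalize I r ^^ k) (\<lambda>_. 0)) [0..<Suc (length (sup_customers I) ^ 3)]"

definition candidates :: "real \<Rightarrow> (pcm_instance \<Rightarrow> nat list) \<Rightarrow> supplier_instance \<Rightarrow> (rat \<times> nat list) list" where
  "candidates \<rho> alg I = concat (map (\<lambda>t. map (\<lambda>u. (snd (snd t), alg (pcm_of I (snd (snd t)) u)))
     (filter (\<lambda>u. real (covered I (snd (snd t)) u (alg (pcm_of I (snd (snd t)) u))) \<ge> \<rho> * real (sup_demand I))
       (rounds I (snd (snd t))))) (dist_table I))"

definition best_candidates :: "real \<Rightarrow> (pcm_instance \<Rightarrow> nat list) \<Rightarrow> supplier_instance \<Rightarrow> (rat \<times> nat list) list" where
  "best_candidates \<rho> alg I =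
     filter (\<lambda>c. \<forall>c'\<in>set (candidates \<rho> alg I). fst c \<le> fst c') (candidates \<rho> alg I)"

definition supplier_alg :: "real \<Rightarrow> (pcm_instance \<Rightarrow> nat list) \<Rightarrow> supplier_instance \<Rightarrow> nat list" where
  "supplier_alg \<rho> alg I =
     (if best_candidates \<rho> alg I = [] then [] else snd (hd (best_candidates \<rho> alg I)))"


section \<open>Correctness\<close>

lemma dist_table_iff:
  "(u, v, q) \<in> set (dist_table I) \<longleftrightarrow> u \<in> set (sup_facilities I) \<union> set (sup_customers I) \<and>
     v \<in> set (sup_facilities I) \<union> set (sup_customers I) \<and> q = sup_metric I u v"
  by (auto simp: dist_table_def Let_def)

lemma near_iff:
  "near I r f v \<longleftrightarrow> f \<in> set (sup_facilities I) \<union> set (sup_customers I) \<and>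
     v \<in> set (sup_facilities I) \<union> set (sup_customers I) \<and> sup_metric I f v \<le> r"
  by (auto simp: near_def Bex_def dist_table_iff)

lemma conflict_sym: "conflict I r v w = conflict I r w v"
  by (auto simp: conflict_def)

lemma distinct_map_set_parts:
  assumes "distinct js" "\<And>i j. i \<in> set js \<Longrightarrow> j \<in> set js \<Longrightarrow> i \<noteq> j \<Longrightarrow> set (A i) \<inter> set (A j) = {}"
  shows "distinct (map set (filter (\<lambda>x. x \<noteq> []) (map A js)))"
  using assms
proof (induction js)
  case (Cons j js)
  have IH: "distinct (map set (filter (\<lambda>x. x \<noteq> []) (map A js)))"
    using Cons.prems by (intro Cons.IH) auto
  have "set (A j) \<noteq> set (A i)" if "i \<in> set js" "A j \<noteq> []" for i
  proof -
    have "i \<noteq> j" using Cons.prems(1) that(1) by auto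
    then have "set (A j) \<inter> set (A i) = {}" using Cons.prems(2)[of j i] that(1) by auto
    then show ?thesis using that(2) by auto
  qed
  with IH show ?case by auto
qed simp

section \<open>One round at an arbitrary radius with arbitrary penalties\<close>

locale trial =
  fixes fam :: family_scheme and I :: supplier_instance and r :: rat and u :: "nat \<Rightarrow> nat"
  assumes valid: "supplier_valid fam I"
begin

abbreviation "F \<equiv> set (sup_facilities I)"
abbreviation "C \<equiv> set (sup_customers I)"
abbreviation "\<F> \<equiv> fam (sup_family I)"
abbreviation "J \<equiv> pcm_of I r u"

lemma family: "constraint_family F \<F>" and distinct_F: "distinct (sup_facilities I)"
  and distinct_C: "distinct (sup_customers I)"
  and metric: "Metric_space (F \<union> C) (sup_dist I)"
  and demand: "sup_demand I \<le> card C"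
  using valid by (auto simp: supplier_valid_def)

lemma family_sub: "S \<in> \<F> \<Longrightarrow> S \<subseteq> F"
  using family by (auto simp: constraint_family_def)

lemma family_down: "S \<in> \<F> \<Longrightarrow> S' \<subseteq> S \<Longrightarrow> S' \<in> \<F>"
  using family by (auto simp: constraint_family_def down_closed_def)

text \<open>The assignment as a function. It is a choice among the functions that
  \<open>assignment_rep\<close> provides, so only the properties stated there are available, and
  only on customers.\<close>

definition rep :: "nat \<Rightarrow> nat" where
  "rep = (SOME rep. rep_pairs I r u = rev (map (\<lambda>v. (v, rep v)) (sort_by u (sup_customers I))) \<and>
    (\<forall>v\<in>C. rep v \<in> C \<and> rep (rep v) = rep v \<and> u (rep v) \<le> u v \<and> (rep v = v \<or> conflict I r (rep v) v)) \<and>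
    (\<forall>v\<in>C. \<forall>w\<in>C. rep v = v \<longrightarrow> rep w = w \<longrightarrow> conflict I r v w \<longrightarrow> v = w))"

lemma rep:
  "rep_pairs I r u = rev (map (\<lambda>v. (v, rep v)) (sort_by u (sup_customers I)))"
  "v \<in> C \<Longrightarrow> rep v \<in> C" "v \<in> C \<Longrightarrow> rep (rep v) = rep v" "v \<in> C \<Longrightarrow> u (rep v) \<le> u v"
  "v \<in> C \<Longrightarrow> rep v = v \<or> conflict I r (rep v) v"
  "v \<in> C \<Longrightarrow> w \<in> C \<Longrightarrow> rep v = v \<Longrightarrow> rep w = w \<Longrightarrow> conflict I r v w \<Longrightarrow> v = w"
proof -
  have "\<exists>rep. rep_pairs I r u = rev (map (\<lambda>v. (v, rep v)) (sort_by u (sup_customers I))) \<and>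
    (\<forall>v\<in>C. rep v \<in> C \<and> rep (rep v) = rep v \<and> u (rep v) \<le> u v \<and> (rep v = v \<or> conflict I r (rep v) v)) \<and>
    (\<forall>v\<in>C. \<forall>w\<in>C. rep v = v \<longrightarrow> rep w = w \<longrightarrow> conflict I r v w \<longrightarrow> v = w)"
    using assignment_rep[of "sort_by u (sup_customers I)" u "conflict I r"] distinct_C conflict_sym
    by (simp add: rep_pairs_def sorted_sort_by)
  note * = someI_ex[OF this, folded rep_def]
  show "rep_pairs I r u = rev (map (\<lambda>v. (v, rep v)) (sort_by u (sup_customers I)))"
    "v \<in> C \<Longrightarrow> rep v \<in> C" "v \<in> C \<Longrightarrow> rep (rep v) = rep v" "v \<in> C \<Longrightarrow> u (rep v) \<le> u v"
    "v \<in> C \<Longrightarrow> rep v = v \<or> conflict I r (rep v) v"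
    "v \<in> C \<Longrightarrow> w \<in> C \<Longrightarrow> rep v = v \<Longrightarrow> rep w = w \<Longrightarrow> conflict I r v w \<Longrightarrow> v = w"
    using * by blast+
qed

lemma length_filter_rep_pairs: "length (filter P (rep_pairs I r u)) = card {v \<in> C. P (v, rep v)}"
proof -
  have "length (filter P (rep_pairs I r u)) = length (filter (\<lambda>v. P (v, rep v)) (sort_by u (sup_customers I)))"
    by (simp add: rep(1) rev_filter[symmetric] filter_map comp_def)
  also have "\<dots> = card ({v. P (v, rep v)} \<inter> C)"
    using distinct_C by (simp add: distinct_length_filter)
  also have "{v. P (v, rep v)} \<inter> C = {v \<in> C. P (v, rep v)}" by auto
  finally show ?thesis .
qed

lemma val_eq: "pcm_val J f = card {v \<in> C. near I r f (rep v)}"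
  by (simp add: pcm_of_def length_filter_rep_pairs)

lemma covered_eq: "covered I r u y = card {v \<in> C. \<exists>f\<in>set y. near I r f (rep v)}"
  by (simp add: covered_def length_filter_rep_pairs)

lemma penalize_eq: "penalize I r u v = u v + card {w \<in> C. rep w = v}"
  by (simp add: penalize_def length_filter_rep_pairs)

text \<open>A facility near two representatives would witness a conflict between them.\<close>

lemma near_unique:
  "f \<in> F \<Longrightarrow> v \<in> C \<Longrightarrow> w \<in> C \<Longrightarrow> rep v = v \<Longrightarrow> rep w = w \<Longrightarrow> near I r f v \<Longrightarrow> near I r f w \<Longrightarrow> v = w"
  by (rule rep(6)) (auto simp: conflict_def)

lemma part_sets_eq:
  "part_sets J = (\<lambda>j. {f \<in> F. near I r f j}) ` {j \<in> C. rep j = j \<and> (\<exists>f\<in>F. near I r f j)}"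
proof -
  let ?A = "\<lambda>j. filter (\<lambda>f. near I r f j) (sup_facilities I)"
  have "set (filter (\<lambda>p. fst p = snd p) (rep_pairs I r u)) = (\<lambda>j. (j, j)) ` {j \<in> C. rep j = j}"
    by (auto simp: rep(1) image_iff)
  then have "set (pcm_parts J) = {A \<in> (\<lambda>p. ?A (fst p)) ` (\<lambda>j. (j, j)) ` {j \<in> C. rep j = j}. A \<noteq> []}"
    by (simp add: pcm_of_def)
  also have "\<dots> = ?A ` {j \<in> C. rep j = j \<and> ?A j \<noteq> []}"
  proof -
    have "{A \<in> g ` X. A \<noteq> []} = g ` {j \<in> X. g j \<noteq> []}" for g :: "nat \<Rightarrow> nat list" and X by auto
    then show ?thesis unfolding image_image fst_conv by simp
  qed
  finally show ?thesis by (simp add: part_sets_def image_image filter_empty_conv)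
qed

lemma val_near_rep:
  assumes "f \<in> F" "j \<in> C" "rep j = j" "near I r f j"
  shows "pcm_val J f = card {v \<in> C. rep v = j}"
proof -
  have "near I r f (rep v) \<longleftrightarrow> rep v = j" if "v \<in> C" for v
    using near_unique[OF assms(1) rep(2)[OF that] assms(2) rep(3)[OF that] assms(3)] assms(4) by auto
  then show ?thesis unfolding val_eq by (metis (mono_tags, lifting))
qed

text \<open>Disjointness of the parts follows from \<open>near_unique\<close>, constancy of the
  values from \<open>val_near_rep\<close>. The radius is arbitrary, so the PCM algorithm may be
  called at every guess.\<close>

lemma pcm_valid: "pcm_valid fam J"
proof -
  let ?A = "\<lambda>j. filter (\<lambda>f. near I r f j) (sup_facilities I)"
  let ?js = "map fst (filter (\<lambda>p. fst p = snd p) (rep_pairs I r u))"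
  have parts: "pcm_parts J = filter (\<lambda>x. x \<noteq> []) (map ?A ?js)"
    by (simp add: pcm_of_def comp_def)
  have js: "?js = rev (filter (\<lambda>v. rep v = v) (sort_by u (sup_customers I)))"
    by (simp add: rep(1) rev_filter[symmetric] filter_map comp_def rev_map[symmetric] eq_commute)
  have "distinct (map set (pcm_parts J))"
    unfolding parts js
  proof (rule distinct_map_set_parts)
    show "distinct (rev (filter (\<lambda>v. rep v = v) (sort_by u (sup_customers I))))" using distinct_C by simp
    fix i j assume "i \<in> set (rev (filter (\<lambda>v. rep v = v) (sort_by u (sup_customers I))))"
      "j \<in> set (rev (filter (\<lambda>v. rep v = v) (sort_by u (sup_customers I))))" "i \<noteq> j"
    then show "set (?A i) \<inter> set (?A j) = {}" using near_unique[of _ i j] by auto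
  qed
  moreover have "\<forall>P\<in>set (pcm_parts J). distinct P" using distinct_F by (auto simp: pcm_of_def)
  moreover have "sub_partition F (part_sets J)"
    unfolding sub_partition_def
  proof
    show "disjoint (part_sets J)"
    proof (rule disjointI)
      fix A B assume "A \<in> part_sets J" "B \<in> part_sets J" and ne: "A \<noteq> B"
      then obtain i j where ij: "i \<in> C" "rep i = i" "A = {f \<in> F. near I r f i}"
        "j \<in> C" "rep j = j" "B = {f \<in> F. near I r f j}"
        unfolding part_sets_eq by auto
      show "A \<inter> B = {}"
      proof (rule ccontr)
        assume "A \<inter> B \<noteq> {}"
        then obtain f where "f \<in> A" "f \<in> B" by auto
        then have "i = j" using near_unique[of f i j] ij by auto
        with ne ij show False by simp
      qed
    qed
  qed (auto simp: part_sets_eq)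
  moreover have "\<forall>A\<in>part_sets J. \<forall>f\<in>A. \<forall>g\<in>A. pcm_val J f = pcm_val J g"
    unfolding part_sets_eq by (auto simp: val_near_rep)
  moreover have J: "pcm_ground J = sup_facilities I" "pcm_family J = sup_family I"
    by (simp_all add: pcm_of_def)
  ultimately show ?thesis
    unfolding pcm_valid_def J using family distinct_F by blast
qed

text \<open>A customer counted for two chosen facilities would have a representative near both,
  which puts them in one part, against feasibility. So no customer is counted twice.\<close>

lemma sum_val_le_covered:
  assumes "pcm_feasible \<F> (part_sets J) (set y)"
  shows "sum (pcm_val J) (set y) \<le> covered I r u y"
proof -
  have y: "set y \<subseteq> F" using assms family_sub by (auto simp: pcm_feasible_def)
  have "sum (pcm_val J) (set y) = (\<Sum>f\<in>set y. card {v \<in> C. near I r f (rep v)})" by (simp add: val_eq)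
  also have "\<dots> = card (\<Union>f\<in>set y. {v \<in> C. near I r f (rep v)})"
  proof (rule card_UN_disjoint[symmetric])
    show "\<forall>f\<in>set y. \<forall>g\<in>set y. f \<noteq> g \<longrightarrow> {v \<in> C. near I r f (rep v)} \<inter> {v \<in> C. near I r g (rep v)} = {}"
    proof (intro ballI impI, rule ccontr)
      fix f g assume fg: "f \<in> set y" "g \<in> set y" "f \<noteq> g"
        "{v \<in> C. near I r f (rep v)} \<inter> {v \<in> C. near I r g (rep v)} \<noteq> {}"
      then obtain v where v: "v \<in> C" "near I r f (rep v)" "near I r g (rep v)" by auto
      let ?A = "{f \<in> F. near I r f (rep v)}"
      have "?A \<in> part_sets J"
        unfolding part_sets_eq using v rep(2,3)[OF v(1)] fg(1) y by blast
      then have "card (set y \<inter> ?A) \<le> 1" using assms by (auto simp: pcm_feasible_def)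
      moreover have "{f, g} \<subseteq> set y \<inter> ?A" using fg v y by auto
      then have "card {f, g} \<le> card (set y \<inter> ?A)" by (intro card_mono) auto
      ultimately show False using fg(3) by simp
    qed
  qed auto
  also have "(\<Union>f\<in>set y. {v \<in> C. near I r f (rep v)}) = {v \<in> C. \<exists>f\<in>set y. near I r f (rep v)}" by auto
  finally show ?thesis by (simp add: covered_eq)
qed

text \<open>Any member of the family prunes to a feasible solution that meets the same parts.\<close>

lemma sum_cnt_le_opt:
  assumes S: "S \<in> \<F>"
  shows "(\<Sum>j\<in>{v \<in> C. \<exists>f\<in>S. near I r f v}. card {v \<in> C. rep v = j}) \<le> pcm_opt \<F> (part_sets J) (pcm_val J)"
proof -
  let ?H = "{v \<in> C. \<exists>f\<in>S. near I r f v}"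
  let ?R = "{j \<in> ?H. rep j = j}"
  have SF: "S \<subseteq> F" by (rule family_sub[OF S])
  \<comment> \<open>One facility of \<open>S\<close> is kept for each representative that
    \<open>S\<close> reaches; keeping more could put two of them in one part.\<close>
  obtain c where c: "\<And>j. j \<in> ?R \<Longrightarrow> c j \<in> S \<and> near I r (c j) j"
    using bchoice[of ?R "\<lambda>j f. f \<in> S \<and> near I r f j"] by blast
  have c_near: "j = j'" if "j \<in> ?R" "j' \<in> C" "rep j' = j'" "near I r (c j) j'" for j j'
    using near_unique[of "c j" j j'] c[OF that(1)] that SF by auto
  have inj: "inj_on c ?R"
  proof (rule inj_onI)
    fix i j assume "i \<in> ?R" "j \<in> ?R" "c i = c j"
    then show "i = j" using c_near[of i j] c[of j] by auto
  qed
  have "c ` ?R \<in> \<F>" by (rule family_down[OF S]) (use c in auto)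
  moreover have "card (c ` ?R \<inter> A) \<le> 1" if A: "A \<in> part_sets J" for A
  proof -
    obtain j where j: "j \<in> C" "rep j = j" "A = {f \<in> F. near I r f j}" using A unfolding part_sets_eq by auto
    have "c ` ?R \<inter> A \<subseteq> {c j}"
    proof
      fix f assume "f \<in> c ` ?R \<inter> A"
      then obtain i where "i \<in> ?R" "f = c i" "near I r (c i) j" using j(3) by auto
      then show "f \<in> {c j}" using c_near[of i j] j by simp
    qed
    then have "card (c ` ?R \<inter> A) \<le> card {c j}" by (intro card_mono) auto
    then show ?thesis by simp
  qed
  ultimately have feas: "pcm_feasible \<F> (part_sets J) (c ` ?R)" by (auto simp: pcm_feasible_def)
  \<comment> \<open>Only representatives have customers assigned to them, so the other members of
    \<open>?H\<close> contribute \<open>0\<close>.\<close>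
  have "(\<Sum>j\<in>?H. card {v \<in> C. rep v = j}) = (\<Sum>j\<in>?R. card {v \<in> C. rep v = j})"
  proof (rule sum.mono_neutral_right)
    show "\<forall>j\<in>?H - ?R. card {v \<in> C. rep v = j} = 0"
    proof
      fix j assume "j \<in> ?H - ?R"
      then have "{v \<in> C. rep v = j} = {}" using rep(3) by auto
      then show "card {v \<in> C. rep v = j} = 0" by simp
    qed
  qed auto
  also have "\<dots> = (\<Sum>j\<in>?R. pcm_val J (c j))"
  proof (intro sum.cong refl)
    fix j assume j: "j \<in> ?R"
    then show "card {v \<in> C. rep v = j} = pcm_val J (c j)"
      using val_near_rep[of "c j" j] c[OF j] SF by auto
  qed
  also have "\<dots> = sum (pcm_val J) (c ` ?R)" by (simp only: sum.reindex[OF inj] comp_def)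
  also have "\<dots> \<le> pcm_opt \<F> (part_sets J) (pcm_val J)"
    unfolding pcm_opt_def
  proof (rule Max_ge)
    have "{sum (pcm_val J) S |S. pcm_feasible \<F> (part_sets J) S} \<subseteq> sum (pcm_val J) ` Pow F"
      using family_sub by (auto simp: pcm_feasible_def)
    then show "finite {sum (pcm_val J) S |S. pcm_feasible \<F> (part_sets J) S}"
      by (rule finite_subset) auto
  qed (use feas in auto)
  finally show ?thesis .
qed

lemma metric_rat:
  assumes "x \<in> F \<union> C" "y \<in> F \<union> C"
  shows "sup_metric I x y = sup_metric I y x" "0 \<le> sup_metric I x y"
    "z \<in> F \<union> C \<Longrightarrow> sup_metric I x z \<le> sup_metric I x y + sup_metric I y z"
proof -
  have "sup_dist I x y = sup_dist I y x" using Metric_space.commute[OF metric] .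
  then show "sup_metric I x y = sup_metric I y x" by (simp add: sup_dist_def)
  show "0 \<le> sup_metric I x y" using Metric_space.nonneg[OF metric, of x y] by (simp add: sup_dist_def)
  assume "z \<in> F \<union> C"
  with assms have "sup_dist I x z \<le> sup_dist I x y + sup_dist I y z" by (intro Metric_space.triangle[OF metric])
  then show "sup_metric I x z \<le> sup_metric I x y + sup_metric I y z"
    by (simp add: sup_dist_def of_rat_add[symmetric] of_rat_less_eq del: of_rat_add)
qed

text \<open>Three hops of length at most \<open>r\<close>: from \<open>v\<close> to the facility
  witnessing its conflict with \<open>rep v\<close>, on to \<open>rep v\<close>, and on to
  \<open>f\<close>. This is the origin of the factor 3.\<close>

lemma near_rep_dist:
  assumes "v \<in> C" "f \<in> F" "near I r f (rep v)"
  shows "sup_metric I v f \<le> 3 * r"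
proof (cases "rep v = v")
  case True
  \<comment> \<open>Together with \<open>near\<close> this makes \<open>r\<close> non-negative, so a
    single hop is within \<open>3 * r\<close>.\<close>
  have "0 \<le> sup_metric I f v" using metric_rat(2) assms by auto
  then show ?thesis using assms True metric_rat(1)[of v f] by (auto simp: near_iff)
next
  case False
  then obtain g where g: "g \<in> F" "near I r g (rep v)" "near I r g v"
    using rep(5)[OF assms(1)] by (auto simp: conflict_def)
  have "sup_metric I v f \<le> sup_metric I v g + sup_metric I g f"
    using metric_rat(3)[of v g f] assms g by auto
  also have "sup_metric I g f \<le> sup_metric I g (rep v) + sup_metric I (rep v) f"
    using metric_rat(3)[of g "rep v" f] assms g rep(2) by auto
  finally show ?thesis
    using g assms metric_rat(1)[of v g] metric_rat(1)[of "rep v" f] rep(2) by (auto simp: near_iff)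
qed

text \<open>Here \<open>opt\<close> is any upper bound of the radius; it becomes the optimum once
  the smallest successful radius is known not to exceed it.\<close>

lemma covered_le_card:
  assumes "set y \<subseteq> F" "ennreal (of_rat r) \<le> opt"
  shows "covered I r u y \<le> card {v \<in> C. set_dist (sup_dist I) v (set y) \<le> ennreal 3 * opt}"
  unfolding covered_eq
proof (rule card_mono)
  show "{v \<in> C. \<exists>f\<in>set y. near I r f (rep v)} \<subseteq> {v \<in> C. set_dist (sup_dist I) v (set y) \<le> ennreal 3 * opt}"
  proof safe
    fix v f assume v: "v \<in> C" "f \<in> set y" "near I r f (rep v)"
    have "set_dist (sup_dist I) v (set y) \<le> ennreal (sup_dist I v f)"
      unfolding set_dist_def using v(2) by (rule INF_lower)
    also have "sup_dist I v f \<le> of_rat (3 * r)"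
      unfolding sup_dist_def of_rat_less_eq using near_rep_dist v assms by auto
    then have "ennreal (sup_dist I v f) \<le> ennreal (of_rat (3 * r))" by (rule ennreal_leI)
    also have "\<dots> = ennreal 3 * ennreal (of_rat r)"
      by (simp add: of_rat_mult ennreal_mult')
    also have "\<dots> \<le> ennreal 3 * opt" using assms(2) by (rule mult_left_mono) simp
    finally show "set_dist (sup_dist I) v (set y) \<le> ennreal 3 * opt" .
  qed
qed simp

end

text \<open>The value of a solution is a maximum of minima over finite sets, hence a distance in the
  table. The maximum exists because \<open>T\<close> is non-empty, and finiteness of the value makes
  \<open>S\<close> non-empty.\<close>

lemma threshold_exists:
  assumes valid: "supplier_valid fam I" and S: "S \<in> fam (sup_family I)"
    and T: "T \<subseteq> set (sup_customers I)" "T \<noteq> {}"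
    and fin: "(SUP v\<in>T. set_dist (sup_dist I) v S) < top"
  shows "\<exists>t\<in>set (dist_table I). ennreal (of_rat (snd (snd t))) \<le> (SUP v\<in>T. set_dist (sup_dist I) v S) \<and>
    (\<forall>v\<in>T. \<exists>f\<in>S. near I (snd (snd t)) f v)"
proof -
  \<comment> \<open>The facts on the family and the metric do not depend on the radius or the
    penalties.\<close>
  interpret trial fam I undefined undefined by unfold_locales (rule valid)
  have SF: "S \<subseteq> F" by (rule family_sub[OF S])
  then have fS: "finite S" by (rule finite_subset) simp
  have fT: "finite T" using T(1) by (rule finite_subset) simp
  have "\<exists>f\<in>S. set_dist (sup_dist I) v S = ennreal (sup_dist I v f)" if v: "v \<in> T" for v
  proof -
    have "set_dist (sup_dist I) v S < top"
      by (rule le_less_trans[OF SUP_upper[OF v] fin])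
    then have "S \<noteq> {}" by (auto simp: set_dist_def)
    then have "(INF f\<in>S. ennreal (sup_dist I v f)) \<in> (\<lambda>f. ennreal (sup_dist I v f)) ` S"
      using fS by (subst cInf_eq_Min) (auto intro!: Min_in)
    then show ?thesis by (auto simp: set_dist_def)
  qed
  then obtain c where c: "\<And>v. v \<in> T \<Longrightarrow> c v \<in> S \<and> set_dist (sup_dist I) v S = ennreal (sup_dist I v (c v))"
    by metis
  define r where "r = Max ((\<lambda>v. sup_metric I (c v) v) ` T)"
  have "r \<in> (\<lambda>v. sup_metric I (c v) v) ` T" unfolding r_def using fT T(2) by (intro Max_in) auto
  then obtain v where v: "v \<in> T" "r = sup_metric I (c v) v" by auto
  have r: "sup_metric I (c w) w \<le> r" if "w \<in> T" for w unfolding r_def using fT that by simp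
  have cF: "c w \<in> F" if "w \<in> T" for w using c[OF that] SF by auto
  have "(c v, v, r) \<in> set (dist_table I)" using v T(1) cF by (auto simp: dist_table_iff)
  moreover have "ennreal (of_rat r) \<le> (SUP v\<in>T. set_dist (sup_dist I) v S)"
  proof -
    have "ennreal (of_rat r) = set_dist (sup_dist I) v S"
      using c[OF v(1)] metric_rat(1)[of "c v" v] cF[OF v(1)] v T(1) by (auto simp: sup_dist_def)
    also have "\<dots> \<le> (SUP v\<in>T. set_dist (sup_dist I) v S)" using v(1) by (rule SUP_upper)
    finally show ?thesis .
  qed
  moreover have "\<exists>f\<in>S. near I r f w" if "w \<in> T" for w
    using c[OF that] r[OF that] cF[OF that] T(1) that by (intro bexI[of _ "c w"]) (auto simp: near_iff)
  ultimately show ?thesis by (intro bexI[of _ "(c v, v, r)"]) auto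
qed

text \<open>If every listed round failed, \<open>perceptron_bound\<close> would apply to more than
  \<open>n ^ 3\<close> rounds. Its set \<open>H\<close> consists of all customers that
  \<open>S\<close> reaches within \<open>r\<close>; it contains \<open>T\<close> and therefore meets
  the demand.\<close>

lemma successful_round_exists:
  assumes valid: "supplier_valid fam I" and S: "S \<in> fam (sup_family I)"
    and alg: "\<And>J. pcm_valid fam J \<Longrightarrow> pcm_feasible (fam (pcm_family J)) (part_sets J) (set (alg J)) \<and>
      real (sum (pcm_val J) (set (alg J))) \<ge> \<rho> * real (pcm_opt (fam (pcm_family J)) (part_sets J) (pcm_val J))"
    and T: "T \<subseteq> set (sup_customers I)" "sup_demand I \<le> card T" "\<And>v. v \<in> T \<Longrightarrow> \<exists>f\<in>S. near I r f v"
  shows "\<exists>u\<in>set (rounds I r). real (covered I r u (alg (pcm_of I r u))) \<ge> \<rho> * real (sup_demand I)"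
proof (rule ccontr)
  assume no: "\<not> ?thesis"
  let ?C = "set (sup_customers I)"
  define u where "u k = (penalize I r ^^ k) (\<lambda>_. 0)" for k
  define N where "N = Suc (length (sup_customers I) ^ 3)"
  let ?rep = "\<lambda>k. trial.rep I r (u k)"
  define H where "H = {v \<in> ?C. \<exists>f\<in>S. near I r f v}"
  have tr: "trial fam I" by unfold_locales (rule valid)
  have "T \<subseteq> H" using T(1,3) by (auto simp: H_def)
  then have card_T: "card T \<le> card H" by (intro card_mono) (auto simp: H_def)
  have "N \<le> card ?C ^ 3"
  proof (rule perceptron_bound[where u = u and rep = ?rep and H = H and m = "sup_demand I"])
    show "H \<subseteq> ?C" "finite ?C" by (auto simp: H_def)
    show "sup_demand I \<le> card H" using T(2) card_T by simp
    show "u 0 v = 0" for v by (simp add: u_def)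
    show "u (Suc k) v = u k v + card {w \<in> ?C. ?rep k w = v}" for k v
      by (simp add: u_def trial.penalize_eq[OF tr])
    show "?rep k v \<in> ?C \<and> u k (?rep k v) \<le> u k v" if "v \<in> ?C" for k v
      using trial.rep(2,4)[OF tr that] by blast
    show "(\<Sum>j\<in>H. card {v \<in> ?C. ?rep k v = j}) < sup_demand I" if "k < N" for k
    proof -
      let ?J = "pcm_of I r (u k)"
      have fam_J: "pcm_family ?J = sup_family I" by (simp add: pcm_of_def)
      note alg_J = alg[OF trial.pcm_valid[OF tr, of r "u k"], unfolded fam_J]
      have "u k \<in> set (rounds I r)" using that by (simp add: rounds_def u_def N_def del: upt_Suc)
      then have "real (covered I r (u k) (alg ?J)) < \<rho> * real (sup_demand I)" using no by force
      moreover have "sum (pcm_val ?J) (set (alg ?J)) \<le> covered I r (u k) (alg ?J)"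
        using alg_J by (intro trial.sum_val_le_covered[OF tr]) blast
      moreover have "\<rho> * real (pcm_opt (fam (sup_family I)) (part_sets ?J) (pcm_val ?J)) \<le> real (sum (pcm_val ?J) (set (alg ?J)))"
        using alg_J by blast
      ultimately have lt: "\<rho> * real (pcm_opt (fam (sup_family I)) (part_sets ?J) (pcm_val ?J)) < \<rho> * real (sup_demand I)"
        and pos: "0 < \<rho> * real (sup_demand I)"
        by linarith+
      \<comment> \<open>A failed round has a count below \<rho> times the demand; counts are not
        negative, so \<rho> is positive and may be cancelled.\<close>
      have "0 < \<rho>" using pos by (simp add: zero_less_mult_iff)
      with lt have "pcm_opt (fam (sup_family I)) (part_sets ?J) (pcm_val ?J) < sup_demand I" by simp
      with trial.sum_cnt_le_opt[OF tr S, of r "u k"] show ?thesis unfolding H_def by linarith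
    qed
  qed
  also have "\<dots> \<le> length (sup_customers I) ^ 3" by (intro power_mono card_length) simp
  finally show False by (simp add: N_def)
qed

text \<open>No optimal pair is exhibited: every admissible pair of finite value yields a candidate
  of no larger radius, so the smallest candidate radius is a lower bound of the infimum.\<close>

lemma supplier_alg_correct:
  assumes valid: "supplier_valid fam I" and \<rho>: "\<rho> \<le> 1"
    and alg: "\<And>J. pcm_valid fam J \<Longrightarrow> pcm_feasible (fam (pcm_family J)) (part_sets J) (set (alg J)) \<and>
      real (sum (pcm_val J) (set (alg J))) \<ge> \<rho> * real (pcm_opt (fam (pcm_family J)) (part_sets J) (pcm_val J))"
  shows "bicriteria_approximates fam 3 \<rho> I (enc_list enc_nat (supplier_alg \<rho> alg I))"
proof -
  let ?C = "set (sup_customers I)" and ?\<F> = "fam (sup_family I)" and ?m = "sup_demand I"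
  let ?y = "supplier_alg \<rho> alg I"
  let ?opt = "supplier_opt ?\<F> ?C (sup_dist I) ?m"
  have tr: "trial fam I" by unfold_locales (rule valid)
  have cand: "\<exists>u. y = alg (pcm_of I r u) \<and> real (covered I r u y) \<ge> \<rho> * real ?m" if "(r, y) \<in> set (candidates \<rho> alg I)" for r y
    using that by (auto simp: candidates_def)
  have best: "hd (best_candidates \<rho> alg I) \<in> set (candidates \<rho> alg I)"
    "\<And>c. c \<in> set (candidates \<rho> alg I) \<Longrightarrow> fst (hd (best_candidates \<rho> alg I)) \<le> fst c"
    if "best_candidates \<rho> alg I \<noteq> []"
    using hd_in_set[OF that] by (auto simp: best_candidates_def)
  have feas: "set (alg (pcm_of I r u)) \<in> ?\<F>" for r u
    using alg[OF trial.pcm_valid[OF tr, of r u]] by (auto simp: pcm_feasible_def pcm_of_def)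
  have y_fam: "set ?y \<in> ?\<F>"
  proof (cases "best_candidates \<rho> alg I = []")
    case True
    have "?\<F> \<noteq> {}" using trial.family[OF tr] by (auto simp: constraint_family_def)
    then show ?thesis using trial.family_down[OF tr, of _ "{}"] True by (auto simp: supplier_alg_def)
  next
    case False
    then show ?thesis using best(1)[OF False] cand[of "fst (hd (best_candidates \<rho> alg I))" ?y] feas
      by (auto simp: supplier_alg_def)
  qed
  have cov: "\<rho> * real ?m \<le> real (card {v \<in> ?C. set_dist (sup_dist I) v (set ?y) \<le> ennreal 3 * ?opt})"
  proof (cases "?m = 0 \<or> ?opt = top")
    case True
    \<comment> \<open>Here \<rho> \<le> 1 enters: with an infinite optimum all customers count, and
      there are at least as many as the demand.\<close>
    have m: "\<rho> * real ?m \<le> real ?m" using mult_right_mono[OF \<rho>, of "real ?m"] by simp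
    from True show ?thesis
    proof
      assume "?opt = top"
      then have "{v \<in> ?C. set_dist (sup_dist I) v (set ?y) \<le> ennreal 3 * ?opt} = ?C"
        by (auto simp: ennreal_mult_top)
      then show ?thesis using m trial.demand[OF tr] by simp
    qed simp
  next
    case False
    have key: "\<exists>c\<in>set (candidates \<rho> alg I). ennreal (of_rat (fst c)) \<le> (SUP v\<in>T. set_dist (sup_dist I) v S)"
      if ST: "S \<in> ?\<F>" "T \<subseteq> ?C" "?m \<le> card T" "(SUP v\<in>T. set_dist (sup_dist I) v S) < top" for S T
    proof -
      have "T \<noteq> {}" using False ST(3) by auto
      from threshold_exists[OF valid ST(1,2) this ST(4)] obtain t where t: "t \<in> set (dist_table I)"
        "ennreal (of_rat (snd (snd t))) \<le> (SUP v\<in>T. set_dist (sup_dist I) v S)"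
        "\<And>v. v \<in> T \<Longrightarrow> \<exists>f\<in>S. near I (snd (snd t)) f v" by blast
      from successful_round_exists[OF valid ST(1) alg ST(2,3) t(3)] obtain u where
        "u \<in> set (rounds I (snd (snd t)))"
        "real (covered I (snd (snd t)) u (alg (pcm_of I (snd (snd t)) u))) \<ge> \<rho> * real ?m" by blast
      then have "(snd (snd t), alg (pcm_of I (snd (snd t)) u)) \<in> set (candidates \<rho> alg I)"
        using t(1) by (auto simp: candidates_def intro!: bexI[of _ t])
      with t(2) show ?thesis by force
    qed
    have "\<exists>S T. S \<in> ?\<F> \<and> T \<subseteq> ?C \<and> ?m \<le> card T \<and> (SUP v\<in>T. set_dist (sup_dist I) v S) < top"
    proof (rule ccontr)
      assume "\<not> ?thesis"
      then have "\<not> x < top" if "x \<in> {(SUP u\<in>T. set_dist (sup_dist I) u S) |S T. S \<in> ?\<F> \<and> T \<subseteq> ?C \<and> ?m \<le> card T}" for x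
        using that by blast
      then have "top \<le> ?opt" unfolding supplier_opt_def by (intro Inf_greatest) (simp only: not_less)
      with False show False by (simp add: top_unique)
    qed
    with key have "candidates \<rho> alg I \<noteq> []" by fastforce
    then have "Min (fst ` set (candidates \<rho> alg I)) \<in> fst ` set (candidates \<rho> alg I)" by (intro Min_in) auto
    then obtain c where "c \<in> set (candidates \<rho> alg I)" "fst c = Min (fst ` set (candidates \<rho> alg I))" by auto
    then have "c \<in> set (best_candidates \<rho> alg I)" by (simp add: best_candidates_def)
    then have ne: "best_candidates \<rho> alg I \<noteq> []" by (auto simp del: set_filter)
    define r where "r = fst (hd (best_candidates \<rho> alg I))"
    have hd: "hd (best_candidates \<rho> alg I) = (r, ?y)" using ne by (simp add: r_def supplier_alg_def)
    obtain u where u: "\<rho> * real ?m \<le> real (covered I r u ?y)" using cand best(1)[OF ne] unfolding hd by blast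
    have "ennreal (of_rat r) \<le> ?opt"
      unfolding supplier_opt_def
    proof (rule Inf_greatest)
      fix x assume "x \<in> {(SUP u\<in>T. set_dist (sup_dist I) u S) |S T. S \<in> ?\<F> \<and> T \<subseteq> ?C \<and> ?m \<le> card T}"
      then obtain S T where ST: "S \<in> ?\<F>" "T \<subseteq> ?C" "?m \<le> card T" "x = (SUP u\<in>T. set_dist (sup_dist I) u S)" by blast
      show "ennreal (of_rat r) \<le> x"
      proof (cases "x = top")
        case False
        then have "x < top" by (simp only: less_top)
        then obtain c where c: "c \<in> set (candidates \<rho> alg I)" "ennreal (of_rat (fst c)) \<le> x"
          using key[OF ST(1-3)] unfolding ST(4) by blast
        have "ennreal (of_rat r) \<le> ennreal (of_rat (fst c))"
          using best(2)[OF ne c(1)] by (intro ennreal_leI) (simp add: of_rat_less_eq r_def)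
        also note c(2)
        finally show ?thesis .
      qed simp
    qed
    then have "covered I r u ?y \<le> card {v \<in> ?C. set_dist (sup_dist I) v (set ?y) \<le> ennreal 3 * ?opt}"
      using trial.family_sub[OF tr y_fam] by (intro trial.covered_le_card[OF tr])
    with u show ?thesis by linarith
  qed
  show ?thesis
    unfolding bicriteria_approximates_def using y_fam cov by blast
qed

section \<open>Running time of the algorithm\<close>

text \<open>All iterates are kept on a stack and each step acts on the top one; the bound on single
  iterates then bounds the whole stack.\<close>

lemma ptime_iterates:
  fixes g :: "'a \<Rightarrow> 's \<Rightarrow> 's"
  assumes xs: "ptime P X (\<lambda>i. enc_list (e i) (xs i))"
    and s0: "ptime P X (\<lambda>i. S i (s0 i))"
    and step: "ptime (\<lambda>z. P (fst z)) (\<lambda>z. Pair (X (fst z)) (S (fst z) (snd z)))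
      (\<lambda>z. S (fst z) (g (fst z) (snd z)))"
    and bnd: "pbound P X n" "\<And>i k. P i \<Longrightarrow> k \<le> length (xs i) \<Longrightarrow> size (S i ((g i ^^ k) (s0 i))) \<le> n i"
  shows "ptime P X (\<lambda>i. enc_list (S i) (map (\<lambda>k. (g i ^^ k) (s0 i)) [0..<Suc (length (xs i))]))"
proof -
  let ?g = "\<lambda>i s. g i (hd s) # s"
  have f: "(?g i ^^ k) [s0 i] = rev (map (\<lambda>k. (g i ^^ k) (s0 i)) [0..<Suc k])" for i k
    by (induction k) simp_all
  have "ptime P X (\<lambda>i. enc_list (S i) ((?g i ^^ length (xs i)) [s0 i]))"
  proof (rule ptime_funpow[where S = "\<lambda>i. enc_list (S i)" and Q = "\<lambda>_ s. s \<noteq> []" and e = e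
        and n = "\<lambda>i. Suc (length (xs i)) * Suc (n i)"])
    show "ptime P X (\<lambda>i. enc_list (S i) [s0 i])" by (intro ptime_Cons ptime_Nil s0)
    let ?Q = "\<lambda>z. P (fst z) \<and> snd z \<noteq> []"
    let ?X = "\<lambda>z. Pair (X (fst z)) (enc_list (S (fst z)) (snd z))"
    have "ptime ?Q ?X (\<lambda>z. S (fst z) (hd (snd z)))" by (rule ptime_hd[OF ptime_proj(2)]) simp
    from ptime_Pair[OF ptime_proj(1) this]
    have "ptime ?Q ?X (\<lambda>z. (\<lambda>z. Pair (X (fst z)) (S (fst z) (snd z))) (fst z, hd (snd z)))" by simp
    from ptime_apply[OF step this] have "ptime ?Q ?X (\<lambda>z. S (fst z) (g (fst z) (hd (snd z))))" by simp
    then show "ptime ?Q ?X (\<lambda>z. enc_list (S (fst z)) (?g (fst z) (snd z)))"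
      by (rule ptime_Cons[OF _ ptime_proj(2)])
    show "pbound P X (\<lambda>i. Suc (length (xs i)) * Suc (n i))"
      by (intro pbound_intros pbound_length[OF xs] bnd)
    show "(?g i ^^ k) [s0 i] \<noteq> []" for i k unfolding f by simp
    fix i k assume i: "P i" "k \<le> length (xs i)"
    show "size (enc_list (S i) ((?g i ^^ k) [s0 i])) \<le> Suc (length (xs i)) * Suc (n i)"
      unfolding f by (rule size_enc_list_le) (use i bnd(2) in \<open>auto simp: less_Suc_eq_le simp del: upt_Suc\<close>)
  qed (rule xs)
  from ptime_rev[OF this] show ?thesis by (simp add: f del: upt_Suc)
qed

lemma size_enc_list_mset: "mset xs = mset ys \<Longrightarrow> size (enc_list e xs) = size (enc_list e ys)"
  unfolding size_enc_list by (metis mset_map sum_mset_sum_list)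

text \<open>The key is computable only for elements of \<open>xs\<close>, hence the invariant that
  the accumulator contains no others. The accumulator rearranges a prefix of \<open>xs\<close>, so
  its code is no larger than that of \<open>xs\<close>.\<close>

lemma ptime_sort_by:
  assumes xs: "ptime P X (\<lambda>i. enc_list (e i) (xs i))"
    and key: "ptime (\<lambda>z. P (fst z) \<and> snd z \<in> set (xs (fst z))) (\<lambda>z. Pair (X (fst z)) (e (fst z) (snd z)))
      (\<lambda>z. enc_unary (u (fst z) (snd z)))"
  shows "ptime P X (\<lambda>i. enc_list (e i) (sort_by (u i) (xs i)))"
  unfolding sort_by_def
proof (rule ptime_fold[where S = "\<lambda>i. enc_list (e i)" and e = e
      and Q = "\<lambda>i b s. b \<in> set (xs i) \<and> set s \<subseteq> set (xs i)" and n = "\<lambda>i. size (enc_list (e i) (xs i))"])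
  let ?Q = "\<lambda>z. P (fst z) \<and> fst (snd z) \<in> set (xs (fst z)) \<and> set (snd (snd z)) \<subseteq> set (xs (fst z))"
  let ?X = "\<lambda>z. Pair (X (fst z)) (Pair (e (fst z) (fst (snd z))) (enc_list (e (fst z)) (snd (snd z))))"
  let ?Q' = "\<lambda>w. ?Q (fst w) \<and> snd w \<in> set (snd (snd (fst w)))"
  let ?X' = "\<lambda>w. Pair (?X (fst w)) (e (fst (fst w)) (snd w))"
  have "ptime ?Q' ?X' (\<lambda>w. (\<lambda>z. Pair (X (fst z)) (e (fst z) (snd z))) (fst (fst w), snd w))"
    unfolding fst_conv snd_conv by (rule ptime_Pair[OF ptime_fst[OF ptime_proj(1)] ptime_proj(2)])
  from ptime_apply[OF key this] have 1: "ptime ?Q' ?X' (\<lambda>w. enc_unary (u (fst (fst w)) (snd w)))"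
    by (auto simp: subset_iff)
  have "ptime ?Q' ?X' (\<lambda>w. (\<lambda>z. Pair (X (fst z)) (e (fst z) (snd z))) (fst (fst w), fst (snd (fst w))))"
    unfolding fst_conv snd_conv by (rule ptime_Pair[OF ptime_fst[OF ptime_proj(1)] ptime_fst[OF ptime_snd[OF ptime_proj(1)]]])
  from ptime_apply[OF key this] have 2: "ptime ?Q' ?X' (\<lambda>w. enc_unary (u (fst (fst w)) (fst (snd (fst w)))))"
    by (auto simp: subset_iff)
  note le = ptime_unary_le[OF 1 2]
  show "ptime ?Q ?X (\<lambda>z. enc_list (e (fst z)) (insert_by (u (fst z)) (fst (snd z)) (snd (snd z))))"
    unfolding insert_by_def
    by (rule ptime_append[OF ptime_filter[OF ptime_proj(4) le] ptime_Cons[OF ptime_proj(3) ptime_filter[OF ptime_proj(4) ptime_not[OF le]]]])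
  fix i ys
  have mset: "mset (fold (insert_by (u i)) ys []) = mset ys" by (simp add: mset_fold_insert_by)
  show "b \<in> set (xs i) \<and> set (fold (insert_by (u i)) ys []) \<subseteq> set (xs i)" if "xs i = ys @ b # zs" for b zs
    using that mset_eq_setD[OF mset] by auto
  show "size (enc_list (e i) (fold (insert_by (u i)) ys [])) \<le> size (enc_list (e i) (xs i))" if "xs i = ys @ zs" for zs
    using that size_enc_list_mset[OF mset, of "e i"] by (simp add: size_enc_list_append)
qed (auto intro: xs ptime_Nil[simplified] ptime_pbound[OF xs])

section \<open>Running times of the steps of the algorithm\<close>

definition enc_entry :: "nat \<times> nat \<times> rat \<Rightarrow> data" where
  "enc_entry t = Pair (enc_nat (fst t)) (Pair (enc_nat (fst (snd t))) (enc_rat (snd (snd t))))"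

definition enc_pair :: "nat \<times> nat \<Rightarrow> data" where
  "enc_pair p = Pair (enc_nat (fst p)) (enc_nat (snd p))"

definition enc_candidate :: "rat \<times> nat list \<Rightarrow> data" where
  "enc_candidate c = Pair (enc_rat (fst c)) (enc_list enc_nat (snd c))"

lemma enc_supplier_eq:
  "enc_supplier I = Pair (enc_list enc_nat (sup_facilities I)) (Pair (enc_list enc_nat (sup_customers I))
     (Pair (enc_list enc_entry (dist_table I)) (Pair (enc_unary (sup_demand I)) (sup_family I))))"
  unfolding enc_supplier_def dist_table_def Let_def enc_list_map
  by (auto intro!: enc_list_cong simp: enc_entry_def)

lemma ptime_supplier:
  assumes "ptime P X (\<lambda>z. enc_supplier (I z))"
  shows "ptime P X (\<lambda>z. enc_list enc_nat (sup_facilities (I z)))"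
    "ptime P X (\<lambda>z. enc_list enc_nat (sup_customers (I z)))"
    "ptime P X (\<lambda>z. enc_list enc_entry (dist_table (I z)))"
    "ptime P X (\<lambda>z. enc_unary (sup_demand (I z)))"
    "ptime P X (\<lambda>z. sup_family (I z))"
proof -
  note 0 = assms[unfolded enc_supplier_eq]
  note 1 = ptime_snd[OF 0] note 2 = ptime_snd[OF 1] note 3 = ptime_snd[OF 2]
  show "ptime P X (\<lambda>z. enc_list enc_nat (sup_facilities (I z)))"
    "ptime P X (\<lambda>z. enc_list enc_nat (sup_customers (I z)))"
    "ptime P X (\<lambda>z. enc_list enc_entry (dist_table (I z)))"
    "ptime P X (\<lambda>z. enc_unary (sup_demand (I z)))"
    "ptime P X (\<lambda>z. sup_family (I z))"
    by (rule ptime_fst[OF 0] ptime_fst[OF 1] ptime_fst[OF 2] ptime_fst[OF 3] ptime_snd[OF 3])+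
qed

lemma dist_table_nonneg:
  assumes "supplier_valid fam I" "t \<in> set (dist_table I)"
  shows "0 \<le> snd (snd t)"
proof -
  interpret trial fam I undefined undefined by unfold_locales (rule assms(1))
  have "(fst t, fst (snd t), snd (snd t)) \<in> set (dist_table I)" using assms(2) by simp
  then show ?thesis unfolding dist_table_iff using metric_rat(2) by auto
qed

text \<open>The assumption \<open>ok\<close> serves the comparison of rationals: the radius is
  non-negative, and so are the table entries, being values of a metric.\<close>

lemma ptime_near:
  assumes I: "ptime P X (\<lambda>z. enc_supplier (I z))" and r: "ptime P X (\<lambda>z. enc_rat (r z))"
    and f: "ptime P X (\<lambda>z. enc_nat (f z))" and v: "ptime P X (\<lambda>z. enc_nat (v z))"
    and ok: "\<forall>z. P z \<longrightarrow> supplier_valid fam (I z) \<and> 0 \<le> r z"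
  shows "ptime P X (\<lambda>z. enc_bool (near (I z) (r z) (f z) (v z)))"
  unfolding near_def
proof (rule ptime_Bex[OF ptime_supplier(3)[OF I]])
  let ?Q = "\<lambda>z. P (fst z) \<and> snd z \<in> set (dist_table (I (fst z)))"
  let ?X = "\<lambda>z. Pair (X (fst z)) (enc_entry (snd z))"
  have t: "ptime ?Q ?X (\<lambda>z. Pair (enc_nat (fst (snd z))) (Pair (enc_nat (fst (snd (snd z)))) (enc_rat (snd (snd (snd z))))))"
    unfolding enc_entry_def by (rule ptime_proj(2))
  note t' = ptime_snd[OF t]
  show "ptime ?Q ?X (\<lambda>z. enc_bool (fst (snd z) = f (fst z) \<and> fst (snd (snd z)) = v (fst z) \<and> snd (snd (snd z)) \<le> r (fst z)))"
  proof (intro ptime_conj ptime_nat_eq ptime_rat_le)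
    show "ptime ?Q ?X (\<lambda>z. enc_nat (fst (snd z)))" by (rule ptime_fst[OF t])
    show "ptime ?Q ?X (\<lambda>z. enc_nat (fst (snd (snd z))))" by (rule ptime_fst[OF t'])
    show "ptime ?Q ?X (\<lambda>z. enc_rat (snd (snd (snd z))))" by (rule ptime_snd[OF t'])
    show "ptime ?Q ?X (\<lambda>z. enc_nat (f (fst z)))" by (rule ptime_lift[OF f]) simp
    show "ptime ?Q ?X (\<lambda>z. enc_nat (v (fst z)))" by (rule ptime_lift[OF v]) simp
    show "ptime ?Q ?X (\<lambda>z. enc_rat (r (fst z)))" by (rule ptime_lift[OF r]) simp
  qed (use ok dist_table_nonneg in blast)+
qed

lemma ptime_conflict:
  assumes I: "ptime P X (\<lambda>z. enc_supplier (I z))" and r: "ptime P X (\<lambda>z. enc_rat (r z))"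
    and v: "ptime P X (\<lambda>z. enc_nat (v z))" and w: "ptime P X (\<lambda>z. enc_nat (w z))"
    and ok: "\<forall>z. P z \<longrightarrow> supplier_valid fam (I z) \<and> 0 \<le> r z"
  shows "ptime P X (\<lambda>z. enc_bool (conflict (I z) (r z) (v z) (w z)))"
  unfolding conflict_def
proof (rule ptime_Bex[OF ptime_supplier(1)[OF I]])
  let ?Q = "\<lambda>z. P (fst z) \<and> snd z \<in> set (sup_facilities (I (fst z)))"
  let ?X = "\<lambda>z. Pair (X (fst z)) (enc_nat (snd z))"
  note lift = ptime_lift[where Q = ?Q and W = "\<lambda>z. enc_nat (snd z)"]
  have Q: "\<forall>z. ?Q z \<longrightarrow> P (fst z)" by simp
  show "ptime ?Q ?X (\<lambda>z. enc_bool (near (I (fst z)) (r (fst z)) (snd z) (v (fst z)) \<and> near (I (fst z)) (r (fst z)) (snd z) (w (fst z))))"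
    by (intro ptime_conj ptime_near[where fam = fam] ptime_proj lift[OF I Q] lift[OF r Q] lift[OF v Q] lift[OF w Q])
      (use ok in simp_all)
qed

text \<open>Size control for the intermediate lists of the loop, valid for any order and any
  relation.\<close>

lemma assign_fold:
  "length (fold (assign_step R) ys []) = length ys \<and> set (fold (assign_step R) ys []) \<subseteq> set ys \<times> set ys"
proof (induction ys rule: rev_induct)
  case (snoc y ys)
  let ?ps = "fold (assign_step R) ys []"
  define j where "j = snd (hd (assign_step R y ?ps))"
  have step: "fold (assign_step R) (ys @ [y]) [] = (y, j) # ?ps" by (simp add: assign_step_def j_def)
  let ?L = "filter (\<lambda>p. fst p = snd p \<and> R (fst p) y) ?ps"
  have "j \<in> insert y (set ys)"
  proof (cases "?L = []")
    case False
    have "hd ?L \<in> set ?ps" using hd_in_set[OF False] by simp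
    then have "hd ?L \<in> set ys \<times> set ys" using snoc by blast
    then show ?thesis using False by (simp add: j_def assign_step_def mem_Times_iff)
  qed (simp add: j_def assign_step_def)
  then show ?case unfolding step using snoc by auto
qed simp

lemma length_rep_pairs [simp]: "length (rep_pairs I r u) = length (sup_customers I)"
  using assign_fold[of "conflict I r"] by (simp add: rep_pairs_def assignment_def)

text \<open>The penalty function enters as its table on the customers, with unary values. Each entry
  carries its sort key, and the keys are stripped once the list is sorted.\<close>

lemma ptime_rep_pairs:
  assumes I: "ptime P X (\<lambda>z. enc_supplier (I z))" and r: "ptime P X (\<lambda>z. enc_rat (r z))"
    and u: "ptime P X (\<lambda>z. enc_list (\<lambda>v. Pair (enc_nat v) (enc_unary (u z v))) (sup_customers (I z)))"
    and ok: "\<forall>z. P z \<longrightarrow> supplier_valid fam (I z) \<and> 0 \<le> r z"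
  shows "ptime P X (\<lambda>z. enc_list enc_pair (rep_pairs (I z) (r z) (u z)))"
proof -
  let ?vs = "\<lambda>z. sort_by (u z) (sup_customers (I z))"
  have "ptime P X (\<lambda>z. enc_list (\<lambda>v. Pair (enc_nat v) (enc_unary (u z v))) (?vs z))"
    by (rule ptime_sort_by[OF u]) (rule ptime_snd[OF ptime_proj(2)])
  from ptime_map[OF this, of "\<lambda>_. enc_nat" "\<lambda>_ v. v", OF ptime_fst[OF ptime_proj(2)]]
  have vs: "ptime P X (\<lambda>z. enc_list enc_nat (?vs z))" by simp
  show ?thesis
    unfolding rep_pairs_def assignment_def
  proof (rule ptime_fold[where S = "\<lambda>_. enc_list enc_pair" and e = "\<lambda>_. enc_nat" and Q = "\<lambda>_ _ _. True"
        and n = "\<lambda>z. length (?vs z) * Suc (1 + 2 * size (enc_list enc_nat (?vs z)))"])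
    let ?Q = "\<lambda>z. P (fst z) \<and> True"
    let ?X = "\<lambda>z. Pair (X (fst z)) (Pair (enc_nat (fst (snd z))) (enc_list enc_pair (snd (snd z))))"
    let ?L = "\<lambda>z. filter (\<lambda>p. fst p = snd p \<and> conflict (I (fst z)) (r (fst z)) (fst p) (fst (snd z))) (snd (snd z))"
    let ?Q' = "\<lambda>w. ?Q (fst w) \<and> snd w \<in> set (snd (snd (fst w)))"
    let ?X' = "\<lambda>w. Pair (?X (fst w)) (enc_pair (snd w))"
    have p: "ptime ?Q' ?X' (\<lambda>w. Pair (enc_nat (fst (snd w))) (enc_nat (snd (snd w))))"
      unfolding enc_pair_def[of "snd _"] by (rule ptime_proj(2))
    have Q: "\<forall>z. ?Q z \<longrightarrow> P (fst z)" by simp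
    have Q': "\<forall>w. ?Q' w \<longrightarrow> ?Q (fst w)" by simp
    have I': "ptime ?Q' ?X' (\<lambda>w. enc_supplier (I (fst (fst w))))" by (rule ptime_lift[OF ptime_lift[OF I Q] Q'])
    have r': "ptime ?Q' ?X' (\<lambda>w. enc_rat (r (fst (fst w))))" by (rule ptime_lift[OF ptime_lift[OF r Q] Q'])
    have v': "ptime ?Q' ?X' (\<lambda>w. enc_nat (fst (snd (fst w))))" by (rule ptime_lift[OF ptime_proj(3) Q'])
    have L: "ptime ?Q ?X (\<lambda>z. enc_list enc_pair (?L z))"
    proof (rule ptime_filter[where e = "\<lambda>_. enc_pair", OF ptime_proj(4)])
      show "ptime ?Q' ?X' (\<lambda>w. enc_bool (fst (snd w) = snd (snd w) \<and>
          conflict (I (fst (fst w))) (r (fst (fst w))) (fst (snd w)) (fst (snd (fst w)))))"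
        by (intro ptime_conj ptime_nat_eq ptime_fst[OF p] ptime_snd[OF p]
            ptime_conflict[where fam = fam, OF I' r' ptime_fst[OF p] v']) (use ok in simp)
    qed
    \<comment> \<open>\<open>hd\<close> is meaningful on this branch only;
      \<open>ptime_if_test\<close> joins it with the branch where the customer represents
      itself.\<close>
    have "ptime (\<lambda>z. ?Q z \<and> \<not> ?L z = []) ?X (\<lambda>z. enc_pair (hd (?L z)))"
      by (rule ptime_hd[OF ptime_weaken[OF L]]) simp_all
    from ptime_fst[OF this[unfolded enc_pair_def[of "hd _"]]]
    have "ptime ?Q ?X (\<lambda>z. if ?L z = [] then enc_nat (fst (snd z)) else enc_nat (fst (hd (?L z))))"
      by (intro ptime_if_test[OF ptime_eq_Nil[OF L]] ptime_weaken[OF ptime_proj(3)]) simp_all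
    from ptime_Pair[OF ptime_Pair[OF ptime_proj(3) this] ptime_proj(4)]
    show "ptime ?Q ?X (\<lambda>z. enc_list enc_pair (assign_step (conflict (I (fst z)) (r (fst z))) (fst (snd z)) (snd (snd z))))"
      unfolding assign_step_def enc_list.simps enc_pair_def[of "(_, _)"] fst_conv snd_conv if_distrib[of enc_nat] .
    show "pbound P X (\<lambda>z. length (?vs z) * Suc (1 + 2 * size (enc_list enc_nat (?vs z))))"
      by (intro pbound_intros pbound_length[OF vs] ptime_pbound[OF vs])
    fix z ys zs assume z: "?vs z = ys @ zs"
    show "size (enc_list enc_pair (fold (assign_step (conflict (I z) (r z))) ys [])) \<le>
        length (?vs z) * Suc (1 + 2 * size (enc_list enc_nat (?vs z)))"
    proof (rule size_enc_list_le)
      fix p assume "p \<in> set (fold (assign_step (conflict (I z) (r z))) ys [])"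
      then have "p \<in> set ys \<times> set ys" using assign_fold[of "conflict (I z) (r z)" ys] by blast
      then have "fst p \<in> set (?vs z)" "snd p \<in> set (?vs z)" unfolding z by auto
      from this[THEN size_le_size_enc_list[of _ _ enc_nat]]
      show "size (enc_pair p) \<le> 1 + 2 * size (enc_list enc_nat (?vs z))" by (simp add: enc_pair_def)
    qed (use assign_fold[of "conflict (I z) (r z)" ys] z in simp)
  qed (auto intro: vs ptime_Nil[simplified])
qed

text \<open>The values are lengths of lists, so they appear in unary, as the code of a PCM instance
  requires.\<close>

lemma ptime_pcm_of:
  assumes I: "ptime P X (\<lambda>z. enc_supplier (I z))" and r: "ptime P X (\<lambda>z. enc_rat (r z))"
    and u: "ptime P X (\<lambda>z. enc_list (\<lambda>v. Pair (enc_nat v) (enc_unary (u z v))) (sup_customers (I z)))"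
    and ok: "\<forall>z. P z \<longrightarrow> supplier_valid fam (I z) \<and> 0 \<le> r z"
  shows "ptime P X (\<lambda>z. enc_pcm (pcm_of (I z) (r z) (u z)))"
proof -
  note rp = ptime_rep_pairs[OF I r u ok]
  let ?rp = "\<lambda>z. rep_pairs (I z) (r z) (u z)"
  note F = ptime_supplier(1)[OF I]
  \<comment> \<open>Mapping the identity changes only the code of each facility: its value is
    attached.\<close>
  have ground: "ptime P X (\<lambda>z. enc_list (\<lambda>f. Pair (enc_nat f) (enc_unary (length (filter (\<lambda>p. near (I z) (r z) f (snd p)) (?rp z)))))
      (map (\<lambda>f. f) (sup_facilities (I z))))"
  proof (rule ptime_map[OF F])
    let ?Q = "\<lambda>z. P (fst z) \<and> snd z \<in> set (sup_facilities (I (fst z)))"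
    let ?X = "\<lambda>z. Pair (X (fst z)) (enc_nat (snd z))"
    let ?Q' = "\<lambda>w. ?Q (fst w) \<and> snd w \<in> set (?rp (fst (fst w)))"
    let ?X' = "\<lambda>w. Pair (?X (fst w)) (enc_pair (snd w))"
    have Q: "\<forall>z. ?Q z \<longrightarrow> P (fst z)" by simp
    have Q': "\<forall>w. ?Q' w \<longrightarrow> ?Q (fst w)" by simp
    have p: "ptime ?Q' ?X' (\<lambda>w. Pair (enc_nat (fst (snd w))) (enc_nat (snd (snd w))))"
      unfolding enc_pair_def[of "snd _"] by (rule ptime_proj(2))
    have "ptime ?Q' ?X' (\<lambda>w. enc_bool (near (I (fst (fst w))) (r (fst (fst w))) (snd (fst w)) (snd (snd w))))"
      by (rule ptime_near[where fam = fam, OF ptime_lift[OF ptime_lift[OF I Q] Q'] ptime_lift[OF ptime_lift[OF r Q] Q']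
            ptime_lift[OF ptime_proj(2) Q'] ptime_snd[OF p]]) (use ok in simp)
    from ptime_length[OF ptime_filter[OF ptime_lift[OF rp Q] this]]
    show "ptime ?Q ?X (\<lambda>z. Pair (enc_nat (snd z)) (enc_unary (length (filter (\<lambda>p. near (I (fst z)) (r (fst z)) (snd z) (snd p)) (?rp (fst z))))))"
      by (rule ptime_Pair[OF ptime_proj(2)])
  qed
  have p: "ptime Q (\<lambda>z. Pair (X (fst z)) (enc_pair (snd z))) (\<lambda>z. Pair (enc_nat (fst (snd z))) (enc_nat (snd (snd z))))" for Q
    unfolding enc_pair_def by (rule ptime_proj(2))
  have reps: "ptime P X (\<lambda>z. enc_list enc_pair (filter (\<lambda>p. fst p = snd p) (?rp z)))"
    by (rule ptime_filter[where e = "\<lambda>_. enc_pair", OF rp]) (rule ptime_nat_eq[OF ptime_fst[OF p] ptime_snd[OF p]])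
  have parts: "ptime P X (\<lambda>z. enc_list (enc_list enc_nat) (filter (\<lambda>A. A \<noteq> []) (map (\<lambda>p. filter (\<lambda>f. near (I z) (r z) f (fst p)) (sup_facilities (I z)))
      (filter (\<lambda>p. fst p = snd p) (?rp z)))))"
  proof (rule ptime_filter[where e = "\<lambda>_. enc_list enc_nat", OF ptime_map[OF reps] ptime_not[OF ptime_eq_Nil[OF ptime_proj(2)]]])
    let ?Q = "\<lambda>z. P (fst z) \<and> snd z \<in> set (filter (\<lambda>p. fst p = snd p) (?rp (fst z)))"
    let ?X = "\<lambda>z. Pair (X (fst z)) (enc_pair (snd z))"
    let ?Q' = "\<lambda>w. ?Q (fst w) \<and> snd w \<in> set (sup_facilities (I (fst (fst w))))"
    let ?X' = "\<lambda>w. Pair (?X (fst w)) (enc_nat (snd w))"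
    have Q: "\<forall>z. ?Q z \<longrightarrow> P (fst z)" by simp
    have Q': "\<forall>w. ?Q' w \<longrightarrow> ?Q (fst w)" by simp
    have "ptime ?Q' ?X' (\<lambda>w. enc_bool (near (I (fst (fst w))) (r (fst (fst w))) (snd w) (fst (snd (fst w)))))"
      by (rule ptime_near[where fam = fam, OF ptime_lift[OF ptime_lift[OF I Q] Q'] ptime_lift[OF ptime_lift[OF r Q] Q']
            ptime_proj(2) ptime_lift[OF ptime_fst[OF p] Q']]) (use ok in simp)
    from ptime_filter[OF ptime_lift[OF F Q] this]
    show "ptime ?Q ?X (\<lambda>z. enc_list enc_nat (filter (\<lambda>f. near (I (fst z)) (r (fst z)) f (fst (snd z))) (sup_facilities (I (fst z)))))" .
  qed
  from ptime_Pair[OF ground ptime_Pair[OF parts ptime_supplier(5)[OF I]]]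
  show ?thesis by (simp add: enc_pcm_def pcm_of_def)
qed

lemma ptime_covered:
  assumes I: "ptime P X (\<lambda>z. enc_supplier (I z))" and r: "ptime P X (\<lambda>z. enc_rat (r z))"
    and u: "ptime P X (\<lambda>z. enc_list (\<lambda>v. Pair (enc_nat v) (enc_unary (u z v))) (sup_customers (I z)))"
    and y: "ptime P X (\<lambda>z. enc_list enc_nat (y z))"
    and ok: "\<forall>z. P z \<longrightarrow> supplier_valid fam (I z) \<and> 0 \<le> r z"
  shows "ptime P X (\<lambda>z. enc_unary (covered (I z) (r z) (u z) (y z)))"
  unfolding covered_def
proof (rule ptime_length[OF ptime_filter[where e = "\<lambda>_. enc_pair", OF ptime_rep_pairs[OF I r u ok]]])
  let ?Q = "\<lambda>z. P (fst z) \<and> snd z \<in> set (rep_pairs (I (fst z)) (r (fst z)) (u (fst z)))"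
  let ?X = "\<lambda>z. Pair (X (fst z)) (enc_pair (snd z))"
  let ?Q' = "\<lambda>w. ?Q (fst w) \<and> snd w \<in> set (y (fst (fst w)))"
  let ?X' = "\<lambda>w. Pair (?X (fst w)) (enc_nat (snd w))"
  have Q: "\<forall>z. ?Q z \<longrightarrow> P (fst z)" by simp
  have Q': "\<forall>w. ?Q' w \<longrightarrow> ?Q (fst w)" by simp
  have p: "ptime ?Q ?X (\<lambda>z. Pair (enc_nat (fst (snd z))) (enc_nat (snd (snd z))))"
    unfolding enc_pair_def by (rule ptime_proj(2))
  have "ptime ?Q' ?X' (\<lambda>w. enc_bool (near (I (fst (fst w))) (r (fst (fst w))) (snd w) (snd (snd (fst w)))))"
    by (rule ptime_near[where fam = fam, OF ptime_lift[OF ptime_lift[OF I Q] Q'] ptime_lift[OF ptime_lift[OF r Q] Q']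
          ptime_proj(2) ptime_lift[OF ptime_snd[OF p] Q']]) (use ok in simp)
  from ptime_Bex[OF ptime_lift[OF y Q] this]
  show "ptime ?Q ?X (\<lambda>z. enc_bool (\<exists>f\<in>set (y (fst z)). near (I (fst z)) (r (fst z)) f (snd (snd z))))" .
qed

lemma ptime_penalize:
  assumes I: "ptime P X (\<lambda>z. enc_supplier (I z))" and r: "ptime P X (\<lambda>z. enc_rat (r z))"
    and u: "ptime P X (\<lambda>z. enc_list (\<lambda>v. Pair (enc_nat v) (enc_unary (u z v))) (sup_customers (I z)))"
    and ok: "\<forall>z. P z \<longrightarrow> supplier_valid fam (I z) \<and> 0 \<le> r z"
  shows "ptime P X (\<lambda>z. enc_list (\<lambda>v. Pair (enc_nat v) (enc_unary (penalize (I z) (r z) (u z) v))) (sup_customers (I z)))"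
proof -
  have "ptime P X (\<lambda>z. enc_list (\<lambda>v. Pair (enc_nat v) (enc_unary (penalize (I z) (r z) (u z) v))) (map (\<lambda>v. v) (sup_customers (I z))))"
    unfolding penalize_def
  proof (rule ptime_map[OF u])
    let ?Q = "\<lambda>z. P (fst z) \<and> snd z \<in> set (sup_customers (I (fst z)))"
    let ?X = "\<lambda>z. Pair (X (fst z)) (Pair (enc_nat (snd z)) (enc_unary (u (fst z) (snd z))))"
    let ?rp = "\<lambda>z. rep_pairs (I z) (r z) (u z)"
    let ?Q' = "\<lambda>w. ?Q (fst w) \<and> snd w \<in> set (?rp (fst (fst w)))"
    let ?X' = "\<lambda>w. Pair (?X (fst w)) (enc_pair (snd w))"
    have Q: "\<forall>z. ?Q z \<longrightarrow> P (fst z)" by simp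
    have Q': "\<forall>w. ?Q' w \<longrightarrow> ?Q (fst w)" by simp
    have p: "ptime ?Q' ?X' (\<lambda>w. Pair (enc_nat (fst (snd w))) (enc_nat (snd (snd w))))"
      unfolding enc_pair_def by (rule ptime_proj(2))
    from ptime_nat_eq[OF ptime_snd[OF p] ptime_lift[OF ptime_proj(3) Q']]
    have "ptime ?Q' ?X' (\<lambda>w. enc_bool (snd (snd w) = snd (fst w)))" .
    from ptime_filter[OF ptime_lift[OF ptime_rep_pairs[OF I r u ok] Q] this]
    have "ptime ?Q ?X (\<lambda>z. enc_list enc_pair (filter (\<lambda>p. snd p = snd z) (?rp (fst z))))" by simp
    from ptime_Pair[OF ptime_proj(3) ptime_unary_add[OF ptime_proj(4) ptime_length[OF this]]]
    show "ptime ?Q ?X (\<lambda>z. Pair (enc_nat (snd z)) (enc_unary (u (fst z) (snd z) + length (filter (\<lambda>p. snd p = snd z) (?rp (fst z))))))" .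
  qed
  then show ?thesis by simp
qed

text \<open>A round assigns each customer once, so no penalty rises by more than the number of
  customers. Hence the penalties stay polynomial over all rounds, even in unary.\<close>

lemma penalize_iterates_le: "(penalize I r ^^ k) (\<lambda>_. 0) v \<le> k * length (sup_customers I)"
proof (induction k)
  case (Suc k)
  have "length (filter p (rep_pairs I r w)) \<le> length (sup_customers I)" for p w
    using length_filter_le[of p "rep_pairs I r w"] by simp
  then have "penalize I r ((penalize I r ^^ k) (\<lambda>_. 0)) v \<le> (penalize I r ^^ k) (\<lambda>_. 0) v + length (sup_customers I)"
    unfolding penalize_def[of I r "(penalize I r ^^ k) (\<lambda>_. 0)"] by simp
  also have "\<dots> \<le> Suc k * length (sup_customers I)" using Suc by simp
  finally show ?case by simp
qed simp

lemma ptime_rounds: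
  assumes I: "ptime P X (\<lambda>z. enc_supplier (I z))" and r: "ptime P X (\<lambda>z. enc_rat (r z))"
    and ok: "\<forall>z. P z \<longrightarrow> supplier_valid fam (I z) \<and> 0 \<le> r z"
  shows "ptime P X (\<lambda>z. enc_list (\<lambda>u. enc_list (\<lambda>v. Pair (enc_nat v) (enc_unary (u v))) (sup_customers (I z))) (rounds (I z) (r z)))"
proof -
  note C = ptime_supplier(2)[OF I]
  let ?C = "\<lambda>z. sup_customers (I z)"
  have rep: "ptime P X (\<lambda>z. enc_list enc_nat (concat (map (\<lambda>_. xs z) (?C z))))"
    if xs: "ptime P X (\<lambda>z. enc_list enc_nat (xs z))" for xs
    by (rule ptime_concat[where e = "\<lambda>_. enc_nat", OF ptime_map[OF C]]) (rule ptime_lift[OF xs], simp)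
  \<comment> \<open>A clock of length \<open>n ^ 3\<close>, made by nesting copies of the customer
    list.\<close>
  let ?xs = "\<lambda>z. concat (map (\<lambda>_. concat (map (\<lambda>_. ?C z) (?C z))) (?C z))"
  have xs: "ptime P X (\<lambda>z. enc_list enc_nat (?xs z))" by (intro rep C)
  have len: "length (?xs z) = length (?C z) ^ 3" for z
    by (simp add: length_concat comp_def sum_list_triv power3_eq_cube)
  let ?S = "\<lambda>z u. enc_list (\<lambda>v. Pair (enc_nat v) (enc_unary (u v))) (?C z)"
  let ?n = "\<lambda>z. length (?C z) * Suc (size (enc_list enc_nat (?C z)) + (length (?C z) ^ 3 * length (?C z) + 1))"
  have "ptime P X (\<lambda>z. enc_list (?S z) (map (\<lambda>k. (penalize (I z) (r z) ^^ k) (\<lambda>_. 0)) [0..<Suc (length (?xs z))]))"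
  proof (rule ptime_iterates[where S = ?S and n = ?n, OF xs])
    have "ptime P X (\<lambda>z. enc_list (\<lambda>v. Pair (enc_nat v) (enc_unary 0)) (map (\<lambda>v. v) (?C z)))"
      by (rule ptime_map[OF C]) (simp, intro ptime_Pair ptime_proj ptime_Atom)
    then show "ptime P X (\<lambda>z. ?S z (\<lambda>_. 0))" by simp
    show "ptime (\<lambda>w. P (fst w)) (\<lambda>w. Pair (X (fst w)) (?S (fst w) (snd w)))
        (\<lambda>w. ?S (fst w) (penalize (I (fst w)) (r (fst w)) (snd w)))"
      by (rule ptime_penalize[where fam = fam, OF ptime_lift[OF I] ptime_lift[OF r] ptime_proj(2)]) (use ok in simp_all)
    show "pbound P X ?n"
      by (intro pbound_intros pbound_length[OF C] ptime_pbound[OF C])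
    fix z k assume k: "k \<le> length (?xs z)"
    show "size (?S z ((penalize (I z) (r z) ^^ k) (\<lambda>_. 0))) \<le> ?n z"
    proof (rule size_enc_list_le)
      fix v assume "v \<in> set (?C z)"
      then have "size (enc_nat v) \<le> size (enc_list enc_nat (?C z))"
        using size_le_size_enc_list[of v "?C z" enc_nat] by simp
      moreover have "(penalize (I z) (r z) ^^ k) (\<lambda>_. 0) v \<le> length (?C z) ^ 3 * length (?C z)"
        using penalize_iterates_le[of k "I z" "r z" v] mult_le_mono1[OF k[unfolded len]] by (rule order_trans)
      ultimately show "size (Pair (enc_nat v) (enc_unary ((penalize (I z) (r z) ^^ k) (\<lambda>_. 0) v)))
          \<le> size (enc_list enc_nat (?C z)) + (length (?C z) ^ 3 * length (?C z) + 1)" by simp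
    qed simp
  qed
  then show ?thesis unfolding rounds_def len .
qed

lemma ptime_candidates:
  assumes alg: "ptime (pcm_valid fam) enc_pcm (\<lambda>J. enc_list enc_nat (alg J))"
    and ratio: "ptime (\<lambda>_. True) (\<lambda>z. Pair (enc_unary (fst z)) (enc_unary (snd z))) (\<lambda>z. enc_bool (real (fst z) \<ge> \<rho> * real (snd z)))"
  shows "ptime (supplier_valid fam) enc_supplier (\<lambda>I. enc_list enc_candidate (candidates \<rho> alg I))"
  unfolding candidates_def
proof (rule ptime_concat[where e = "\<lambda>_. enc_candidate", OF ptime_map[OF ptime_supplier(3)[OF ptime_id]]])
  let ?Q = "\<lambda>z. supplier_valid fam (fst z) \<and> snd z \<in> set (dist_table (fst z))"
  let ?X = "\<lambda>z. Pair (enc_supplier (fst z)) (enc_entry (snd z))"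
  let ?r = "\<lambda>z. snd (snd (snd z))"
  let ?enc = "\<lambda>z u. enc_list (\<lambda>v. Pair (enc_nat v) (enc_unary (u v))) (sup_customers (fst z))"
  have I: "ptime ?Q ?X (\<lambda>z. enc_supplier (fst z))" by (rule ptime_proj(1))
  have r: "ptime ?Q ?X (\<lambda>z. enc_rat (?r z))"
    unfolding enc_entry_def by (rule ptime_snd[OF ptime_snd[OF ptime_proj(2)]])
  have ok: "\<forall>z. ?Q z \<longrightarrow> supplier_valid fam (fst z) \<and> 0 \<le> ?r z"
    using dist_table_nonneg by blast
  note rounds = ptime_rounds[OF I r ok]
  let ?y = "\<lambda>w. alg (pcm_of (fst (fst w)) (?r (fst w)) (snd w))"
  \<comment> \<open>\<open>Q'\<close> is left open because the facts are used twice: for filtering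
    the rounds and for mapping over the successful ones.\<close>
  have y: "ptime Q' (\<lambda>w. Pair (?X (fst w)) (?enc (fst w) (snd w))) (\<lambda>w. enc_list enc_nat (?y w))"
    and cov: "ptime Q' (\<lambda>w. Pair (?X (fst w)) (?enc (fst w) (snd w))) (\<lambda>w. enc_bool (\<rho> * real (sup_demand (fst (fst w))) \<le>
      real (covered (fst (fst w)) (?r (fst w)) (snd w) (?y w))))"
    and r': "ptime Q' (\<lambda>w. Pair (?X (fst w)) (?enc (fst w) (snd w))) (\<lambda>w. enc_rat (?r (fst w)))"
    if Q': "\<forall>w. Q' w \<longrightarrow> ?Q (fst w)" for Q'
  proof -
    let ?X' = "\<lambda>w. Pair (?X (fst w)) (?enc (fst w) (snd w))"
    have I': "ptime Q' ?X' (\<lambda>w. enc_supplier (fst (fst w)))" by (rule ptime_lift[OF I Q'])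
    show r': "ptime Q' ?X' (\<lambda>w. enc_rat (?r (fst w)))" by (rule ptime_lift[OF r Q'])
    have u': "ptime Q' ?X' (\<lambda>w. ?enc (fst w) (snd w))" by (rule ptime_proj(2))
    have ok': "\<forall>w. Q' w \<longrightarrow> supplier_valid fam (fst (fst w)) \<and> 0 \<le> ?r (fst w)" using ok Q' by blast
    show y: "ptime Q' ?X' (\<lambda>w. enc_list enc_nat (?y w))"
    proof (rule ptime_apply[OF alg ptime_pcm_of[OF I' r' u' ok']])
      fix w assume "Q' w"
      then have "trial fam (fst (fst w))" using ok' by unfold_locales blast
      then show "pcm_valid fam (pcm_of (fst (fst w)) (?r (fst w)) (snd w))" by (rule trial.pcm_valid)
    qed
    have "ptime Q' ?X' (\<lambda>w. (\<lambda>z. Pair (enc_unary (fst z)) (enc_unary (snd z)))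
        (covered (fst (fst w)) (?r (fst w)) (snd w) (?y w), sup_demand (fst (fst w))))"
      unfolding fst_conv snd_conv
      by (rule ptime_Pair[OF ptime_covered[OF I' r' u' y ok'] ptime_supplier(4)[OF I']])
    from ptime_apply[OF ratio this]
    show "ptime Q' ?X' (\<lambda>w. enc_bool (\<rho> * real (sup_demand (fst (fst w))) \<le>
      real (covered (fst (fst w)) (?r (fst w)) (snd w) (?y w))))" by simp
  qed
  show "ptime ?Q ?X (\<lambda>z. enc_list enc_candidate (map (\<lambda>u. (?r z, alg (pcm_of (fst z) (?r z) u)))
      (filter (\<lambda>u. \<rho> * real (sup_demand (fst z)) \<le> real (covered (fst z) (?r z) u (alg (pcm_of (fst z) (?r z) u))))
        (rounds (fst z) (?r z)))))"
  proof (rule ptime_map[where e' = "\<lambda>_. enc_candidate", OF ptime_filter[OF rounds cov]], blast)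
    let ?us = "\<lambda>z. filter (\<lambda>u. \<rho> * real (sup_demand (fst z)) \<le> real (covered (fst z) (?r z) u (alg (pcm_of (fst z) (?r z) u))))
        (rounds (fst z) (?r z))"
    let ?Q' = "\<lambda>w. ?Q (fst w) \<and> snd w \<in> set (?us (fst w))"
    have Q': "\<forall>w. ?Q' w \<longrightarrow> ?Q (fst w)" by blast
    show "ptime ?Q' (\<lambda>w. Pair (?X (fst w)) (?enc (fst w) (snd w)))
        (\<lambda>w. enc_candidate (?r (fst w), ?y w))"
      unfolding enc_candidate_def fst_conv snd_conv by (rule ptime_Pair[OF r'[OF Q'] y[OF Q']])
  qed
qed

lemma ptime_supplier_alg:
  assumes alg: "ptime (pcm_valid fam) enc_pcm (\<lambda>J. enc_list enc_nat (alg J))"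
    and ratio: "ptime (\<lambda>_. True) (\<lambda>z. Pair (enc_unary (fst z)) (enc_unary (snd z))) (\<lambda>z. enc_bool (real (fst z) \<ge> \<rho> * real (snd z)))"
  shows "ptime (supplier_valid fam) enc_supplier (\<lambda>I. enc_list enc_nat (supplier_alg \<rho> alg I))"
proof -
  let ?P = "supplier_valid fam" and ?X = enc_supplier
  note c = ptime_candidates[OF assms]
  have best: "ptime ?P ?X (\<lambda>I. enc_list enc_candidate (best_candidates \<rho> alg I))"
    unfolding best_candidates_def
  proof (rule ptime_filter[where e = "\<lambda>_. enc_candidate", OF c])
    let ?Q = "\<lambda>z. ?P (fst z) \<and> snd z \<in> set (candidates \<rho> alg (fst z))"
    let ?X' = "\<lambda>z. Pair (?X (fst z)) (enc_candidate (snd z))"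
    have Q: "\<forall>z. ?Q z \<longrightarrow> ?P (fst z)" by simp
    show "ptime ?Q ?X' (\<lambda>z. enc_bool (\<forall>c'\<in>set (candidates \<rho> alg (fst z)). fst (snd z) \<le> fst c'))"
    proof (rule ptime_Ball[where e = "\<lambda>_. enc_candidate", OF ptime_lift[OF c Q]])
      let ?Q' = "\<lambda>w. ?Q (fst w) \<and> snd w \<in> set (candidates \<rho> alg (fst (fst w)))"
      let ?X'' = "\<lambda>w. Pair (?X' (fst w)) (enc_candidate (snd w))"
      \<comment> \<open>Candidate radii are table entries, which makes them comparable by
        \<open>ptime_rat_le\<close>.\<close>
      have nonneg: "0 \<le> fst c" if "?P I" "c \<in> set (candidates \<rho> alg I)" for I c
        using that dist_table_nonneg[OF that(1)] by (auto simp: candidates_def)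
      show "ptime ?Q' ?X'' (\<lambda>w. enc_bool (fst (snd (fst w)) \<le> fst (snd w)))"
      proof (rule ptime_rat_le)
        show "ptime ?Q' ?X'' (\<lambda>w. enc_rat (fst (snd (fst w))))"
          unfolding enc_candidate_def by (rule ptime_fst[OF ptime_snd[OF ptime_proj(1)]])
        show "ptime ?Q' ?X'' (\<lambda>w. enc_rat (fst (snd w)))"
          unfolding enc_candidate_def[of "snd (_ :: (supplier_instance \<times> rat \<times> nat list) \<times> _)"] by (rule ptime_fst[OF ptime_proj(2)])
      qed (use nonneg in blast)+
    qed
  qed
  have "ptime (\<lambda>I. ?P I \<and> \<not> best_candidates \<rho> alg I = []) ?X (\<lambda>I. enc_candidate (hd (best_candidates \<rho> alg I)))"
    by (rule ptime_hd[OF ptime_weaken[OF best]]) simp_all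
  from ptime_snd[OF this[unfolded enc_candidate_def]]
  have "ptime ?P ?X (\<lambda>I. if best_candidates \<rho> alg I = [] then Atom else enc_list enc_nat (snd (hd (best_candidates \<rho> alg I))))"
    by (intro ptime_if_test[OF ptime_eq_Nil[OF best]] ptime_Atom) simp_all
  then show ?thesis
    unfolding supplier_alg_def if_distrib[of "enc_list enc_nat"] enc_list.simps(1) .
qed

text \<open>A solver promises some acceptable output per instance. Choosing one turns it into a
  function of the instance, the form in which the calculus composes programs.\<close>

lemma ptime_of_solves:
  assumes "poly_time_solves c code valid ok"
  obtains Y where "ptime valid code Y" "\<And>i. valid i \<Longrightarrow> ok i (Y i)"
proof -
  obtain p where p: "\<forall>i. valid i \<longrightarrow> (\<exists>t y. runs c (code i) t y \<and> t \<le> poly p (size (code i)) \<and> ok i y)"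
    using assms unfolding poly_time_solves_def by blast
  then have "\<forall>i. \<exists>y. valid i \<longrightarrow> (\<exists>t. runs c (code i) t y \<and> t \<le> poly p (size (code i))) \<and> ok i y"
    by blast
  then obtain Y where Y: "\<And>i. valid i \<Longrightarrow> (\<exists>t. runs c (code i) t (Y i) \<and> t \<le> poly p (size (code i))) \<and> ok i (Y i)"
    by metis
  have "pbound valid code (\<lambda>i. poly p (size (code i)))" by (intro pbound_intros pbound_size)
  then have "ptime valid code Y" by (rule ptime_runs) (use Y in blast)
  then show ?thesis using Y by (intro that) blast+
qed

theorem theorem9:
  fixes fam :: family_scheme and \<rho> :: real and \<A> :: com
  assumes "\<rho> \<le> 1"
    and "poly_time_ratio \<rho>"
    and "poly_time_pcm_approx fam \<rho> \<A>"
  shows "\<exists>\<B>. poly_time_bicriteria_approx fam 3 \<rho> \<B>"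
proof -
  obtain Y where Y: "ptime (pcm_valid fam) enc_pcm Y" "\<And>J. pcm_valid fam J \<Longrightarrow> pcm_approximates fam \<rho> J (Y J)"
    using assms(3) unfolding poly_time_pcm_approx_def by (rule ptime_of_solves) blast
  have "\<forall>J. \<exists>xs. pcm_valid fam J \<longrightarrow> Y J = enc_list enc_nat xs \<and>
        pcm_feasible (fam (pcm_family J)) (part_sets J) (set xs) \<and>
        real (sum (pcm_val J) (set xs)) \<ge> \<rho> * real (pcm_opt (fam (pcm_family J)) (part_sets J) (pcm_val J))"
    using Y(2) unfolding pcm_approximates_def by blast
  \<comment> \<open>The output trees are replaced by the lists they encode, on which the algorithm
    is defined.\<close>
  then obtain alg where alg: "\<And>J. pcm_valid fam J \<Longrightarrow> Y J = enc_list enc_nat (alg J) \<and>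
        pcm_feasible (fam (pcm_family J)) (part_sets J) (set (alg J)) \<and>
        real (sum (pcm_val J) (set (alg J))) \<ge> \<rho> * real (pcm_opt (fam (pcm_family J)) (part_sets J) (pcm_val J))"
    by metis
  have alg_time: "ptime (pcm_valid fam) enc_pcm (\<lambda>J. enc_list enc_nat (alg J))"
    by (rule ptime_cong[OF Y(1)]) (simp_all add: alg)
  obtain c where c: "poly_time_solves c (\<lambda>(q, m). Pair (enc_unary q) (enc_unary m)) (\<lambda>_. True)
      (\<lambda>(q, m) y. y \<noteq> Atom \<longleftrightarrow> real q \<ge> \<rho> * real m)"
    using assms(2) unfolding poly_time_ratio_def by blast
  obtain B where B: "ptime (\<lambda>_. True) (\<lambda>(q, m). Pair (enc_unary q) (enc_unary m)) B"
    "\<And>z. (case z of (q, m) \<Rightarrow> \<lambda>y. y \<noteq> Atom \<longleftrightarrow> real q \<ge> \<rho> * real m) (B z)"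
    using c by (rule ptime_of_solves) blast
  \<comment> \<open>The ratio test may answer true by any tree other than \<open>Atom\<close>;
    \<open>ptime_test\<close> normalises the answer.\<close>
  have "ptime (\<lambda>_. True) (\<lambda>(q, m). Pair (enc_unary q) (enc_unary m)) (\<lambda>z. enc_bool (real (fst z) \<ge> \<rho> * real (snd z)))"
    by (rule ptime_test[OF B(1)]) (use B(2) in \<open>simp add: case_prod_beta\<close>)
  then have "ptime (\<lambda>_. True) (\<lambda>z. Pair (enc_unary (fst z)) (enc_unary (snd z))) (\<lambda>z. enc_bool (real (fst z) \<ge> \<rho> * real (snd z)))"
    by (rule ptime_cong) auto
  from ptime_imp_runs[OF ptime_supplier_alg[OF alg_time this]]
  obtain \<B> p where "\<And>I. supplier_valid fam I \<Longrightarrow>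
      \<exists>t. runs \<B> (enc_supplier I) t (enc_list enc_nat (supplier_alg \<rho> alg I)) \<and> t \<le> poly p (size (enc_supplier I))"
    by blast
  moreover have "bicriteria_approximates fam 3 \<rho> I (enc_list enc_nat (supplier_alg \<rho> alg I))" if "supplier_valid fam I" for I
    using alg by (intro supplier_alg_correct[OF that assms(1)]) blast
  ultimately have "poly_time_bicriteria_approx fam 3 \<rho> \<B>"
    unfolding poly_time_bicriteria_approx_def poly_time_solves_def by (intro exI[of _ p]) blast
  then show ?thesis ..
qed

end
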